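(* Let $\mathcal{G}$ be an ultragraph and let $K$ be a field. A non-graded ideal of $L_K(\mathcal{G})$ is prime if and only if it is primitive.
   Context: An ultragraph $\mathcal{G}=(G^0,\mathcal{G}^1,r_{\mathcal{G}},s_{\mathcal{G}})$ consists of a countable set of vertices $G^0$, a countable set of edges $\mathcal{G}^1$, a source map $s_{\mathcal{G}}:\mathcal{G}^1\to G^0$ and a range map $r_{\mathcal{G}}:\mathcal{G}^1\to\mathcal{P}(G^0)\setminus\{\emptyset\}$. An algebra in $\mathcal{P}(X)$ is a collection of subsets of $X$ closed under $\cup,\cap,\setminus$. $\mathcal{G}^0$ (not to be confused with $G^0$) is the smallest algebra in $\mathcal{P}(G^0)$ containing all $\{v\}$, $v\in G^0$, and all $r_{\mathcal{G}}(e)$, $e\in\mathcal{G}^1$. The ultragraph Leavitt path algebra $L_K(\mathcal{G})$ is the universal $K$-algebra generated by elements $p_A$ ($A\in\mathcal{G}^0$), $s_e,s_{e^*}$ ($e\in\mathcal{G}^1$) subject to: (1) $p_\emptyset=0$, $p_Ap_B=p_{A\cap B}$, $p_{A\cup B}=p_A+p_B-p_{A\cap B}$; (2) $p_{s_{\mathcal{G}}(e)}s_e=s_ep_{r_{\mathcal{G}}(e)}=s_e$ and $p_{r_{\mathcal{G}}(e)}s_{e^*}=s_{e^*}p_{s_{\mathcal{G}}(e)}=s_{e^*}$; (3) $s_{e^*}s_f=\delta_{e,f}p_{r_{\mathcal{G}}(e)}$; (4) $p_v=\sum_{s_{\mathcal{G}}(e)=v}s_es_{e^*}$ whenever $0<|s_{\mathcal{G}}^{-1}(v)|<\infty$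 (writing $p_v=p_{\{v\}}$). It is $\mathbb{Z}$-graded, with $p_A$, $s_e$, $s_{e^*}$ of degree $0,1,-1$; a non-graded ideal is a two-sided ideal that is not graded for this grading. A ring is left primitive if it has a faithful simple left module; a two-sided ideal $I$ of a ring $R$ is left primitive if $R/I$ is a left primitive ring. Here "primitive" is read as left primitive. *)

theory Defs
  imports "HOL-Algebra.Algebra" "HOL-Library.Poly_Mapping" "HOL-Library.Countable_Set"
begin

section \<open>Rings without unit, their ideals and their modules\<close>

text \<open>
  Leavitt path algebras of ultragraphs need not have a unit, so the locales \<^locale>\<open>ring\<close>
  and \<^locale>\<open>ideal\<close> of HOL-Algebra do not apply. We keep the library's record type
  for rings and its notions that do not refer to the unit (additive subgroups, cosets, quotients,
  products of ideals); the record field \<^const>\<open>monoid.one\<close> is never used.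
\<close>

locale nonunital_ring = abelian_group R for R (structure) +
  assumes rng_m_closed: "\<lbrakk>x \<in> carrier R; y \<in> carrier R\<rbrakk> \<Longrightarrow> x \<otimes> y \<in> carrier R"
    and rng_m_assoc: "\<lbrakk>x \<in> carrier R; y \<in> carrier R; z \<in> carrier R\<rbrakk>
      \<Longrightarrow> (x \<otimes> y) \<otimes> z = x \<otimes> (y \<otimes> z)"
    and rng_l_distr: "\<lbrakk>x \<in> carrier R; y \<in> carrier R; z \<in> carrier R\<rbrakk>
      \<Longrightarrow> (x \<oplus> y) \<otimes> z = x \<otimes> z \<oplus> y \<otimes> z"
    and rng_r_distr: "\<lbrakk>x \<in> carrier R; y \<in> carrier R; z \<in> carrier R\<rbrakk>
      \<Longrightarrow> z \<otimes> (x \<oplus> y) = z \<otimes> x \<oplus> z \<otimes> y"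

definition two_sided_ideal :: "'a set \<Rightarrow> ('a, 'b) ring_scheme \<Rightarrow> bool" where
  "two_sided_ideal I R \<longleftrightarrow> additive_subgroup I R \<and>
     (\<forall>a\<in>I. \<forall>x\<in>carrier R. x \<otimes>\<^bsub>R\<^esub> a \<in> I \<and> a \<otimes>\<^bsub>R\<^esub> x \<in> I)"

definition prime_two_sided_ideal :: "'a set \<Rightarrow> ('a, 'b) ring_scheme \<Rightarrow> bool" where
  "prime_two_sided_ideal P R \<longleftrightarrow> two_sided_ideal P R \<and> P \<noteq> carrier R \<and>
     (\<forall>I J. two_sided_ideal I R \<and> two_sided_ideal J R \<and> ideal_prod R I J \<subseteq> P
        \<longrightarrow> I \<subseteq> P \<or> J \<subseteq> P)"

text \<open>A grading is given by its family of homogeneous components \<open>C n\<close>. Since the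
  components of \<open>R\<close> form a direct sum, an ideal \<open>I\<close> is the direct sum of the
  \<open>I \<inter> C n\<close> as soon as it is their sum.\<close>

definition graded_ideal :: "(int \<Rightarrow> 'a set) \<Rightarrow> 'a set \<Rightarrow> ('a, 'b) ring_scheme \<Rightarrow> bool" where
  "graded_ideal C I R \<longleftrightarrow> two_sided_ideal I R \<and>
     (\<forall>x\<in>I. \<exists>N y. finite N \<and> (\<forall>n\<in>N. y n \<in> I \<inter> C n) \<and> x = (\<Oplus>\<^bsub>R\<^esub>n\<in>N. y n))"

definition left_module :: "('a, 'b) ring_scheme \<Rightarrow> ('a, 'm) module \<Rightarrow> bool" where
  "left_module R M \<longleftrightarrow> abelian_group M \<and>
     (\<forall>a\<in>carrier R. \<forall>x\<in>carrier M. a \<odot>\<^bsub>M\<^esub> x \<in> carrier M) \<and>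
     (\<forall>a\<in>carrier R. \<forall>b\<in>carrier R. \<forall>x\<in>carrier M.
        (a \<oplus>\<^bsub>R\<^esub> b) \<odot>\<^bsub>M\<^esub> x = a \<odot>\<^bsub>M\<^esub> x \<oplus>\<^bsub>M\<^esub> b \<odot>\<^bsub>M\<^esub> x) \<and>
     (\<forall>a\<in>carrier R. \<forall>x\<in>carrier M. \<forall>y\<in>carrier M.
        a \<odot>\<^bsub>M\<^esub> (x \<oplus>\<^bsub>M\<^esub> y) = a \<odot>\<^bsub>M\<^esub> x \<oplus>\<^bsub>M\<^esub> a \<odot>\<^bsub>M\<^esub> y) \<and>
     (\<forall>a\<in>carrier R. \<forall>b\<in>carrier R. \<forall>x\<in>carrier M.
        (a \<otimes>\<^bsub>R\<^esub> b) \<odot>\<^bsub>M\<^esub> x = a \<odot>\<^bsub>M\<^esub> (b \<odot>\<^bsub>M\<^esub> x))"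

definition simple_left_module :: "('a, 'b) ring_scheme \<Rightarrow> ('a, 'm) module \<Rightarrow> bool" where
  "simple_left_module R M \<longleftrightarrow> left_module R M \<and>
     (\<exists>a\<in>carrier R. \<exists>x\<in>carrier M. a \<odot>\<^bsub>M\<^esub> x \<noteq> \<zero>\<^bsub>M\<^esub>) \<and>
     (\<forall>N. submodule N R M \<longrightarrow> N = {\<zero>\<^bsub>M\<^esub>} \<or> N = carrier M)"

definition faithful_left_module :: "('a, 'b) ring_scheme \<Rightarrow> ('a, 'm) module \<Rightarrow> bool" where
  "faithful_left_module R M \<longleftrightarrow> left_module R M \<and>
     (\<forall>a\<in>carrier R. (\<forall>x\<in>carrier M. a \<odot>\<^bsub>M\<^esub> x = \<zero>\<^bsub>M\<^esub>) \<longrightarrow> a = \<zero>\<^bsub>R\<^esub>)"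

text \<open>HOL cannot quantify over the type of the elements of the module. The modules
  over the fixed type \<^typ>\<open>'a set\<close> suffice: a simple module is a quotient of the
  ring by a left ideal, and lemma \<open>left_primitive_ringI\<close> below shows that a faithful simple
  module over any type yields one over \<^typ>\<open>'a set\<close>.\<close>

definition left_primitive_ring :: "('a, 'b) ring_scheme \<Rightarrow> bool" where
  "left_primitive_ring R \<longleftrightarrow>
     (\<exists>M :: ('a, 'a set) module. simple_left_module R M \<and> faithful_left_module R M)"

definition left_primitive_ideal :: "'a set \<Rightarrow> ('a, 'b) ring_scheme \<Rightarrow> bool" where
  "left_primitive_ideal I R \<longleftrightarrow> two_sided_ideal I R \<and> left_primitive_ring (R Quot I)"


section \<open>Ultragraphs\<close>

record ('v, 'e) ugraph =
  verts :: "'v set"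
  edges :: "'e set"
  src :: "'e \<Rightarrow> 'v"
  rge :: "'e \<Rightarrow> 'v set"

definition ultragraph :: "('v, 'e) ugraph \<Rightarrow> bool" where
  "ultragraph G \<longleftrightarrow> countable (verts G) \<and> countable (edges G) \<and>
     (\<forall>e\<in>edges G. src G e \<in> verts G \<and> rge G e \<subseteq> verts G \<and> rge G e \<noteq> {})"

text \<open>The empty set is included explicitly; it is a difference \<open>A - A\<close> unless there
  are no vertices at all.\<close>

inductive_set gen_verts :: "('v, 'e) ugraph \<Rightarrow> 'v set set" for G where
  gv_empty: "{} \<in> gen_verts G"
| gv_vert: "v \<in> verts G \<Longrightarrow> {v} \<in> gen_verts G"
| gv_range: "e \<in> edges G \<Longrightarrow> rge G e \<in> gen_verts G"
| gv_Un: "\<lbrakk>A \<in> gen_verts G; B \<in> gen_verts G\<rbrakk> \<Longrightarrow> A \<union> B \<in> gen_verts G"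
| gv_Int: "\<lbrakk>A \<in> gen_verts G; B \<in> gen_verts G\<rbrakk> \<Longrightarrow> A \<inter> B \<in> gen_verts G"
| gv_Diff: "\<lbrakk>A \<in> gen_verts G; B \<in> gen_verts G\<rbrakk> \<Longrightarrow> A - B \<in> gen_verts G"


section \<open>The free algebra on the generators\<close>

datatype ('v, 'e) generator = Proj "'v set" | Edge 'e | Ghost 'e

definition generators :: "('v, 'e) ugraph \<Rightarrow> ('v, 'e) generator set" where
  "generators G = Proj ` gen_verts G \<union> Edge ` edges G \<union> Ghost ` edges G"

text \<open>Words form an additively written monoid under concatenation, so that the convolution
  product of \<^theory>\<open>HOL-Library.Poly_Mapping\<close> turns the finitely supported functions on
  words into the free algebra with unit. The free algebra without unit on the generators of
  \<open>G\<close> consists of the combinations of nonempty words in these generators.\<close>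

datatype 'a word = Word (letters: "'a list")

instantiation word :: (type) monoid_add
begin

definition zero_word :: "'a word" where "0 = Word []"

definition plus_word :: "'a word \<Rightarrow> 'a word \<Rightarrow> 'a word" where
  "u + w = Word (letters u @ letters w)"

instance
  by standard (auto simp: zero_word_def plus_word_def)

end

type_synonym ('v, 'e, 'k) free_elem = "('v, 'e) generator word \<Rightarrow>\<^sub>0 'k"

definition gen_words :: "('v, 'e) ugraph \<Rightarrow> ('v, 'e) generator word set" where
  "gen_words G = {w. w \<noteq> 0 \<and> set (letters w) \<subseteq> generators G}"

definition free_alg :: "('v, 'e) ugraph \<Rightarrow> ('v, 'e, 'k::field) free_elem ring" where
  "free_alg G = \<lparr>carrier = {f. Poly_Mapping.keys f \<subseteq> gen_words G},
     monoid.mult = (*), monoid.one = undefined, ring.zero = 0, ring.add = (+)\<rparr>"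

definition gen_elem :: "('v, 'e) generator \<Rightarrow> ('v, 'e, 'k::field) free_elem" where
  "gen_elem x = Poly_Mapping.single (Word [x]) 1"

abbreviation pp :: "'v set \<Rightarrow> ('v, 'e, 'k::field) free_elem" where
  "pp A \<equiv> gen_elem (Proj A)"

abbreviation ss :: "'e \<Rightarrow> ('v, 'e, 'k::field) free_elem" where
  "ss e \<equiv> gen_elem (Edge e)"

abbreviation gg :: "'e \<Rightarrow> ('v, 'e, 'k::field) free_elem" where
  "gg e \<equiv> gen_elem (Ghost e)"


section \<open>The ultragraph Leavitt path algebra\<close>

text \<open>A relation \<open>x = y\<close> is recorded as the element \<open>x - y\<close> of the free algebra.\<close>

inductive_set lpa_relations :: "('v, 'e) ugraph \<Rightarrow> ('v, 'e, 'k::field) free_elem set" for G where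
  rel_p_empty: "pp {} \<in> lpa_relations G"
| rel_p_mult: "\<lbrakk>A \<in> gen_verts G; B \<in> gen_verts G\<rbrakk>
    \<Longrightarrow> pp A * pp B - pp (A \<inter> B) \<in> lpa_relations G"
| rel_p_Un: "\<lbrakk>A \<in> gen_verts G; B \<in> gen_verts G\<rbrakk>
    \<Longrightarrow> pp (A \<union> B) - (pp A + pp B - pp (A \<inter> B)) \<in> lpa_relations G"
| rel_src_edge: "e \<in> edges G \<Longrightarrow> pp {src G e} * ss e - ss e \<in> lpa_relations G"
| rel_edge_rge: "e \<in> edges G \<Longrightarrow> ss e * pp (rge G e) - ss e \<in> lpa_relations G"
| rel_rge_ghost: "e \<in> edges G \<Longrightarrow> pp (rge G e) * gg e - gg e \<in> lpa_relations G"
| rel_ghost_src: "e \<in> edges G \<Longrightarrow> gg e * pp {src G e} - gg e \<in> lpa_relations G"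
| rel_ghost_edge: "\<lbrakk>e \<in> edges G; f \<in> edges G\<rbrakk>
    \<Longrightarrow> gg e * ss f - (if e = f then pp (rge G e) else 0) \<in> lpa_relations G"
| rel_regular: "\<lbrakk>v \<in> verts G; {e \<in> edges G. src G e = v} \<noteq> {}; finite {e \<in> edges G. src G e = v}\<rbrakk>
    \<Longrightarrow> pp {v} - (\<Sum>e\<in>{e \<in> edges G. src G e = v}. ss e * gg e) \<in> lpa_relations G"

text \<open>The relations are factored out as in \<open>K\<close>-algebras: the ideal is also closed under
  scalars, the scalar multiple of \<open>f\<close> by \<open>c\<close> being
  \<open>Poly_Mapping.single 0 c * f\<close>. This is not automatic in an algebra without unit.\<close>

definition lpa_ideal :: "('v, 'e) ugraph \<Rightarrow> ('v, 'e, 'k::field) free_elem set" where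
  "lpa_ideal G = \<Inter> {J. two_sided_ideal J (free_alg G) \<and>
     (\<forall>c. \<forall>f\<in>J. Poly_Mapping.single 0 c * f \<in> J) \<and> lpa_relations G \<subseteq> J}"

definition lpa :: "('v, 'e) ugraph \<Rightarrow> ('v, 'e, 'k::field) free_elem set ring" where
  "lpa G = free_alg G Quot lpa_ideal G"

fun generator_degree :: "('v, 'e) generator \<Rightarrow> int" where
  "generator_degree (Proj A) = 0"
| "generator_degree (Edge e) = 1"
| "generator_degree (Ghost e) = - 1"

definition word_degree :: "('v, 'e) generator word \<Rightarrow> int" where
  "word_degree w = (\<Sum>x\<leftarrow>letters w. generator_degree x)"

definition lpa_component ::
    "('v, 'e) ugraph \<Rightarrow> int \<Rightarrow> ('v, 'e, 'k::field) free_elem set set" where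
  "lpa_component G n = {lpa_ideal G +>\<^bsub>free_alg G\<^esub> f | f.
     f \<in> carrier (free_alg G) \<and> (\<forall>w\<in>Poly_Mapping.keys f. word_degree w = n)}"


section \<open>Basic facts\<close>

text \<open>Independence of the notion of primitivity of the type of the module.\<close>

lemma left_moduleD:
  assumes "left_module R M"
  shows "abelian_group M"
    and "\<lbrakk>a \<in> carrier R; x \<in> carrier M\<rbrakk> \<Longrightarrow> a \<odot>\<^bsub>M\<^esub> x \<in> carrier M"
    and "\<lbrakk>a \<in> carrier R; b \<in> carrier R; x \<in> carrier M\<rbrakk>
      \<Longrightarrow> (a \<oplus>\<^bsub>R\<^esub> b) \<odot>\<^bsub>M\<^esub> x = a \<odot>\<^bsub>M\<^esub> x \<oplus>\<^bsub>M\<^esub> b \<odot>\<^bsub>M\<^esub> x"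
    and "\<lbrakk>a \<in> carrier R; x \<in> carrier M; y \<in> carrier M\<rbrakk>
      \<Longrightarrow> a \<odot>\<^bsub>M\<^esub> (x \<oplus>\<^bsub>M\<^esub> y) = a \<odot>\<^bsub>M\<^esub> x \<oplus>\<^bsub>M\<^esub> a \<odot>\<^bsub>M\<^esub> y"
    and "\<lbrakk>a \<in> carrier R; b \<in> carrier R; x \<in> carrier M\<rbrakk>
      \<Longrightarrow> (a \<otimes>\<^bsub>R\<^esub> b) \<odot>\<^bsub>M\<^esub> x = a \<odot>\<^bsub>M\<^esub> (b \<odot>\<^bsub>M\<^esub> x)"
  using assms unfolding left_module_def by blast+

lemma transport_abelian_group:
  fixes M :: "('a, 'm) module" and h :: "'m \<Rightarrow> 'n"
  assumes M: "abelian_group M" and inj: "inj_on h (carrier M)"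
    and N: "carrier N = h ` carrier M" "\<zero>\<^bsub>N\<^esub> = h \<zero>\<^bsub>M\<^esub>"
    and add: "\<And>x y. \<lbrakk>x \<in> carrier M; y \<in> carrier M\<rbrakk> \<Longrightarrow> h x \<oplus>\<^bsub>N\<^esub> h y = h (x \<oplus>\<^bsub>M\<^esub> y)"
  shows "abelian_group N"
proof -
  interpret M: abelian_group M by (fact M)
  show ?thesis
  proof (rule abelian_groupI)
    fix x assume "x \<in> carrier N"
    then obtain x' where x': "x' \<in> carrier M" "x = h x'" by (auto simp: N)
    have "h (\<ominus>\<^bsub>M\<^esub> x') \<oplus>\<^bsub>N\<^esub> x = \<zero>\<^bsub>N\<^esub>"
      using x' by (simp add: add N M.l_neg)
    then show "\<exists>y\<in>carrier N. y \<oplus>\<^bsub>N\<^esub> x = \<zero>\<^bsub>N\<^esub>"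
      using x' by (auto simp: N)
  next
    fix x y assume "x \<in> carrier N" "y \<in> carrier N"
    then show "x \<oplus>\<^bsub>N\<^esub> y = y \<oplus>\<^bsub>N\<^esub> x"
      by (auto simp: N add M.a_comm)
  qed (auto simp: N add M.a_assoc)
qed

lemma left_primitive_ringI:
  fixes R :: "('a, 'b) ring_scheme" and M :: "('a, 'm) module"
  assumes simple: "simple_left_module R M" and faithful: "faithful_left_module R M"
    and R: "nonunital_ring R"
  shows "left_primitive_ring R"
proof -
  interpret R: nonunital_ring R by (fact R)
  have lm: "left_module R M" using simple by (simp add: simple_left_module_def)
  note lmD = left_moduleD[OF lm]
  interpret M: abelian_group M by (rule lmD(1))
  have zeroR: "\<zero>\<^bsub>R\<^esub> \<odot>\<^bsub>M\<^esub> x = \<zero>\<^bsub>M\<^esub>" if "x \<in> carrier M" for x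
  proof -
    have "\<zero>\<^bsub>R\<^esub> \<odot>\<^bsub>M\<^esub> x \<oplus>\<^bsub>M\<^esub> \<zero>\<^bsub>R\<^esub> \<odot>\<^bsub>M\<^esub> x = \<zero>\<^bsub>R\<^esub> \<odot>\<^bsub>M\<^esub> x"
      using lmD(3)[of "\<zero>\<^bsub>R\<^esub>" "\<zero>\<^bsub>R\<^esub>" x] that by simp
    then show ?thesis
      using lmD(2)[of "\<zero>\<^bsub>R\<^esub>" x] that by simp
  qed
  obtain a0 x0 where a0: "a0 \<in> carrier R" "x0 \<in> carrier M" "a0 \<odot>\<^bsub>M\<^esub> x0 \<noteq> \<zero>\<^bsub>M\<^esub>"
    using simple by (auto simp: simple_left_module_def)
  define Q where "Q = (\<lambda>a. a \<odot>\<^bsub>M\<^esub> x0) ` carrier R"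
  have "submodule Q R M"
  proof (intro submodule.intro subgroup.intro submodule_axioms.intro)
    show "Q \<subseteq> carrier (add_monoid M)"
      using lmD(2) a0 by (auto simp: Q_def)
  next
    fix x y assume "x \<in> Q" "y \<in> Q"
    then obtain a b where ab: "a \<in> carrier R" "b \<in> carrier R"
      "x = a \<odot>\<^bsub>M\<^esub> x0" "y = b \<odot>\<^bsub>M\<^esub> x0" by (auto simp: Q_def)
    then have "x \<oplus>\<^bsub>M\<^esub> y = (a \<oplus>\<^bsub>R\<^esub> b) \<odot>\<^bsub>M\<^esub> x0" using lmD(3) a0 by simp
    then show "x \<otimes>\<^bsub>add_monoid M\<^esub> y \<in> Q" using ab by (auto simp: Q_def)
  next
    show "\<one>\<^bsub>add_monoid M\<^esub> \<in> Q"
      using zeroR[OF a0(2)] by (auto simp: Q_def intro!: image_eqI[where x = "\<zero>\<^bsub>R\<^esub>"])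
  next
    fix x assume "x \<in> Q"
    then obtain a where a: "a \<in> carrier R" "x = a \<odot>\<^bsub>M\<^esub> x0" by (auto simp: Q_def)
    have "(\<ominus>\<^bsub>R\<^esub> a) \<odot>\<^bsub>M\<^esub> x0 \<oplus>\<^bsub>M\<^esub> x = \<zero>\<^bsub>M\<^esub>"
      using lmD(3)[of "\<ominus>\<^bsub>R\<^esub> a" a x0] a a0 zeroR by (simp add: R.l_neg)
    then have "\<ominus>\<^bsub>M\<^esub> x = (\<ominus>\<^bsub>R\<^esub> a) \<odot>\<^bsub>M\<^esub> x0"
      using M.minus_equality a a0 lmD(2) by simp
    then show "inv\<^bsub>add_monoid M\<^esub> x \<in> Q"
      using a by (auto simp: Q_def a_inv_def)
  next
    fix a x assume a: "a \<in> carrier R" and "x \<in> Q"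
    then obtain b where b: "b \<in> carrier R" "x = b \<odot>\<^bsub>M\<^esub> x0" by (auto simp: Q_def)
    then have "a \<odot>\<^bsub>M\<^esub> x = (a \<otimes>\<^bsub>R\<^esub> b) \<odot>\<^bsub>M\<^esub> x0" using lmD(5) a a0 by simp
    then show "a \<odot>\<^bsub>M\<^esub> x \<in> Q" using a b R.rng_m_closed by (auto simp: Q_def)
  qed
  moreover have "Q \<noteq> {\<zero>\<^bsub>M\<^esub>}" using a0 by (auto simp: Q_def)
  ultimately have Q: "Q = carrier M"
    using simple by (auto simp: simple_left_module_def)
  define h where "h x = {a \<in> carrier R. a \<odot>\<^bsub>M\<^esub> x0 = x}" for x
  define g where "g = inv_into (carrier M) h"
  have ne: "\<exists>a. a \<in> h x" if "x \<in> carrier M" for x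
    using that unfolding Q[symmetric] by (auto simp: h_def Q_def)
  have inj: "inj_on h (carrier M)"
  proof (rule inj_onI)
    fix x y assume "x \<in> carrier M" "h x = h y"
    then show "x = y" using ne[of x] by (auto simp: h_def)
  qed
  have gh: "g (h x) = x" if "x \<in> carrier M" for x
    using inj that by (simp add: g_def)
  define N :: "('a, 'a set) module" where
    "N = \<lparr>carrier = h ` carrier M, monoid.mult = undefined, monoid.one = undefined, ring.zero = h \<zero>\<^bsub>M\<^esub>,
      ring.add = (\<lambda>u w. h (g u \<oplus>\<^bsub>M\<^esub> g w)), smult = (\<lambda>a u. h (a \<odot>\<^bsub>M\<^esub> g u))\<rparr>"
  have N: "carrier N = h ` carrier M" "\<zero>\<^bsub>N\<^esub> = h \<zero>\<^bsub>M\<^esub>"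
    by (simp_all add: N_def)
  have Nadd: "h x \<oplus>\<^bsub>N\<^esub> h y = h (x \<oplus>\<^bsub>M\<^esub> y)" if "x \<in> carrier M" "y \<in> carrier M" for x y
    using that by (simp add: N_def gh)
  have Nsm: "a \<odot>\<^bsub>N\<^esub> h x = h (a \<odot>\<^bsub>M\<^esub> x)" if "x \<in> carrier M" for a x
    using that by (simp add: N_def gh)
  have abN: "abelian_group N"
    by (rule transport_abelian_group[OF lmD(1) inj N Nadd])
  then interpret N: abelian_group N .
  have lmN: "left_module R N"
    unfolding left_module_def using abN lmD(2-)
    by (auto simp: N(1) Nadd Nsm)
  have hz: "h x = \<zero>\<^bsub>N\<^esub> \<longleftrightarrow> x = \<zero>\<^bsub>M\<^esub>" if "x \<in> carrier M" for x
    using inj that by (auto simp: N inj_on_def)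
  have "simple_left_module R N"
    unfolding simple_left_module_def
  proof (intro conjI lmN allI impI)
    show "\<exists>a\<in>carrier R. \<exists>x\<in>carrier N. a \<odot>\<^bsub>N\<^esub> x \<noteq> \<zero>\<^bsub>N\<^esub>"
      using a0 lmD(2) by (intro bexI[of _ a0] bexI[of _ "h x0"]) (auto simp: Nsm hz N(1))
  next
    fix T assume T: "submodule T R N"
    interpret T: subgroup T "add_monoid N" using T by (rule submodule.axioms)
    define U where "U = {x \<in> carrier M. h x \<in> T}"
    have TU: "T = h ` U" using T.subset by (auto simp: U_def N)
    have "submodule U R M"
    proof (intro submodule.intro subgroup.intro submodule_axioms.intro)
      fix x assume x: "x \<in> U"
      have "h (\<ominus>\<^bsub>M\<^esub> x) \<oplus>\<^bsub>N\<^esub> h x = \<zero>\<^bsub>N\<^esub>"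
        using x by (auto simp: U_def Nadd N M.l_neg)
      then have "\<ominus>\<^bsub>N\<^esub> (h x) = h (\<ominus>\<^bsub>M\<^esub> x)"
        using x by (intro N.minus_equality) (auto simp: U_def N)
      moreover have "\<ominus>\<^bsub>N\<^esub> (h x) \<in> T"
        using x T.m_inv_closed by (simp add: U_def a_inv_def)
      ultimately have "\<ominus>\<^bsub>M\<^esub> x \<in> U" using x by (auto simp: U_def)
      then show "inv\<^bsub>add_monoid M\<^esub> x \<in> U" by (simp add: a_inv_def)
    next
      fix x y assume "x \<in> U" "y \<in> U"
      then show "x \<otimes>\<^bsub>add_monoid M\<^esub> y \<in> U"
        using T.m_closed[of "h x" "h y"] by (auto simp: U_def Nadd)
    next
      show "\<one>\<^bsub>add_monoid M\<^esub> \<in> U"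
        using T.one_closed by (simp add: U_def N)
    next
      fix a x assume "a \<in> carrier R" "x \<in> U"
      then show "a \<odot>\<^bsub>M\<^esub> x \<in> U"
        using submodule.smult_closed[OF T, of a "h x"] lmD(2) by (auto simp: U_def Nsm)
    qed (auto simp: U_def)
    then have "U = {\<zero>\<^bsub>M\<^esub>} \<or> U = carrier M"
      using simple by (auto simp: simple_left_module_def)
    then show "T = {\<zero>\<^bsub>N\<^esub>} \<or> T = carrier N"
      unfolding TU by (auto simp: N)
  qed
  moreover have "faithful_left_module R N"
    unfolding faithful_left_module_def
  proof (intro conjI lmN ballI impI)
    fix a assume a: "a \<in> carrier R" "\<forall>x\<in>carrier N. a \<odot>\<^bsub>N\<^esub> x = \<zero>\<^bsub>N\<^esub>"
    then have "\<forall>x\<in>carrier M. a \<odot>\<^bsub>M\<^esub> x = \<zero>\<^bsub>M\<^esub>"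
      using lmD(2) by (auto simp: N(1) Nsm hz)
    then show "a = \<zero>\<^bsub>R\<^esub>"
      using faithful a by (auto simp: faithful_left_module_def)
  qed
  ultimately show ?thesis
    unfolding left_primitive_ring_def by blast
qed


text \<open>The construction yields a ring.\<close>

lemma two_sided_idealD:
  assumes "two_sided_ideal I R"
  shows "additive_subgroup I R"
    and "\<lbrakk>a \<in> I; x \<in> carrier R\<rbrakk> \<Longrightarrow> x \<otimes>\<^bsub>R\<^esub> a \<in> I"
    and "\<lbrakk>a \<in> I; x \<in> carrier R\<rbrakk> \<Longrightarrow> a \<otimes>\<^bsub>R\<^esub> x \<in> I"
  using assms unfolding two_sided_ideal_def by blast+

lemma (in nonunital_ring) rng_rcoset_mult:
  assumes I: "two_sided_ideal I R" and x: "x \<in> carrier R" and y: "y \<in> carrier R"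
  shows "rcoset_mult R I (I +> x) (I +> y) = I +> (x \<otimes> y)"
proof -
  interpret I: additive_subgroup I R by (rule two_sided_idealD(1)[OF I])
  interpret I: abelian_subgroup I R
    by (rule abelian_subgroupI3) (unfold_locales)
  note idl = two_sided_idealD(2,3)[OF I]
  have eq: "I +> (a \<otimes> b) = I +> (x \<otimes> y)" if "a \<in> I +> x" "b \<in> I +> y" for a b
  proof -
    obtain i j where ij: "i \<in> I" "j \<in> I" "a = i \<oplus> x" "b = j \<oplus> y"
      using \<open>a \<in> I +> x\<close> \<open>b \<in> I +> y\<close> by (auto simp: a_r_coset_def')
    have car: "i \<in> carrier R" "j \<in> carrier R"
      using ij by (auto intro: I.a_Hcarr)
    have "a \<otimes> b = (i \<otimes> b \<oplus> x \<otimes> j) \<oplus> x \<otimes> y"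
      using car x y ij by (simp add: rng_l_distr rng_r_distr rng_m_closed a_ac)
    moreover have "i \<otimes> b \<oplus> x \<otimes> j \<in> I"
      using ij car x y idl by (intro I.a_closed) auto
    ultimately have "a \<otimes> b \<in> I +> (x \<otimes> y)" by (auto simp: a_r_coset_def')
    then show ?thesis
      using I.a_repr_independence' x y rng_m_closed by metis
  qed
  have "x \<in> I +> x" "y \<in> I +> y"
    using x y by (auto intro: I.a_rcos_self)
  then show ?thesis
    unfolding rcoset_mult_def using eq by blast
qed

lemma (in nonunital_ring) nonunital_ring_Quot:
  assumes I: "two_sided_ideal I R"
  shows "nonunital_ring (R Quot I)"
proof -
  interpret I: additive_subgroup I R by (rule two_sided_idealD(1)[OF I])
  interpret I: abelian_subgroup I R
    by (rule abelian_subgroupI3) (unfold_locales)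
  show ?thesis
  proof (intro nonunital_ring.intro nonunital_ring_axioms.intro)
    show "abelian_group (R Quot I)"
      by (rule comm_group_abelian_groupI)
        (simp add: FactRing_def I.a_factorgroup_is_comm_group[unfolded A_FactGroup_def'])
  qed (auto simp: FactRing_simps rng_rcoset_mult[OF I] I.a_rcos_sum rng_l_distr rng_r_distr
        rng_m_assoc rng_m_closed)
qed

lemma free_alg_simps:
  "carrier (free_alg G) = {f. Poly_Mapping.keys f \<subseteq> gen_words G}"
  "x \<otimes>\<^bsub>free_alg G\<^esub> y = x * y" "x \<oplus>\<^bsub>free_alg G\<^esub> y = x + y" "\<zero>\<^bsub>free_alg G\<^esub> = 0"
  by (simp_all add: free_alg_def)

lemma gen_words_add: "\<lbrakk>u \<in> gen_words G; w \<in> gen_words G\<rbrakk> \<Longrightarrow> u + w \<in> gen_words G"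
  by (cases u; cases w) (auto simp: gen_words_def plus_word_def zero_word_def)

lemma free_alg_closed:
  assumes "x \<in> carrier (free_alg G)" "y \<in> carrier (free_alg G)"
  shows "x + y \<in> carrier (free_alg G)" "x - y \<in> carrier (free_alg G)"
    and "x * y \<in> carrier (free_alg G)" "- x \<in> carrier (free_alg G)"
proof -
  show "x + y \<in> carrier (free_alg G)" "x - y \<in> carrier (free_alg G)"
    using assms Poly_Mapping.keys_add[of x y] keys_diff[of x y] by (auto simp: free_alg_simps)
  show "x * y \<in> carrier (free_alg G)"
    using assms keys_mult[of x y] gen_words_add by (fastforce simp: free_alg_simps)
  show "- x \<in> carrier (free_alg G)"
    using assms by (simp add: free_alg_simps)
qed

lemma nonunital_ring_free_alg: "nonunital_ring (free_alg G)"
proof (intro nonunital_ring.intro nonunital_ring_axioms.intro abelian_groupI)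
  fix x assume x: "x \<in> carrier (free_alg G)"
  show "\<exists>y\<in>carrier (free_alg G). y \<oplus>\<^bsub>free_alg G\<^esub> x = \<zero>\<^bsub>free_alg G\<^esub>"
    using free_alg_closed(4)[OF x x] by (intro bexI[of _ "- x"]) (auto simp: free_alg_simps)
qed (simp_all add: free_alg_simps(2-4) free_alg_closed algebra_simps, simp add: free_alg_simps)

lemma gen_elem_closed: "x \<in> generators G \<Longrightarrow> gen_elem x \<in> carrier (free_alg G)"
  by (auto simp: free_alg_simps gen_elem_def gen_words_def zero_word_def)

lemma free_alg_sum_closed:
  assumes "\<And>i. i \<in> A \<Longrightarrow> f i \<in> carrier (free_alg G)"
  shows "sum f A \<in> carrier (free_alg G)"
  using assms
proof (induction A rule: infinite_finite_induct)
  case (insert i A)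
  then show ?case by (simp add: free_alg_closed)
qed (auto simp: free_alg_simps)

lemma lpa_relations_closed:
  fixes G :: "('v, 'e) ugraph"
  assumes "ultragraph G"
  shows "(lpa_relations G :: ('v, 'e, 'k::field) free_elem set) \<subseteq> carrier (free_alg G)"
proof -
  have [simp]: "(0 :: ('v, 'e, 'k) free_elem) \<in> carrier (free_alg G)" by (simp add: free_alg_simps)
  have [simp]: "(pp A :: ('v, 'e, 'k) free_elem) \<in> carrier (free_alg G)" if "A \<in> gen_verts G" for A
    using that by (intro gen_elem_closed) (auto simp: generators_def)
  have [simp]: "(ss e :: ('v, 'e, 'k) free_elem) \<in> carrier (free_alg G)"
    "(gg e :: ('v, 'e, 'k) free_elem) \<in> carrier (free_alg G)" if "e \<in> edges G" for e
    using that by (auto intro!: gen_elem_closed simp: generators_def)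
  have [simp]: "{src G e} \<in> gen_verts G" if "e \<in> edges G" for e
    using that assms by (auto simp: ultragraph_def intro: gen_verts.intros)
  show ?thesis
  proof
    fix r :: "('v, 'e, 'k) free_elem" assume "r \<in> lpa_relations G"
    then show "r \<in> carrier (free_alg G)"
      by cases (auto intro!: free_alg_closed free_alg_sum_closed simp: gen_verts.intros)
  qed
qed

lemma two_sided_ideal_lpa_ideal:
  fixes G :: "('v, 'e) ugraph"
  assumes "ultragraph G"
  shows "two_sided_ideal (lpa_ideal G :: ('v, 'e, 'k::field) free_elem set) (free_alg G)"
proof -
  interpret R: nonunital_ring "free_alg G :: ('v, 'e, 'k) free_elem ring" by (rule nonunital_ring_free_alg)
  define F :: "('v, 'e, 'k) free_elem set set" where "F = {J. two_sided_ideal J (free_alg G) \<and>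
     (\<forall>c. \<forall>f\<in>J. Poly_Mapping.single 0 c * f \<in> J) \<and> lpa_relations G \<subseteq> J}"
  have scal: "Poly_Mapping.single 0 c * f \<in> carrier (free_alg G)"
    if "f \<in> carrier (free_alg G)" for c :: 'k and f :: "('v, 'e, 'k) free_elem"
    using that keys_mult[of "Poly_Mapping.single 0 c" f]
    by (auto simp: free_alg_simps split: if_splits)
  have "two_sided_ideal (carrier (free_alg G)) (free_alg G :: ('v, 'e, 'k) free_elem ring)"
    unfolding two_sided_ideal_def additive_subgroup_def
    using R.add.subgroup_self R.rng_m_closed by auto
  then have "carrier (free_alg G) \<in> F"
    using scal lpa_relations_closed[OF assms] by (auto simp: F_def)
  moreover have "two_sided_ideal J (free_alg G)" if "J \<in> F" for J
    using that by (simp add: F_def)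
  ultimately have "two_sided_ideal (\<Inter>F) (free_alg G)"
    unfolding two_sided_ideal_def additive_subgroup_def
    by (intro conjI R.add.subgroups_Inter) blast+
  then show ?thesis by (simp add: lpa_ideal_def F_def)
qed

lemma nonunital_ring_lpa: "ultragraph G \<Longrightarrow> nonunital_ring (lpa G)"
  unfolding lpa_def
  by (intro nonunital_ring.nonunital_ring_Quot nonunital_ring_free_alg two_sided_ideal_lpa_ideal)

end

theory Submission
  imports Defs
begin

text \<open>
  A primitive ideal is prime by the usual annihilator argument, which needs no unit
  (\<open>prime_if_left_primitive\<close>). Conversely, let \<open>I\<close> be a prime ideal that is not graded, and let
  \<open>R\<close> be the quotient by \<open>I\<close>. It is the sum of its subspaces \<open>R\<^sub>n\<close>, spanned by the images of the
  monomials \<open>s\<^sub>\<alpha> p\<^sub>A s\<^sub>\<beta>\<^sup>*\<close> with \<open>|\<alpha>| - |\<beta>| = n\<close>. As \<open>I\<close> is not graded, these subspaces are linearly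
  dependent. Let \<open>w\<close> be the least number such that some nonzero element of some \<open>R\<^sub>b\<close> lies in
  \<open>R\<^sub>b\<^sub>-\<^sub>w + \<dots> + R\<^sub>b\<^sub>-\<^sub>1\<close>.

  Every nonzero homogeneous element becomes, after multiplication by homogeneous elements on both
  sides, a nonzero idempotent \<open>q = p\<^sub>B - \<Sum>\<^sub>e\<^sub>\<in>\<^sub>F s\<^sub>e s\<^sub>e\<^sup>*\<close> with \<open>F\<close> finite (\<open>reduction\<close>). Applied to the top
  term of a shortest dependency this gives \<open>q = x\<^sub>-\<^sub>w + \<dots> + x\<^sub>-\<^sub>1\<close> with \<open>x\<^sub>j\<close> in \<open>q R\<^sub>j q\<close>. Commuting this
  equation with a homogeneous element of \<open>q R q\<close> yields a shorter dependency, which must be trivial;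
  hence all \<open>x\<^sub>j\<close> are central in \<open>q R q\<close>. Reducing the nonzero central element \<open>x\<^sub>-\<^sub>w\<close> once more leads
  to a corner that has a central unit of degree \<open>w\<close> (\<open>good_exists\<close>). Passing along edges, first to
  \<open>p\<^sub>A\<close> for a range \<open>A\<close> and then to a unit without ghost edges, one arrives at a closed path \<open>\<alpha>\<close> of
  length \<open>w\<close> such that \<open>p = s\<^sub>\<alpha> s\<^sub>\<alpha>\<^sup>* = s\<^sub>\<alpha>\<^sup>* s\<^sub>\<alpha>\<close> and \<open>s\<^sub>\<alpha>\<close> is central in \<open>p R p\<close> (\<open>good_cycle\<close>).

  Now \<open>p R p\<close> is spanned by the products of a negative power of \<open>s\<^sub>\<alpha>\<close> with the path of an initial
  segment of \<open>\<alpha>\<alpha>\<alpha>\<dots>\<close>. So it is commutative, its nonzero homogeneous elements are invertible, and it is a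
  domain because \<open>R\<close> is prime. The shortest dependency acts like a minimal polynomial: division with
  remainder by an element that spreads over at most \<open>w\<close> consecutive degrees shows that \<open>p R p\<close> is a field
  (\<open>prime_dependent_has_field_corner\<close>). Finally, \<open>R p\<close> is a faithful simple left \<open>R\<close>-module
  (\<open>left_primitive_if_field_corner\<close>).
\<close>

section \<open>Prime and primitive ideals of rings without unit\<close>

text \<open>The elements of \<open>M\<close> that a set \<open>U\<close> with \<open>U R \<subseteq> U\<close> kills form a submodule.\<close>

lemma submodule_annihilated:
  assumes M: "left_module R M" and U: "\<And>x. x \<in> U \<Longrightarrow> x \<in> carrier R"
    and UR: "\<And>x r. \<lbrakk>x \<in> U; r \<in> carrier R\<rbrakk> \<Longrightarrow> x \<otimes>\<^bsub>R\<^esub> r \<in> U"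
  shows "submodule {m \<in> carrier M. \<forall>x\<in>U. x \<odot>\<^bsub>M\<^esub> m = \<zero>\<^bsub>M\<^esub>} R M"
proof -
  note lm = left_moduleD[OF M]
  interpret M: abelian_group M by (rule lm(1))
  have smz: "x \<odot>\<^bsub>M\<^esub> \<zero>\<^bsub>M\<^esub> = \<zero>\<^bsub>M\<^esub>" if "x \<in> carrier R" for x
  proof -
    have "x \<odot>\<^bsub>M\<^esub> \<zero>\<^bsub>M\<^esub> \<oplus>\<^bsub>M\<^esub> x \<odot>\<^bsub>M\<^esub> \<zero>\<^bsub>M\<^esub> = x \<odot>\<^bsub>M\<^esub> \<zero>\<^bsub>M\<^esub>"
      using lm(4)[of x "\<zero>\<^bsub>M\<^esub>" "\<zero>\<^bsub>M\<^esub>"] that by simp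
    then show ?thesis using lm(2)[of x "\<zero>\<^bsub>M\<^esub>"] that by simp
  qed
  have smn: "x \<odot>\<^bsub>M\<^esub> (\<ominus>\<^bsub>M\<^esub> m) = \<ominus>\<^bsub>M\<^esub> (x \<odot>\<^bsub>M\<^esub> m)" if "x \<in> carrier R" "m \<in> carrier M" for x m
  proof -
    have "x \<odot>\<^bsub>M\<^esub> (\<ominus>\<^bsub>M\<^esub> m) \<oplus>\<^bsub>M\<^esub> x \<odot>\<^bsub>M\<^esub> m = \<zero>\<^bsub>M\<^esub>"
      using lm(4)[of x "\<ominus>\<^bsub>M\<^esub> m" m] that smz by (simp add: M.l_neg)
    then show ?thesis using M.minus_equality lm(2) that by simp
  qed
  show ?thesis
  proof (intro submodule.intro subgroup.intro submodule_axioms.intro)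
    fix r m assume "r \<in> carrier R" "m \<in> {m \<in> carrier M. \<forall>x\<in>U. x \<odot>\<^bsub>M\<^esub> m = \<zero>\<^bsub>M\<^esub>}"
    then show "r \<odot>\<^bsub>M\<^esub> m \<in> {m \<in> carrier M. \<forall>x\<in>U. x \<odot>\<^bsub>M\<^esub> m = \<zero>\<^bsub>M\<^esub>}"
      using U UR lm(2) lm(5)[symmetric] by auto
  qed (use U lm(4) smz smn in \<open>auto simp: a_inv_def[symmetric]\<close>)
qed

context nonunital_ring
begin

lemma rng_zero_mult: "x \<in> carrier R \<Longrightarrow> \<zero> \<otimes> x = \<zero>" "x \<in> carrier R \<Longrightarrow> x \<otimes> \<zero> = \<zero>"
  using rng_l_distr[of \<zero> \<zero> x] rng_r_distr[of \<zero> \<zero> x] rng_m_closed[of \<zero> x] rng_m_closed[of x \<zero>] by auto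

lemma rng_minus_mult:
  assumes "x \<in> carrier R" "y \<in> carrier R"
  shows "(\<ominus> x) \<otimes> y = \<ominus> (x \<otimes> y)" "x \<otimes> (\<ominus> y) = \<ominus> (x \<otimes> y)"
proof -
  have "(\<ominus> x) \<otimes> y \<oplus> x \<otimes> y = \<zero>" "x \<otimes> (\<ominus> y) \<oplus> x \<otimes> y = \<zero>"
    using assms by (simp_all add: rng_l_distr[symmetric] rng_r_distr[symmetric] l_neg rng_zero_mult)
  then show "(\<ominus> x) \<otimes> y = \<ominus> (x \<otimes> y)" "x \<otimes> (\<ominus> y) = \<ominus> (x \<otimes> y)"
    using minus_equality[of "(\<ominus> x) \<otimes> y" "x \<otimes> y"] minus_equality[of "x \<otimes> (\<ominus> y)" "x \<otimes> y"] assms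
    by (simp_all add: rng_m_closed)
qed

lemma two_sided_idealI:
  assumes "J \<subseteq> carrier R" "\<zero> \<in> J" "\<And>x y. \<lbrakk>x \<in> J; y \<in> J\<rbrakk> \<Longrightarrow> x \<oplus> y \<in> J"
    "\<And>x. x \<in> J \<Longrightarrow> \<ominus> x \<in> J"
    "\<And>x r. \<lbrakk>x \<in> J; r \<in> carrier R\<rbrakk> \<Longrightarrow> r \<otimes> x \<in> J" "\<And>x r. \<lbrakk>x \<in> J; r \<in> carrier R\<rbrakk> \<Longrightarrow> x \<otimes> r \<in> J"
  shows "two_sided_ideal J R"
  unfolding two_sided_ideal_def additive_subgroup_def
  using assms by (auto intro!: add.subgroupI simp: a_inv_def[symmetric])

lemma two_sided_ideal_facts:
  assumes "two_sided_ideal J R"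
  shows "J \<subseteq> carrier R" "\<zero> \<in> J" "\<And>x y. \<lbrakk>x \<in> J; y \<in> J\<rbrakk> \<Longrightarrow> x \<oplus> y \<in> J"
    "\<And>x. x \<in> J \<Longrightarrow> \<ominus> x \<in> J"
proof -
  interpret additive_subgroup J R by (rule two_sided_idealD[OF assms])
  show "J \<subseteq> carrier R" "\<zero> \<in> J" "\<And>x y. \<lbrakk>x \<in> J; y \<in> J\<rbrakk> \<Longrightarrow> x \<oplus> y \<in> J" "\<And>x. x \<in> J \<Longrightarrow> \<ominus> x \<in> J"
    using a_subset zero_closed a_closed a_inv_closed abelian_group_axioms by auto
qed

lemma Quot_facts:
  assumes I: "two_sided_ideal I R"
  shows "carrier (R Quot I) = {I +> x | x. x \<in> carrier R}" "\<zero>\<^bsub>R Quot I\<^esub> = I"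
    and "\<And>x y. \<lbrakk>x \<in> carrier R; y \<in> carrier R\<rbrakk> \<Longrightarrow> (I +> x) \<otimes>\<^bsub>R Quot I\<^esub> (I +> y) = I +> (x \<otimes> y)"
    and "\<And>x y. \<lbrakk>x \<in> carrier R; y \<in> carrier R\<rbrakk> \<Longrightarrow> (I +> x) \<oplus>\<^bsub>R Quot I\<^esub> (I +> y) = I +> (x \<oplus> y)"
    and "\<And>x. x \<in> carrier R \<Longrightarrow> I +> x = I \<longleftrightarrow> x \<in> I"
proof -
  interpret I: additive_subgroup I R by (rule two_sided_idealD(1)[OF I])
  interpret I: abelian_subgroup I R
    by (rule abelian_subgroupI3) (unfold_locales)
  show "carrier (R Quot I) = {I +> x | x. x \<in> carrier R}" "\<zero>\<^bsub>R Quot I\<^esub> = I"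
    by (auto simp: FactRing_def A_RCOSETS_def')
  show "(I +> x) \<otimes>\<^bsub>R Quot I\<^esub> (I +> y) = I +> (x \<otimes> y)"
    "(I +> x) \<oplus>\<^bsub>R Quot I\<^esub> (I +> y) = I +> (x \<oplus> y)" if "x \<in> carrier R" "y \<in> carrier R" for x y
    using that rng_rcoset_mult[OF I] I.a_rcos_sum by (simp_all add: FactRing_def)
  show "I +> x = I \<longleftrightarrow> x \<in> I" if "x \<in> carrier R" for x
    using that I.a_rcos_const I.a_rcos_self by metis
qed

text \<open>Let \<open>U Y \<subseteq> I\<close> for ideals \<open>U\<close> and \<open>Y\<close>, and let \<open>M\<close> be a faithful simple module of the quotient. The
  elements of \<open>M\<close> killed by \<open>U\<close> form a submodule. If it is \<open>M\<close>, then \<open>U \<subseteq> I\<close>; if it is zero, then \<open>Y\<close>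
  kills \<open>M\<close>, because \<open>Y M\<close> lies in it, and \<open>Y \<subseteq> I\<close>.\<close>

lemma prime_if_left_primitive:
  assumes prim: "left_primitive_ideal I R"
  shows "prime_two_sided_ideal I R"
proof -
  have I: "two_sided_ideal I R" using prim by (simp add: left_primitive_ideal_def)
  note q = Quot_facts[OF I]
  obtain M :: "('a set, 'a set set) module" where M: "simple_left_module (R Quot I) M" "faithful_left_module (R Quot I) M"
    using prim by (auto simp: left_primitive_ideal_def left_primitive_ring_def)
  have lm: "left_module (R Quot I) M" using M by (simp add: simple_left_module_def)
  note lmD = left_moduleD[OF lm]
  interpret M: abelian_group M by (rule lmD(1))
  have zero: "I \<odot>\<^bsub>M\<^esub> m = \<zero>\<^bsub>M\<^esub>" if "m \<in> carrier M" for m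
  proof -
    have I0: "I +> \<zero> = I" using q(5)[OF zero_closed] two_sided_ideal_facts(2)[OF I] by simp
    then have Ic: "I \<in> carrier (R Quot I)" unfolding q(1) using zero_closed by blast
    have "I \<oplus>\<^bsub>R Quot I\<^esub> I = I" using q(4)[OF zero_closed zero_closed] by (simp add: I0)
    then have "I \<odot>\<^bsub>M\<^esub> m \<oplus>\<^bsub>M\<^esub> I \<odot>\<^bsub>M\<^esub> m = I \<odot>\<^bsub>M\<^esub> m" using lmD(3)[OF Ic Ic that] by simp
    then show ?thesis using lmD(2)[OF Ic that] by simp
  qed
  have in_I: "x \<in> I" if "x \<in> carrier R" "\<And>m. m \<in> carrier M \<Longrightarrow> (I +> x) \<odot>\<^bsub>M\<^esub> m = \<zero>\<^bsub>M\<^esub>" for x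
  proof -
    have "I +> x \<in> carrier (R Quot I)" using that(1) q(1) by blast
    then have "I +> x = I" using M(2) that(2) q(2) unfolding faithful_left_module_def by metis
    then show ?thesis using q(5)[OF that(1)] by simp
  qed
  show ?thesis unfolding prime_two_sided_ideal_def
  proof (intro conjI allI impI I)
    obtain a m where "a \<in> carrier (R Quot I)" "m \<in> carrier M" "a \<odot>\<^bsub>M\<^esub> m \<noteq> \<zero>\<^bsub>M\<^esub>"
      using M(1) unfolding simple_left_module_def by blast
    then show "I \<noteq> carrier R" using q(1,5) zero by auto
  next
    fix U Y assume UY: "two_sided_ideal U R \<and> two_sided_ideal Y R \<and> ideal_prod R U Y \<subseteq> I"
    have Uc: "U \<subseteq> carrier R" and Yc: "Y \<subseteq> carrier R" using UY two_sided_ideal_facts(1) by blast+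
    have prod: "x \<otimes> y \<in> I" if "x \<in> U" "y \<in> Y" for x y
      using UY ideal_prod.prod[OF that] by blast
    define N where "N = {m \<in> carrier M. \<forall>x\<in>(\<lambda>x. I +> x) ` U. x \<odot>\<^bsub>M\<^esub> m = \<zero>\<^bsub>M\<^esub>}"
    have "submodule N (R Quot I) M" unfolding N_def
    proof (rule submodule_annihilated[OF lm])
      fix x r assume "x \<in> (\<lambda>x. I +> x) ` U" "r \<in> carrier (R Quot I)"
      then obtain x' r' where "x' \<in> U" "r' \<in> carrier R" "x = I +> x'" "r = I +> r'" using q(1) by auto
      then show "x \<otimes>\<^bsub>R Quot I\<^esub> r \<in> (\<lambda>x. I +> x) ` U"
        using q(3)[of x' r'] Uc two_sided_idealD(3)[of U R x' r'] UY by auto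
    qed (use Uc q(1) in auto)
    then have "N = {\<zero>\<^bsub>M\<^esub>} \<or> N = carrier M" using M(1) by (auto simp: simple_left_module_def)
    then show "U \<subseteq> I \<or> Y \<subseteq> I"
    proof
      assume "N = carrier M"
      then have "(I +> x) \<odot>\<^bsub>M\<^esub> m = \<zero>\<^bsub>M\<^esub>" if "x \<in> U" "m \<in> carrier M" for x m
        using that by (auto simp: N_def)
      then have "U \<subseteq> I" using in_I Uc by blast
      then show ?thesis ..
    next
      assume N: "N = {\<zero>\<^bsub>M\<^esub>}"
      have "(I +> y) \<odot>\<^bsub>M\<^esub> m = \<zero>\<^bsub>M\<^esub>" if y: "y \<in> Y" and m: "m \<in> carrier M" for y m
      proof -
        have yc: "I +> y \<in> carrier (R Quot I)" using y Yc q(1) by blast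
        have "(I +> x) \<odot>\<^bsub>M\<^esub> ((I +> y) \<odot>\<^bsub>M\<^esub> m) = \<zero>\<^bsub>M\<^esub>" if x: "x \<in> U" for x
        proof -
          have xc: "I +> x \<in> carrier (R Quot I)" using x Uc q(1) by blast
          have "(I +> x) \<odot>\<^bsub>M\<^esub> ((I +> y) \<odot>\<^bsub>M\<^esub> m) = (I +> (x \<otimes> y)) \<odot>\<^bsub>M\<^esub> m"
            by (simp only: lmD(5)[OF xc yc m, symmetric] q(3)[OF subsetD[OF Uc x] subsetD[OF Yc y]])
          also have "I +> (x \<otimes> y) = I"
            using prod[OF x y] q(5) two_sided_ideal_facts(1)[OF I] by blast
          finally show ?thesis using zero[OF m] by simp
        qed
        then have "(I +> y) \<odot>\<^bsub>M\<^esub> m \<in> N" using lmD(2)[OF yc m] by (auto simp: N_def)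
        then show ?thesis using N by simp
      qed
      then have "Y \<subseteq> I" using in_I Yc by blast
      then show ?thesis ..
    qed
  qed
qed

text \<open>Primeness in terms of elements. Right local units make the product of the two annihilators \<open>U\<close> and
  \<open>Y\<close> below lie in \<open>I\<close>, although the hypothesis only speaks of products with a factor in between.\<close>

lemma prime_elementwise:
  assumes P: "prime_two_sided_ideal I R"
    and unit: "\<And>x. x \<in> carrier R \<Longrightarrow> \<exists>e\<in>carrier R. x \<otimes> e = x"
    and xy: "x \<in> carrier R" "y \<in> carrier R" "\<And>r. r \<in> carrier R \<Longrightarrow> x \<otimes> r \<otimes> y \<in> I"
  shows "x \<in> I \<or> y \<in> I"
proof -
  have I: "two_sided_ideal I R" using P by (simp add: prime_two_sided_ideal_def)
  note If = two_sided_ideal_facts[OF I] and Im = two_sided_idealD(2,3)[OF I]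
  define U where "U = {a \<in> carrier R. \<forall>r\<in>carrier R. a \<otimes> r \<otimes> y \<in> I}"
  define Y where "Y = {b \<in> carrier R. \<forall>a\<in>U. \<forall>r\<in>carrier R. a \<otimes> r \<otimes> b \<in> I}"
  have U: "two_sided_ideal U R"
  proof (rule two_sided_idealI)
    fix a s assume as: "a \<in> U" "s \<in> carrier R"
    show "s \<otimes> a \<in> U" using as If Im xy unfolding U_def
      by (auto simp: rng_m_closed rng_m_assoc)
    have "a \<otimes> s \<otimes> r \<otimes> y \<in> I" if "r \<in> carrier R" for r
      using as that xy rng_m_closed[of s r] unfolding U_def by (auto simp: rng_m_assoc)
    then show "a \<otimes> s \<in> U" using as unfolding U_def by (auto simp: rng_m_closed)
  qed (use xy If in \<open>auto simp: U_def rng_l_distr rng_minus_mult rng_zero_mult rng_m_closed\<close>)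
  have Uc: "U \<subseteq> carrier R" by (auto simp: U_def)
  have Y: "two_sided_ideal Y R"
  proof (rule two_sided_idealI)
    fix b s assume bs: "b \<in> Y" "s \<in> carrier R"
    have "a \<otimes> r \<otimes> (b \<otimes> s) \<in> I" if "a \<in> U" "r \<in> carrier R" for a r
    proof -
      have "a \<otimes> r \<otimes> (b \<otimes> s) = (a \<otimes> r \<otimes> b) \<otimes> s"
        using that bs Uc by (auto simp: Y_def rng_m_closed rng_m_assoc subsetD)
      then show ?thesis using Im(2)[of "a \<otimes> r \<otimes> b" s] that bs by (auto simp: Y_def)
    qed
    then show "b \<otimes> s \<in> Y" using bs by (auto simp: Y_def rng_m_closed)
    have "a \<otimes> r \<otimes> (s \<otimes> b) \<in> I" if "a \<in> U" "r \<in> carrier R" for a r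
    proof -
      have "a \<otimes> r \<otimes> (s \<otimes> b) = a \<otimes> (r \<otimes> s) \<otimes> b"
        using that bs Uc by (auto simp: Y_def rng_m_closed rng_m_assoc subsetD)
      then show ?thesis using that bs rng_m_closed by (auto simp: Y_def)
    qed
    then show "s \<otimes> b \<in> Y" using bs by (auto simp: Y_def rng_m_closed)
  qed (use Uc If in \<open>auto simp: Y_def rng_r_distr rng_minus_mult rng_zero_mult rng_m_closed subsetD\<close>)
  have prod: "a \<otimes> b \<in> I" if "a \<in> U" "b \<in> Y" for a b
  proof -
    have "a \<in> carrier R" using that(1) Uc by blast
    then obtain e where "e \<in> carrier R" "a \<otimes> e = a" using unit by blast
    then show ?thesis using that unfolding Y_def by fastforce
  qed
  have "ideal_prod R U Y \<subseteq> I"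
  proof
    fix z assume "z \<in> ideal_prod R U Y"
    then show "z \<in> I" by (induction rule: ideal_prod.induct) (use prod If in auto)
  qed
  then have "U \<subseteq> I \<or> Y \<subseteq> I" using P U Y unfolding prime_two_sided_ideal_def by blast
  moreover have "x \<in> U" "y \<in> Y" using xy by (auto simp: U_def Y_def)
  ultimately show ?thesis by blast
qed

text \<open>The module is \<open>R p\<close>. It is faithful as \<open>R\<close> is prime. It is simple since, for \<open>n \<noteq> 0\<close> in \<open>R p\<close>, primeness
  gives \<open>r\<close> with \<open>n r n \<noteq> 0\<close>, so that \<open>p r n\<close> is a nonzero element of \<open>p R p\<close> and \<open>p\<close> is a left multiple
  of \<open>n\<close>.\<close>

lemma left_primitive_if_field_corner:
  assumes prime: "\<And>x y. \<lbrakk>x \<in> carrier R; y \<in> carrier R; \<And>r. r \<in> carrier R \<Longrightarrow> x \<otimes> r \<otimes> y = \<zero>\<rbrakk>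
      \<Longrightarrow> x = \<zero> \<or> y = \<zero>"
    and p: "p \<in> carrier R" "p \<noteq> \<zero>" "p \<otimes> p = p"
    and field: "\<And>x. \<lbrakk>x \<in> carrier R; p \<otimes> x \<otimes> p \<noteq> \<zero>\<rbrakk> \<Longrightarrow> \<exists>z\<in>carrier R. z \<otimes> (p \<otimes> x \<otimes> p) = p"
  shows "left_primitive_ring R"
proof -
  define M :: "('a, 'a) module" where
    "M = \<lparr>carrier = {x \<in> carrier R. x \<otimes> p = x}, monoid.mult = undefined, monoid.one = undefined,
      ring.zero = \<zero>, ring.add = (\<oplus>), smult = (\<otimes>)\<rparr>"
  have M: "carrier M = {x \<in> carrier R. x \<otimes> p = x}" "\<zero>\<^bsub>M\<^esub> = \<zero>" "\<And>x y. x \<oplus>\<^bsub>M\<^esub> y = x \<oplus> y"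
    "\<And>x y. x \<odot>\<^bsub>M\<^esub> y = x \<otimes> y"
    by (simp_all add: M_def)
  have aM: "abelian_group M"
  proof (rule abelian_groupI)
    fix x assume x: "x \<in> carrier M"
    then have "\<ominus> x \<in> carrier M" using p by (simp add: M rng_minus_mult)
    then show "\<exists>y\<in>carrier M. y \<oplus>\<^bsub>M\<^esub> x = \<zero>\<^bsub>M\<^esub>"
      using x by (intro bexI[of _ "\<ominus> x"]) (auto simp: M l_neg)
  qed (use p in \<open>auto simp: M rng_l_distr rng_zero_mult a_ac\<close>)
  then have lm: "left_module R M"
    unfolding left_module_def using p
    by (auto simp: M rng_m_closed rng_m_assoc rng_l_distr rng_r_distr)
  have "simple_left_module R M" unfolding simple_left_module_def
  proof (intro conjI lm allI impI)
    show "\<exists>a\<in>carrier R. \<exists>x\<in>carrier M. a \<odot>\<^bsub>M\<^esub> x \<noteq> \<zero>\<^bsub>M\<^esub>"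
      using p by (intro bexI[of _ p]) (auto simp: M)
  next
    fix N assume N: "submodule N R M"
    interpret N: subgroup N "add_monoid M" using N by (rule submodule.axioms)
    have Nsm: "r \<otimes> n \<in> N" if "r \<in> carrier R" "n \<in> N" for r n
      using submodule.smult_closed[OF N that] by (simp add: M)
    show "N = {\<zero>\<^bsub>M\<^esub>} \<or> N = carrier M"
    proof (cases "N \<subseteq> {\<zero>}")
      case True
      then show ?thesis using N.one_closed by (auto simp: M)
    next
      case False
      then obtain n where n: "n \<in> N" "n \<noteq> \<zero>" by auto
      have nc: "n \<in> carrier R" "n \<otimes> p = n" using N.subset n by (auto simp: M)
      obtain r where r: "r \<in> carrier R" "n \<otimes> r \<otimes> n \<noteq> \<zero>" using prime[OF nc(1) nc(1)] n(2) by blast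
      have "n \<otimes> r \<otimes> n = n \<otimes> (p \<otimes> (r \<otimes> n) \<otimes> p)"
      proof -
        have "n \<otimes> r \<otimes> n = (n \<otimes> p) \<otimes> r \<otimes> (n \<otimes> p)" using nc by simp
        also have "\<dots> = n \<otimes> (p \<otimes> (r \<otimes> n) \<otimes> p)"
          using r nc(1) p(1) by (simp add: rng_m_closed rng_m_assoc)
        finally show ?thesis .
      qed
      then have "p \<otimes> (r \<otimes> n) \<otimes> p \<noteq> \<zero>" using r nc rng_zero_mult(2)[of n] by auto
      then obtain z where z: "z \<in> carrier R" "z \<otimes> (p \<otimes> (r \<otimes> n) \<otimes> p) = p"
        using field[of "r \<otimes> n"] r nc rng_m_closed by auto
      have e: "p \<otimes> (r \<otimes> n) \<otimes> p = (p \<otimes> r) \<otimes> n"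
        using r nc p(1) by (simp add: rng_m_closed rng_m_assoc)
      have "z \<otimes> ((p \<otimes> r) \<otimes> n) \<in> N" using z r p n by (intro Nsm) (auto simp: rng_m_closed)
      then have pN: "p \<in> N" using z(2) e by simp
      have "carrier M \<subseteq> N"
      proof
        fix x assume "x \<in> carrier M"
        then show "x \<in> N" using Nsm[OF _ pN, of x] by (simp add: M)
      qed
      then show ?thesis using N.subset by auto
    qed
  qed
  moreover have "faithful_left_module R M" unfolding faithful_left_module_def
  proof (intro conjI lm ballI impI)
    fix a assume a: "a \<in> carrier R" "\<forall>x\<in>carrier M. a \<odot>\<^bsub>M\<^esub> x = \<zero>\<^bsub>M\<^esub>"
    have "a \<otimes> r \<otimes> p = \<zero>" if "r \<in> carrier R" for r
    proof -
      have "r \<otimes> p \<in> carrier M" using that p by (simp add: M rng_m_closed rng_m_assoc)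
      then show ?thesis using a that p by (simp add: M rng_m_assoc)
    qed
    then show "a = \<zero>\<^bsub>R\<^esub>" using prime[OF a(1) p(1)] p(2) by blast
  qed
  ultimately show ?thesis
    by (rule left_primitive_ringI) (rule nonunital_ring_axioms)
qed

end

section \<open>Homogeneous elements of a family satisfying the Leavitt relations\<close>

text \<open>Elements \<open>P A\<close>, \<open>S e\<close> and \<open>T e\<close> of a unital ring that satisfy the relations of \<open>p\<^sub>A\<close>, \<open>s\<^sub>e\<close> and \<open>s\<^sub>e\<^sup>*\<close>;
  the relation at regular vertices is not imposed. The scalars act through \<open>kap\<close>, whose values
  commute with the family but not necessarily with the whole ring. The unit of the ring serves as a
  formal unit of the algebra generated by the family, to which it need not belong.\<close>

locale leavitt_family =
  fixes G :: "('v, 'e) ugraph" and kap :: "'k::field \<Rightarrow> 'a::ring_1"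
    and P :: "'v set \<Rightarrow> 'a" and S T :: "'e \<Rightarrow> 'a"
  assumes kap_one: "kap 1 = 1"
    and kap_add: "kap (c + d) = kap c + kap d"
    and kap_mult: "kap (c * d) = kap c * kap d"
    and kap_P: "A \<in> gen_verts G \<Longrightarrow> P A * kap c = kap c * P A"
    and kap_S: "e \<in> edges G \<Longrightarrow> S e * kap c = kap c * S e"
    and kap_T: "e \<in> edges G \<Longrightarrow> T e * kap c = kap c * T e"
    and P_empty: "P {} = 0"
    and P_mult: "\<lbrakk>A \<in> gen_verts G; B \<in> gen_verts G\<rbrakk> \<Longrightarrow> P A * P B = P (A \<inter> B)"
    and P_Un: "\<lbrakk>A \<in> gen_verts G; B \<in> gen_verts G\<rbrakk> \<Longrightarrow> P (A \<union> B) = P A + P B - P (A \<inter> B)"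
    and P_src_S: "e \<in> edges G \<Longrightarrow> P {src G e} * S e = S e"
    and S_P_rge: "e \<in> edges G \<Longrightarrow> S e * P (rge G e) = S e"
    and P_rge_T: "e \<in> edges G \<Longrightarrow> P (rge G e) * T e = T e"
    and T_P_src: "e \<in> edges G \<Longrightarrow> T e * P {src G e} = T e"
    and T_S: "\<lbrakk>e \<in> edges G; f \<in> edges G\<rbrakk> \<Longrightarrow> T e * S f = (if e = f then P (rge G e) else 0)"
    and src_verts: "e \<in> edges G \<Longrightarrow> src G e \<in> verts G"
begin

abbreviation "E \<equiv> edges G"
abbreviation "GV \<equiv> gen_verts G"

lemma kap_zero: "kap 0 = 0"
  using kap_add[of 0 0] by simp

lemma kap_minus: "kap (- c) = - kap c"
  using kap_add[of c "- c"] by (simp add: kap_zero minus_unique)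

lemma kap_inv: "c \<noteq> 0 \<Longrightarrow> kap (inverse c) * kap c = 1"
  by (simp add: kap_mult[symmetric] kap_one)

lemma kap_comm: "kap c * kap d = kap d * kap c"
  by (simp add: kap_mult[symmetric] mult.commute)

lemma P_split: "\<lbrakk>A \<in> GV; B \<in> GV\<rbrakk> \<Longrightarrow> P A = P (A \<inter> B) + P (A - B)"
  using P_Un[of "A \<inter> B" "A - B"] gv_Int[of A G B] gv_Diff[of A G B]
  by (simp add: Int_Diff_Un Int_Diff P_empty)
    (metis Diff_disjoint Int_Diff P_empty Un_Diff_Int diff_zero add.commute inf.commute)

lemma src_gv: "e \<in> E \<Longrightarrow> {src G e} \<in> GV"
  by (simp add: gv_vert src_verts)

lemma rge_gv: "e \<in> E \<Longrightarrow> rge G e \<in> GV"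
  by (rule gv_range)

lemma P_S:
  assumes "A \<in> GV" "e \<in> E"
  shows "P A * S e = (if src G e \<in> A then S e else 0)"
proof -
  have "P A * S e = P (A \<inter> {src G e}) * S e"
    using assms by (metis P_src_S P_mult src_gv mult.assoc)
  then show ?thesis using assms by (simp add: P_src_S P_empty)
qed

lemma T_P:
  assumes "A \<in> GV" "e \<in> E"
  shows "T e * P A = (if src G e \<in> A then T e else 0)"
proof -
  have "T e * P A = T e * P ({src G e} \<inter> A)"
    using assms by (metis T_P_src P_mult src_gv mult.assoc)
  then show ?thesis using assms by (simp add: T_P_src P_empty)
qed

text \<open>The product of \<open>S e\<close> over the edges of a word, in the given order. The word need not be a path:
  otherwise the product is zero.\<close>

definition spath :: "'e list \<Rightarrow> 'a" where "spath \<alpha> = prod_list (map S \<alpha>)"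

text \<open>The product of \<open>T e\<close> over the edges of a word in reversed order, that is, \<open>s\<^sub>\<alpha>\<^sup>*\<close>.\<close>

definition gpath :: "'e list \<Rightarrow> 'a" where "gpath \<alpha> = prod_list (map T (rev \<alpha>))"

lemma spath_simps [simp]: "spath [] = 1" "spath (e # \<alpha>) = S e * spath \<alpha>" "spath (\<alpha> @ \<beta>) = spath \<alpha> * spath \<beta>"
  by (simp_all add: spath_def)

lemma gpath_simps [simp]: "gpath [] = 1" "gpath (e # \<alpha>) = gpath \<alpha> * T e" "gpath (\<alpha> @ \<beta>) = gpath \<beta> * gpath \<alpha>"
  by (simp_all add: gpath_def)

lemma kap_spath: "set \<alpha> \<subseteq> E \<Longrightarrow> spath \<alpha> * kap c = kap c * spath \<alpha>"
  by (induction \<alpha>) (simp_all add: mult.assoc, metis kap_S mult.assoc)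

lemma kap_gpath: "set \<alpha> \<subseteq> E \<Longrightarrow> gpath \<alpha> * kap c = kap c * gpath \<alpha>"
  by (induction \<alpha>) (simp_all add: mult.assoc, metis kap_T mult.assoc)

text \<open>Scalar multiples of \<open>s\<^sub>\<alpha> p\<^sub>A s\<^sub>\<beta>\<^sup>*\<close> of degree \<open>n\<close> whose ghost part \<open>\<beta>\<close> has length at most \<open>m\<close>.\<close>

definition monomials :: "int \<Rightarrow> nat \<Rightarrow> 'a set" where
  "monomials n m = {kap c * spath \<alpha> * P A * gpath \<beta> | c \<alpha> A \<beta>. set \<alpha> \<subseteq> E \<and> set \<beta> \<subseteq> E \<and> A \<in> GV \<and>
     int (length \<alpha>) - int (length \<beta>) = n \<and> length \<beta> \<le> m}"

text \<open>Sums of such monomials. The elements of \<open>homog_le n 0\<close> are free of ghost edges.\<close>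

inductive_set homog_le :: "int \<Rightarrow> nat \<Rightarrow> 'a set" for n m where
  homog_le_zero: "0 \<in> homog_le n m"
| homog_le_step: "\<lbrakk>x \<in> monomials n m; y \<in> homog_le n m\<rbrakk> \<Longrightarrow> x + y \<in> homog_le n m"

text \<open>The elements of degree \<open>n\<close>. For different \<open>n\<close> these subspaces need not be independent.\<close>

definition homog :: "int \<Rightarrow> 'a set" where "homog n = (\<Union>m. homog_le n m)"

lemma monomialsI:
  "\<lbrakk>set \<alpha> \<subseteq> E; set \<beta> \<subseteq> E; A \<in> GV; int (length \<alpha>) - int (length \<beta>) = n; length \<beta> \<le> m\<rbrakk>
    \<Longrightarrow> kap c * spath \<alpha> * P A * gpath \<beta> \<in> monomials n m"
  unfolding monomials_def by blast

lemma monomialsE: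
  assumes "x \<in> monomials n m"
  obtains c \<alpha> A \<beta> where "x = kap c * spath \<alpha> * P A * gpath \<beta>" "set \<alpha> \<subseteq> E" "set \<beta> \<subseteq> E" "A \<in> GV"
    "int (length \<alpha>) - int (length \<beta>) = n" "length \<beta> \<le> m"
  using assms unfolding monomials_def by blast

lemma monomials_homog_le: "x \<in> monomials n m \<Longrightarrow> x \<in> homog_le n m"
  using homog_le_step[of x n m 0] by (simp add: homog_le_zero)

lemma homog_le_add: "\<lbrakk>x \<in> homog_le n m; y \<in> homog_le n m\<rbrakk> \<Longrightarrow> x + y \<in> homog_le n m"
  by (induction rule: homog_le.induct) (auto simp: add.assoc intro: homog_le.intros)

lemma homog_le_map:
  assumes "x \<in> homog_le n m" and "\<And>y. y \<in> monomials n m \<Longrightarrow> f y \<in> homog_le n' m'"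
    and "f 0 = 0" "\<And>y z. f (y + z) = f y + f z"
  shows "f x \<in> homog_le n' m'"
  using assms(1) by (induction rule: homog_le.induct) (auto simp: assms homog_le_zero intro!: homog_le_add)

lemma homog_le_mono: "\<lbrakk>x \<in> homog_le n m; m \<le> m'\<rbrakk> \<Longrightarrow> x \<in> homog_le n m'"
  by (rule homog_le_map[where f = "\<lambda>x. x"]) (auto intro!: monomials_homog_le simp: monomials_def, metis le_trans)

lemma homog_le_kap:
  assumes "x \<in> homog_le n m" shows "kap c * x \<in> homog_le n m"
  using assms
proof (rule homog_le_map)
  fix y assume "y \<in> monomials n m"
  then obtain d \<alpha> A \<beta> where y: "y = kap d * spath \<alpha> * P A * gpath \<beta>" "set \<alpha> \<subseteq> E" "set \<beta> \<subseteq> E" "A \<in> GV"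
    "int (length \<alpha>) - int (length \<beta>) = n" "length \<beta> \<le> m" by (rule monomialsE)
  have "kap c * y = kap (c * d) * spath \<alpha> * P A * gpath \<beta>" by (simp add: y kap_mult mult.assoc)
  then show "kap c * y \<in> homog_le n m" using y by (auto intro!: monomials_homog_le monomialsI)
qed (simp_all add: algebra_simps)

lemma homog_le_uminus: "x \<in> homog_le n m \<Longrightarrow> - x \<in> homog_le n m"
  using homog_le_kap[of x n m "- 1"] by (simp add: kap_minus kap_one)

lemma homog_le_S_left:
  assumes "x \<in> homog_le n m" "e \<in> E" shows "S e * x \<in> homog_le (n + 1) m"
  using assms(1)
proof (rule homog_le_map)
  fix y assume "y \<in> monomials n m"
  then obtain d \<alpha> A \<beta> where y: "y = kap d * spath \<alpha> * P A * gpath \<beta>" "set \<alpha> \<subseteq> E" "set \<beta> \<subseteq> E" "A \<in> GV"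
    "int (length \<alpha>) - int (length \<beta>) = n" "length \<beta> \<le> m" by (rule monomialsE)
  have "S e * y = kap d * spath (e # \<alpha>) * P A * gpath \<beta>"
    unfolding y(1) spath_simps mult.assoc[symmetric] kap_S[OF assms(2), symmetric] ..
  then show "S e * y \<in> homog_le (n + 1) m" using y assms by (auto intro!: monomials_homog_le monomialsI simp del: spath_simps)
qed (simp_all add: algebra_simps)

lemma homog_le_P_left:
  assumes "x \<in> homog_le n m" "B \<in> GV" shows "P B * x \<in> homog_le n m"
  using assms(1)
proof (rule homog_le_map)
  fix y assume "y \<in> monomials n m"
  then obtain d \<alpha> A \<beta> where y: "y = kap d * spath \<alpha> * P A * gpath \<beta>" "set \<alpha> \<subseteq> E" "set \<beta> \<subseteq> E" "A \<in> GV"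
    "int (length \<alpha>) - int (length \<beta>) = n" "length \<beta> \<le> m" by (rule monomialsE)
  have eq: "P B * y = kap d * (P B * spath \<alpha>) * P A * gpath \<beta>"
    unfolding y(1) mult.assoc[symmetric] kap_P[OF assms(2), symmetric] ..
  show "P B * y \<in> homog_le n m"
  proof (cases \<alpha>)
    case Nil
    then have "P B * y = kap d * spath [] * P (B \<inter> A) * gpath \<beta>"
      using eq P_mult[OF assms(2) y(4)] by (simp add: mult.assoc)
    then show ?thesis using y Nil assms(2) by (auto intro!: monomials_homog_le monomialsI gv_Int simp del: spath_simps)
  next
    case (Cons e \<alpha>')
    then have "P B * spath \<alpha> = 0 \<or> P B * spath \<alpha> = spath \<alpha>"
      using P_S[OF assms(2), of e] y by (simp add: mult.assoc[symmetric])
    then have "P B * y = 0 \<or> P B * y = y" using eq y by auto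
    then show ?thesis using \<open>y \<in> monomials n m\<close> by (auto simp: homog_le_zero monomials_homog_le)
  qed
qed (simp_all add: algebra_simps)

text \<open>Multiplication by a ghost edge from the left lengthens the ghost part only if there is no edge to
  cancel, which cannot happen in positive degree.\<close>

lemma homog_le_T_left:
  assumes "x \<in> homog_le n m" "e \<in> E" shows "T e * x \<in> homog_le (n - 1) (if 1 \<le> n then m else Suc m)"
  using assms(1)
proof (rule homog_le_map)
  fix y assume "y \<in> monomials n m"
  then obtain d \<alpha> A \<beta> where y: "y = kap d * spath \<alpha> * P A * gpath \<beta>" "set \<alpha> \<subseteq> E" "set \<beta> \<subseteq> E" "A \<in> GV"
    "int (length \<alpha>) - int (length \<beta>) = n" "length \<beta> \<le> m" by (rule monomialsE)
  have eq: "T e * y = kap d * (T e * spath \<alpha>) * P A * gpath \<beta>"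
    unfolding y(1) mult.assoc[symmetric] kap_T[OF assms(2), symmetric] ..
  show "T e * y \<in> homog_le (n - 1) (if 1 \<le> n then m else Suc m)"
  proof (cases \<alpha>)
    case Nil
    then have n: "\<not> 1 \<le> n" using y by auto
    have "T e * P A = 0 \<or> T e * P A = P (rge G e) * T e"
      using T_P[OF y(4) assms(2)] by (simp add: P_rge_T assms)
    moreover have "T e * y = kap d * (T e * P A) * gpath \<beta>"
      using eq Nil by (simp add: mult.assoc)
    ultimately have "T e * y = 0 \<or> T e * y = kap d * spath [] * P (rge G e) * gpath (\<beta> @ [e])"
      by (elim disjE) (simp_all add: mult.assoc)
    moreover have "kap d * spath [] * P (rge G e) * gpath (\<beta> @ [e]) \<in> homog_le (n - 1) (Suc m)"
      using y Nil assms(2) by (intro monomials_homog_le monomialsI gv_range) auto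
    ultimately show ?thesis using n by (metis homog_le_zero)
  next
    case (Cons f \<alpha>')
    let ?z = "kap d * spath \<alpha>' * P A * gpath \<beta>"
    have "?z \<in> homog_le (n - 1) m" using y Cons by (intro monomials_homog_le monomialsI) auto
    moreover have "T e * spath \<alpha> = 0 \<or> T e * spath \<alpha> = P (rge G e) * spath \<alpha>'"
      using T_S[OF assms(2), of f] y Cons by (auto simp: mult.assoc[symmetric])
    then have "T e * y = 0 \<or> T e * y = kap d * P (rge G e) * spath \<alpha>' * P A * gpath \<beta>"
      using eq by (elim disjE) (simp_all add: mult.assoc)
    then have "T e * y = 0 \<or> T e * y = P (rge G e) * ?z"
      unfolding mult.assoc[symmetric] kap_P[OF rge_gv[OF assms(2)]] .
    ultimately have "T e * y \<in> homog_le (n - 1) m"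
      using homog_le_P_left[OF _ rge_gv[OF assms(2)]] by (auto simp: homog_le_zero)
    then show ?thesis using homog_le_mono[of _ "n - 1" m "Suc m"] by auto
  qed
qed (simp_all add: algebra_simps)

lemma homog_le_T_right:
  assumes "x \<in> homog_le n m" "e \<in> E" shows "x * T e \<in> homog_le (n - 1) (Suc m)"
  using assms(1)
proof (rule homog_le_map)
  fix y assume "y \<in> monomials n m"
  then obtain d \<alpha> A \<beta> where y: "y = kap d * spath \<alpha> * P A * gpath \<beta>" "set \<alpha> \<subseteq> E" "set \<beta> \<subseteq> E" "A \<in> GV"
    "int (length \<alpha>) - int (length \<beta>) = n" "length \<beta> \<le> m" by (rule monomialsE)
  have "y * T e = kap d * spath \<alpha> * P A * gpath (e # \<beta>)"
    by (simp add: y mult.assoc)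
  then show "y * T e \<in> homog_le (n - 1) (Suc m)" using y assms by (auto intro!: monomials_homog_le monomialsI simp del: gpath_simps)
qed (simp_all add: algebra_simps)

lemma homog_le_P_right:
  assumes "x \<in> homog_le n m" "B \<in> GV" shows "x * P B \<in> homog_le n m"
  using assms(1)
proof (rule homog_le_map)
  fix y assume "y \<in> monomials n m"
  then obtain d \<alpha> A \<beta> where y: "y = kap d * spath \<alpha> * P A * gpath \<beta>" "set \<alpha> \<subseteq> E" "set \<beta> \<subseteq> E" "A \<in> GV"
    "int (length \<alpha>) - int (length \<beta>) = n" "length \<beta> \<le> m" by (rule monomialsE)
  show "y * P B \<in> homog_le n m"
  proof (cases \<beta>)
    case Nil
    then have "y * P B = kap d * spath \<alpha> * P (A \<inter> B) * gpath []"
      using P_mult[OF y(4) assms(2)] y by (simp add: mult.assoc)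
    then show ?thesis using y Nil assms(2) by (auto intro!: monomials_homog_le monomialsI gv_Int simp del: gpath_simps)
  next
    case (Cons e \<beta>')
    then have "gpath \<beta> * P B = 0 \<or> gpath \<beta> * P B = gpath \<beta>"
      using T_P[OF assms(2), of e] y by (simp add: mult.assoc)
    then have "y * P B = 0 \<or> y * P B = y" using y by (auto simp: mult.assoc)
    then show ?thesis using \<open>y \<in> monomials n m\<close> by (auto simp: homog_le_zero monomials_homog_le)
  qed
qed (simp_all add: algebra_simps)

lemma homog_le_S_right:
  assumes "x \<in> homog_le n m" "e \<in> E" shows "x * S e \<in> homog_le (n + 1) (m - 1)"
  using assms(1)
proof (rule homog_le_map)
  fix y assume "y \<in> monomials n m"
  then obtain d \<alpha> A \<beta> where y: "y = kap d * spath \<alpha> * P A * gpath \<beta>" "set \<alpha> \<subseteq> E" "set \<beta> \<subseteq> E" "A \<in> GV"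
    "int (length \<alpha>) - int (length \<beta>) = n" "length \<beta> \<le> m" by (rule monomialsE)
  show "y * S e \<in> homog_le (n + 1) (m - 1)"
  proof (cases \<beta>)
    case Nil
    have "P A * S e = 0 \<or> P A * S e = S e * P (rge G e)"
      using P_S[OF y(4) assms(2)] by (simp add: S_P_rge assms)
    then have "y * S e = 0 \<or> y * S e = kap d * spath (\<alpha> @ [e]) * P (rge G e) * gpath []"
      using Nil y(1) by (auto simp: mult.assoc)
    moreover have "kap d * spath (\<alpha> @ [e]) * P (rge G e) * gpath [] \<in> homog_le (n + 1) (m - 1)"
      using y Nil assms(2) by (intro monomials_homog_le monomialsI gv_range) auto
    ultimately show ?thesis by (metis homog_le_zero)
  next
    case (Cons f \<beta>')
    let ?z = "kap d * spath \<alpha> * P A * gpath \<beta>'"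
    have "?z \<in> homog_le (n + 1) (m - 1)" using y Cons by (intro monomials_homog_le monomialsI) auto
    moreover have "gpath \<beta> * S e = 0 \<or> gpath \<beta> * S e = gpath \<beta>' * P (rge G e)"
      using T_S[of f, OF _ assms(2)] y Cons by (auto simp: mult.assoc)
    then have "y * S e = 0 \<or> y * S e = ?z * P (rge G e)"
      using y by (auto simp: mult.assoc)
    ultimately show ?thesis
      using homog_le_P_right[OF _ rge_gv[OF assms(2)]] by (auto simp: homog_le_zero)
  qed
qed (simp_all add: algebra_simps)

lemma homog_le_kap_right:
  assumes "x \<in> homog_le n m" shows "x * kap c = kap c * x"
  using assms
proof (induction rule: homog_le.induct)
  case (homog_le_step x y)
  obtain d \<alpha> A \<beta> where x: "x = kap d * spath \<alpha> * P A * gpath \<beta>" "set \<alpha> \<subseteq> E" "set \<beta> \<subseteq> E" "A \<in> GV"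
    using \<open>x \<in> monomials n m\<close> by (rule monomialsE)
  have "x * kap c = kap d * spath \<alpha> * P A * (gpath \<beta> * kap c)" by (simp add: x(1) mult.assoc)
  also have "\<dots> = kap d * spath \<alpha> * (P A * kap c) * gpath \<beta>" by (simp add: kap_gpath x mult.assoc)
  also have "\<dots> = kap d * (spath \<alpha> * kap c) * P A * gpath \<beta>" by (simp add: kap_P x mult.assoc)
  also have "\<dots> = (kap d * kap c) * spath \<alpha> * P A * gpath \<beta>" by (simp add: kap_spath x mult.assoc)
  also have "\<dots> = kap c * x" by (simp add: kap_comm[of d] x(1) mult.assoc)
  finally have "x * kap c = kap c * x" .
  with homog_le_step show ?case by (simp add: algebra_simps)
qed simp

lemma homogI: "x \<in> homog_le n m \<Longrightarrow> x \<in> homog n" by (auto simp: homog_def)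
lemma homog_zero: "0 \<in> homog n" by (rule homogI[OF homog_le_zero[of n 0]])

lemma homog_add: assumes "x \<in> homog n" "y \<in> homog n" shows "x + y \<in> homog n"
proof -
  obtain m m' where "x \<in> homog_le n m" "y \<in> homog_le n m'" using assms by (auto simp: homog_def)
  then have "x \<in> homog_le n (max m m')" "y \<in> homog_le n (max m m')" by (auto intro: homog_le_mono)
  then show ?thesis by (intro homogI[OF homog_le_add])
qed

lemma homog_uminus: "x \<in> homog n \<Longrightarrow> - x \<in> homog n" by (auto simp: homog_def intro: homog_le_uminus)
lemma homog_diff: "\<lbrakk>x \<in> homog n; y \<in> homog n\<rbrakk> \<Longrightarrow> x - y \<in> homog n"
  using homog_add[of x n "- y"] homog_uminus[of y] by simp
lemma homog_kap: "x \<in> homog n \<Longrightarrow> kap c * x \<in> homog n" by (auto simp: homog_def intro: homog_le_kap)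
lemma homog_kap_right: "x \<in> homog n \<Longrightarrow> x * kap c = kap c * x" by (auto simp: homog_def dest: homog_le_kap_right)
lemma homog_sum: "(\<And>k. k \<in> K \<Longrightarrow> f k \<in> homog n) \<Longrightarrow> sum f K \<in> homog n"
  by (induction K rule: infinite_finite_induct) (auto intro: homog_add homog_zero)

lemma homog_S_right: "\<lbrakk>x \<in> homog n; e \<in> E; n' = n + 1\<rbrakk> \<Longrightarrow> x * S e \<in> homog n'"
  unfolding homog_def using homog_le_S_right by blast
lemma homog_T_right: "\<lbrakk>x \<in> homog n; e \<in> E; n' = n - 1\<rbrakk> \<Longrightarrow> x * T e \<in> homog n'"
  unfolding homog_def using homog_le_T_right by blast
lemma homog_P_right: "\<lbrakk>x \<in> homog n; A \<in> GV\<rbrakk> \<Longrightarrow> x * P A \<in> homog n"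
  unfolding homog_def using homog_le_P_right by blast

lemma homog_S_left: "\<lbrakk>x \<in> homog n; e \<in> E; n' = n + 1\<rbrakk> \<Longrightarrow> S e * x \<in> homog n'"
  unfolding homog_def using homog_le_S_left by blast
lemma homog_spath_right: "\<lbrakk>x \<in> homog n; set \<alpha> \<subseteq> E\<rbrakk> \<Longrightarrow> x * spath \<alpha> \<in> homog (n + int (length \<alpha>))"
proof (induction \<alpha> arbitrary: x n)
  case (Cons e \<alpha>)
  then have "(x * S e) * spath \<alpha> \<in> homog (n + 1 + int (length \<alpha>))" by (intro Cons.IH homog_S_right) auto
  then show ?case by (simp add: mult.assoc algebra_simps)
qed simp

lemma homog_gpath_right: "\<lbrakk>x \<in> homog n; set \<alpha> \<subseteq> E\<rbrakk> \<Longrightarrow> x * gpath \<alpha> \<in> homog (n - int (length \<alpha>))"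
proof (induction \<alpha> arbitrary: x n)
  case (Cons e \<alpha>)
  then have "(x * gpath \<alpha>) * T e \<in> homog (n - int (length \<alpha>) - 1)" by (intro homog_T_right[OF Cons.IH]) auto
  then show ?case by (simp add: mult.assoc algebra_simps)
qed simp

lemma homog_mult:
  assumes x: "x \<in> homog n" and y: "y \<in> homog n'" and "N = n + n'" shows "x * y \<in> homog N"
proof -
  obtain m where "y \<in> homog_le n' m" using y by (auto simp: homog_def)
  then have "x * y \<in> homog (n + n')"
  proof (induction rule: homog_le.induct)
    case (homog_le_step y z)
    obtain d \<alpha> A \<beta> where y: "y = kap d * spath \<alpha> * P A * gpath \<beta>" "set \<alpha> \<subseteq> E" "set \<beta> \<subseteq> E" "A \<in> GV"
      "int (length \<alpha>) - int (length \<beta>) = n'" "length \<beta> \<le> m" using homog_le_step(1) by (rule monomialsE)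
    have "kap d * x * spath \<alpha> * P A * gpath \<beta> \<in> homog (n + int (length \<alpha>) - int (length \<beta>))"
      using y x by (intro homog_gpath_right homog_P_right homog_spath_right homog_kap)
    moreover have "x * y = (x * kap d) * spath \<alpha> * P A * gpath \<beta>"
      by (simp add: y mult.assoc)
    then have "x * y = kap d * x * spath \<alpha> * P A * gpath \<beta>"
      by (simp only: homog_kap_right[OF x])
    ultimately have "x * y \<in> homog (n + n')" using y(5) by (simp add: algebra_simps)
    with homog_le_step show ?case by (simp add: distrib_left homog_add)
  qed (simp add: homog_zero)
  with assms show ?thesis by simp
qed

lemma P_homog: "A \<in> GV \<Longrightarrow> P A \<in> homog 0"
  using monomialsI[of "[]" "[]" A 0 0 1] by (auto simp: kap_one intro!: homogI monomials_homog_le)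

lemma S_homog: "e \<in> E \<Longrightarrow> S e \<in> homog 1"
  using homog_S_left[OF P_homog[OF rge_gv], of e e 1] by (simp add: S_P_rge)

lemma T_homog: "e \<in> E \<Longrightarrow> T e \<in> homog (- 1)"
  using homog_T_right[OF P_homog[OF rge_gv], of e e "- 1"] by (simp add: P_rge_T)

text \<open>A projection that fixes an element may be replaced by a larger one; two elements thus have a common
  local unit.\<close>

lemma P_left_mono:
  assumes "U0 \<in> GV" "B \<in> GV" "U0 \<subseteq> B" "P U0 * x = x" shows "P B * x = x"
proof -
  have "P B * x = P B * P U0 * x" using assms by (simp add: mult.assoc)
  then show ?thesis using assms P_mult[of B U0] by (simp add: Int_absorb1)
qed

lemma P_right_mono:
  assumes "U0 \<in> GV" "B \<in> GV" "U0 \<subseteq> B" "x * P U0 = x" shows "x * P B = x"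
proof -
  have "x * P B = x * (P U0 * P B)" using assms by (simp add: mult.assoc[symmetric])
  then show ?thesis using assms P_mult[of U0 B] by (simp add: Int_absorb2)
qed

lemma local_unit_left_add:
  assumes "\<exists>U\<in>GV. P U * x = x" "\<exists>U\<in>GV. P U * y = y"
  shows "\<exists>U\<in>GV. P U * (x + y) = x + y"
proof -
  obtain U0 U1 where U: "U0 \<in> GV" "P U0 * x = x" "U1 \<in> GV" "P U1 * y = y" using assms by blast
  have "P (U0 \<union> U1) * x = x" "P (U0 \<union> U1) * y = y"
    using P_left_mono[OF U(1) gv_Un[OF U(1,3)] _ U(2)] P_left_mono[OF U(3) gv_Un[OF U(1,3)] _ U(4)] by auto
  then show ?thesis using gv_Un[OF U(1,3)] by (intro bexI[of _ "U0 \<union> U1"]) (simp_all add: distrib_left)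
qed

lemma local_unit_right_add:
  assumes "\<exists>U\<in>GV. x * P U = x" "\<exists>U\<in>GV. y * P U = y"
  shows "\<exists>U\<in>GV. (x + y) * P U = x + y"
proof -
  obtain U0 U1 where U: "U0 \<in> GV" "x * P U0 = x" "U1 \<in> GV" "y * P U1 = y" using assms by blast
  have "x * P (U0 \<union> U1) = x" "y * P (U0 \<union> U1) = y"
    using P_right_mono[OF U(1) gv_Un[OF U(1,3)] _ U(2)] P_right_mono[OF U(3) gv_Un[OF U(1,3)] _ U(4)] by auto
  then show ?thesis using gv_Un[OF U(1,3)] by (intro bexI[of _ "U0 \<union> U1"]) (simp_all add: distrib_right)
qed

lemma local_unit_left:
  assumes "x \<in> homog_le n m" shows "\<exists>U\<in>GV. P U * x = x"
  using assms
proof (induction rule: homog_le.induct)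
  case (homog_le_step x y)
  obtain d \<alpha> A \<beta> where x: "x = kap d * spath \<alpha> * P A * gpath \<beta>" "set \<alpha> \<subseteq> E" "A \<in> GV"
    using homog_le_step(1) by (auto elim!: monomialsE)
  have px: "P U * x = kap d * (P U * spath \<alpha>) * P A * gpath \<beta>" if "U \<in> GV" for U
    unfolding x(1) mult.assoc[symmetric] kap_P[OF that] ..
  have "\<exists>U\<in>GV. P U * x = x"
  proof (cases \<alpha>)
    case Nil
    then show ?thesis using px[OF x(3)] x P_mult[OF x(3) x(3)] by (auto simp: mult.assoc intro!: bexI[of _ A])
  next
    case (Cons e \<alpha>')
    then have e: "e \<in> E" using x by simp
    then have "P {src G e} * spath \<alpha> = spath \<alpha>" using Cons by (simp add: mult.assoc[symmetric] P_src_S)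
    then show ?thesis using px[OF src_gv[OF e]] x src_gv[OF e] by auto
  qed
  then show ?case using homog_le_step.IH by (rule local_unit_left_add)
qed (auto intro: gv_empty)

lemma local_unit_right:
  assumes "x \<in> homog_le n m" shows "\<exists>U\<in>GV. x * P U = x"
  using assms
proof (induction rule: homog_le.induct)
  case (homog_le_step x y)
  obtain d \<alpha> A \<beta> where x: "x = kap d * spath \<alpha> * P A * gpath \<beta>" "set \<beta> \<subseteq> E" "A \<in> GV"
    using homog_le_step(1) by (auto elim!: monomialsE)
  have "\<exists>U\<in>GV. x * P U = x"
  proof (cases \<beta>)
    case Nil
    then show ?thesis using x P_mult[OF x(3) x(3)] by (auto simp: mult.assoc intro!: bexI[of _ A])
  next
    case (Cons e \<beta>')
    then have e: "e \<in> E" using x by simp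
    then have "gpath \<beta> * P {src G e} = gpath \<beta>" using Cons by (simp add: mult.assoc T_P_src)
    then show ?thesis using x src_gv[OF e] by (intro bexI[of _ "{src G e}"]) (simp_all add: mult.assoc)
  qed
  then show ?case using homog_le_step.IH by (rule local_unit_right_add)
qed (auto intro: gv_empty)

lemma P_spath_gpath:
  assumes "A \<in> GV" "set \<alpha> \<subseteq> E" "\<alpha> \<noteq> []"
  shows "(P A * spath \<alpha> = spath \<alpha> \<and> gpath \<alpha> * P A = gpath \<alpha>) \<or> (P A * spath \<alpha> = 0 \<and> gpath \<alpha> * P A = 0)"
proof -
  obtain e \<alpha>' where a: "\<alpha> = e # \<alpha>'" using assms by (cases \<alpha>) auto
  have "P A * spath \<alpha> = (P A * S e) * spath \<alpha>'" "gpath \<alpha> * P A = gpath \<alpha>' * (T e * P A)"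
    using a by (simp_all add: mult.assoc)
  then show ?thesis using P_S[OF assms(1), of e] T_P[OF assms(1), of e] a assms(2) by auto
qed

lemma spath_last:
  assumes "set \<alpha> \<subseteq> E" "\<alpha> \<noteq> []"
  shows "spath \<alpha> * P (rge G (last \<alpha>)) = spath \<alpha>" "P (rge G (last \<alpha>)) * gpath \<alpha> = gpath \<alpha>"
proof -
  have a: "spath \<alpha> = spath (butlast \<alpha>) * S (last \<alpha>)" "gpath \<alpha> = T (last \<alpha>) * gpath (butlast \<alpha>)"
    using spath_simps(3)[of "butlast \<alpha>" "[last \<alpha>]"] gpath_simps(3)[of "butlast \<alpha>" "[last \<alpha>]"] assms(2) by simp_all
  have "last \<alpha> \<in> E" using assms by (meson last_in_set subsetD)
  then show "spath \<alpha> * P (rge G (last \<alpha>)) = spath \<alpha>" "P (rge G (last \<alpha>)) * gpath \<alpha> = gpath \<alpha>"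
    unfolding a by (simp_all add: mult.assoc S_P_rge) (simp add: mult.assoc[symmetric] P_rge_T)
qed

lemma gpath_spath:
  assumes "set \<alpha> \<subseteq> E" "\<alpha> \<noteq> []" "spath \<alpha> \<noteq> 0"
  shows "gpath \<alpha> * spath \<alpha> = P (rge G (last \<alpha>))"
  using assms
proof (induction \<alpha>)
  case (Cons e \<alpha>)
  then have e: "e \<in> E" by simp
  show ?case
  proof (cases "\<alpha> = []")
    case True
    then show ?thesis using e by (simp add: T_S)
  next
    case False
    have "S e * spath \<alpha> = S e * (P (rge G e) * spath \<alpha>)" using e by (simp add: mult.assoc[symmetric] S_P_rge)
    then have "P (rge G e) * spath \<alpha> = spath \<alpha>"
      using P_spath_gpath[OF rge_gv[OF e], of \<alpha>] Cons.prems False by auto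
    moreover have "gpath (e # \<alpha>) * spath (e # \<alpha>) = gpath \<alpha> * (T e * S e) * spath \<alpha>" by (simp add: mult.assoc)
    ultimately have "gpath (e # \<alpha>) * spath (e # \<alpha>) = gpath \<alpha> * spath \<alpha>" using e by (simp add: T_S mult.assoc)
    moreover have "spath \<alpha> \<noteq> 0" using Cons.prems by auto
    ultimately show ?thesis using Cons.IH Cons.prems False by simp
  qed
qed simp

text \<open>A ghost-free element of degree zero is a combination of the \<open>P A\<close>, each of which fixes or kills a
  given nonempty path.\<close>

lemma vertex_mult_spath:
  assumes "y \<in> homog_le 0 0" "set \<alpha> \<subseteq> E" "\<alpha> \<noteq> []"
  shows "\<exists>c. y * spath \<alpha> = kap c * spath \<alpha>"
  using assms(1)
proof (induction rule: homog_le.induct)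
  case homog_le_zero
  then show ?case using kap_zero by (metis mult_zero_left)
next
  case (homog_le_step x y)
  obtain d A where x: "x = kap d * P A" "A \<in> GV"
    using homog_le_step(1) by (auto elim!: monomialsE)
  obtain c where c: "y * spath \<alpha> = kap c * spath \<alpha>" using homog_le_step by blast
  have "x * spath \<alpha> = kap d * spath \<alpha> \<or> x * spath \<alpha> = kap 0 * spath \<alpha>"
    using P_spath_gpath[OF x(2) assms(2,3)] x(1) by (auto simp: mult.assoc kap_zero)
  then obtain d' where "x * spath \<alpha> = kap d' * spath \<alpha>" by blast
  then show ?case using c by (intro exI[of _ "d' + c"]) (simp add: distrib_right kap_add)
qed

lemma homog_le_gpath_left:
  "\<lbrakk>x \<in> homog_le n m; set \<alpha> \<subseteq> E; int (length \<alpha>) \<le> n\<rbrakk> \<Longrightarrow> gpath \<alpha> * x \<in> homog_le (n - int (length \<alpha>)) m"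
proof (induction \<alpha> arbitrary: x n)
  case (Cons e \<alpha>)
  then have "T e * x \<in> homog_le (n - 1) m" using homog_le_T_left[of x n m e] by simp
  then have "gpath \<alpha> * (T e * x) \<in> homog_le (n - 1 - int (length \<alpha>)) m"
    by (rule Cons.IH) (use Cons in auto)
  then show ?case by (simp add: mult.assoc algebra_simps)
qed simp

lemma spath_gpath_homog:
  assumes "set \<alpha> \<subseteq> E" "\<alpha> \<noteq> []"
  shows "spath \<alpha> \<in> homog (int (length \<alpha>))" "gpath \<alpha> \<in> homog (- int (length \<alpha>))"
proof -
  let ?A = "rge G (last \<alpha>)"
  have A: "?A \<in> GV" using assms by (intro gv_range) auto
  have "kap 1 * spath \<alpha> * P ?A * gpath [] \<in> monomials (int (length \<alpha>)) 0"
    using assms A by (intro monomialsI) auto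
  then have "kap 1 * spath \<alpha> * P ?A * gpath [] \<in> homog (int (length \<alpha>))" by (intro homogI monomials_homog_le)
  then show "spath \<alpha> \<in> homog (int (length \<alpha>))" using spath_last[OF assms] by (simp add: kap_one)
  have "kap 1 * spath [] * P ?A * gpath \<alpha> \<in> monomials (- int (length \<alpha>)) (length \<alpha>)"
    using assms A by (intro monomialsI) auto
  then have "kap 1 * spath [] * P ?A * gpath \<alpha> \<in> homog (- int (length \<alpha>))" by (intro homogI monomials_homog_le)
  then show "gpath \<alpha> \<in> homog (- int (length \<alpha>))" using spath_last[OF assms] by (simp add: kap_one)
qed

lemma homog_le_spath_right:
  "\<lbrakk>x \<in> homog_le n m; set \<alpha> \<subseteq> E\<rbrakk> \<Longrightarrow> x * spath \<alpha> \<in> homog_le (n + int (length \<alpha>)) (m - length \<alpha>)"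
proof (induction \<alpha> arbitrary: x n m)
  case (Cons e \<alpha>)
  then have "x * S e \<in> homog_le (n + 1) (m - 1)" using homog_le_S_right[of x n m e] by simp
  then have "(x * S e) * spath \<alpha> \<in> homog_le (n + 1 + int (length \<alpha>)) (m - 1 - length \<alpha>)"
    by (rule Cons.IH) (use Cons in auto)
  then show ?case by (simp add: mult.assoc algebra_simps)
qed simp

text \<open>If the word \<open>\<gamma>\<close> is at most as long as \<open>\<epsilon>\<close>, then \<open>s\<^sub>\<epsilon>\<^sup>* s\<^sub>\<gamma>\<close> vanishes unless \<open>\<gamma>\<close> is an initial segment of \<open>\<epsilon>\<close>.\<close>

lemma gpath_spath_prefix:
  assumes "set \<epsilon> \<subseteq> E" "set \<gamma> \<subseteq> E" "length \<gamma> \<le> length \<epsilon>" "gpath \<epsilon> * spath \<gamma> \<noteq> 0"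
  shows "\<gamma> = take (length \<gamma>) \<epsilon>"
  using assms
proof (induction \<gamma> arbitrary: \<epsilon>)
  case (Cons f \<gamma>)
  then obtain e \<epsilon>' where \<epsilon>: "\<epsilon> = e # \<epsilon>'" by (cases \<epsilon>) auto
  have ef: "e \<in> E" "f \<in> E" using Cons.prems \<epsilon> by auto
  have eq: "gpath \<epsilon> * spath (f # \<gamma>) = gpath \<epsilon>' * (T e * S f) * spath \<gamma>" by (simp add: \<epsilon> mult.assoc)
  then have "T e * S f \<noteq> 0" using Cons.prems(4) by auto
  then have [simp]: "f = e" using T_S[OF ef] by (auto split: if_splits)
  show ?case
  proof (cases "\<gamma> = []")
    case False
    have "gpath \<epsilon>' * (P (rge G e) * spath \<gamma>) \<noteq> 0" using eq Cons.prems(4) ef by (simp add: T_S mult.assoc)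
    then have "gpath \<epsilon>' * spath \<gamma> \<noteq> 0"
      using P_spath_gpath[OF rge_gv[OF ef(1)] _ False] Cons.prems(2) by auto
    then show ?thesis using Cons.IH[of \<epsilon>'] Cons.prems \<epsilon> by auto
  qed (simp add: \<epsilon>)
qed simp

end

section \<open>Reduction of homogeneous elements to idempotents\<close>

context leavitt_family begin

text \<open>An element of positive degree is recovered from its left products with the ghosts of finitely many
  edges. Any larger finite set of edges works too, which makes the sets for two summands compatible.\<close>

lemma first_edges_homog_le:
  assumes "x \<in> homog_le n m" "1 \<le> n"
  shows "\<exists>F. finite F \<and> F \<subseteq> E \<and> (\<forall>F'. finite F' \<and> F \<subseteq> F' \<and> F' \<subseteq> E \<longrightarrow> x = (\<Sum>e\<in>F'. S e * (T e * x)))"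
  using assms(1)
proof (induction rule: homog_le.induct)
  case homog_le_zero
  then show ?case by (intro exI[of _ "{}"]) simp
next
  case (homog_le_step x y)
  obtain d \<alpha> A \<beta> where x: "x = kap d * spath \<alpha> * P A * gpath \<beta>" "set \<alpha> \<subseteq> E"
    "int (length \<alpha>) - int (length \<beta>) = n" using homog_le_step(1) by (rule monomialsE)
  then obtain e \<alpha>' where \<alpha>: "\<alpha> = e # \<alpha>'" using assms(2) by (cases \<alpha>) auto
  let ?w = "kap d * spath \<alpha>' * P A * gpath \<beta>"
  have e: "e \<in> E" using x \<alpha> by simp
  have "x = (kap d * S e) * spath \<alpha>' * P A * gpath \<beta>" using x \<alpha> by (simp add: mult.assoc)
  then have "x = (S e * kap d) * spath \<alpha>' * P A * gpath \<beta>" by (simp only: kap_S[OF e])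
  then have xe: "x = S e * ?w" by (simp add: mult.assoc)
  have T: "T f * x = (if f = e then P (rge G e) * ?w else 0)" if "f \<in> E" for f
    using T_S[OF that e] xe by (auto simp: mult.assoc[symmetric])
  obtain F where F: "finite F" "F \<subseteq> E"
    "\<And>F'. finite F' \<and> F \<subseteq> F' \<and> F' \<subseteq> E \<Longrightarrow> y = (\<Sum>e\<in>F'. S e * (T e * y))"
    using homog_le_step.IH by blast
  show ?case
  proof (intro exI[of _ "insert e F"] conjI allI impI)
    fix F' assume F': "finite F' \<and> insert e F \<subseteq> F' \<and> F' \<subseteq> E"
    have "(\<Sum>f\<in>F'. S f * (T f * x)) = (\<Sum>f\<in>F'. if f = e then S e * (P (rge G e) * ?w) else 0)"
      using F' by (intro sum.cong) (auto simp: T)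
    also have "\<dots> = S e * P (rge G e) * ?w" using F' by (simp add: mult.assoc)
    also have "\<dots> = x" using xe e by (simp add: S_P_rge)
    finally show "x + y = (\<Sum>e\<in>F'. S e * (T e * (x + y)))"
      using F(3)[of F'] F' by (simp add: distrib_left sum.distrib)
  qed (use F e in auto)
qed

lemma first_edges:
  assumes "x \<in> homog n" "1 \<le> n"
  obtains F where "finite F" "F \<subseteq> E" "x = (\<Sum>e\<in>F. S e * (T e * x))"
proof -
  obtain m where "x \<in> homog_le n m" using assms by (auto simp: homog_def)
  then show ?thesis using first_edges_homog_le[OF _ assms(2), of x m] that by blast
qed

text \<open>Splitting off the last ghost edge of every monomial. The coefficients \<open>z e\<close> are extended by zero
  outside \<open>F\<close>, so that the sets of edges can be enlarged in the induction.\<close>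

lemma last_ghosts:
  assumes "x \<in> homog_le n (Suc m)"
  shows "\<exists>y F z. finite F \<and> F \<subseteq> E \<and> y \<in> homog_le n 0 \<and> (\<forall>e. e \<notin> F \<longrightarrow> z e = 0) \<and>
    (\<forall>e\<in>F. z e \<in> homog_le (n + 1) m \<and> z e * P (rge G e) = z e) \<and> x = y + (\<Sum>e\<in>F. z e * T e)"
  using assms
proof (induction rule: homog_le.induct)
  case homog_le_zero
  then show ?case by (intro exI[of _ 0] exI[of _ "{}"] exI[of _ "\<lambda>_. 0"]) (simp add: homog_le.homog_le_zero)
next
  case (homog_le_step x x')
  obtain y F z where IH: "finite F" "F \<subseteq> E" "y \<in> homog_le n 0" "\<And>e. e \<notin> F \<Longrightarrow> z e = 0"
    "\<And>e. e\<in>F \<Longrightarrow> z e \<in> homog_le (n + 1) m" "\<And>e. e\<in>F \<Longrightarrow> z e * P (rge G e) = z e"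
    "x' = y + (\<Sum>e\<in>F. z e * T e)"
    using homog_le_step.IH by blast
  obtain d \<alpha> A \<beta> where x: "x = kap d * spath \<alpha> * P A * gpath \<beta>" "set \<alpha> \<subseteq> E" "set \<beta> \<subseteq> E" "A \<in> GV"
    "int (length \<alpha>) - int (length \<beta>) = n" "length \<beta> \<le> Suc m" using homog_le_step(1) by (rule monomialsE)
  show ?case
  proof (cases \<beta>)
    case Nil
    then have "x \<in> homog_le n 0" using x by (auto intro!: monomials_homog_le monomialsI simp del: gpath_simps)
    then show ?thesis using IH
      by (intro exI[of _ "x + y"] exI[of _ F] exI[of _ z]) (simp add: homog_le_add add.assoc)
  next
    case (Cons e \<beta>')
    have e: "e \<in> E" using x Cons by simp
    let ?w = "kap d * spath \<alpha> * P A * gpath \<beta>'"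
    let ?w' = "?w * P (rge G e)"
    have w': "?w' \<in> homog_le (n + 1) m" "?w' * P (rge G e) = ?w'"
    proof -
      show "?w' \<in> homog_le (n + 1) m" using x Cons e by (intro homog_le_P_right monomials_homog_le monomialsI gv_range) auto
      show "?w' * P (rge G e) = ?w'"
        using P_mult[OF rge_gv[OF e] rge_gv[OF e]] by (simp add: mult.assoc)
    qed
    have xw: "x = ?w' * T e" using x Cons e by (simp add: mult.assoc P_rge_T)
    let ?z = "z(e := z e + ?w')"
    have "(\<Sum>f\<in>insert e F. ?z f * T f) = (\<Sum>f\<in>insert e F. z f * T f + (if f = e then ?w' * T e else 0))"
      by (intro sum.cong) (auto simp: distrib_right)
    also have "\<dots> = (\<Sum>f\<in>insert e F. z f * T f) + x"
      using IH(1) xw by (simp add: sum.distrib)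
    also have "(\<Sum>f\<in>insert e F. z f * T f) = (\<Sum>f\<in>F. z f * T f)"
      using IH(1,4) by (cases "e \<in> F") (simp_all add: insert_absorb)
    finally have s: "x + x' = y + (\<Sum>f\<in>insert e F. ?z f * T f)" using IH(7) by (simp add: add_ac)
    have z: "z e \<in> homog_le (n + 1) m \<and> z e * P (rge G e) = z e"
      by (cases "e \<in> F") (simp_all add: IH homog_le.homog_le_zero)
    have z': "z e + ?w' \<in> homog_le (n + 1) m \<and> (z e + ?w') * P (rge G e) = z e + ?w'"
      using z w' by (simp add: homog_le_add distrib_right)
    show ?thesis
      by (rule exI[of _ y], rule exI[of _ "insert e F"], rule exI[of _ ?z])
        (use IH z' e s in auto)
  qed
qed

lemma ghost_free_neg: "x \<in> homog_le n 0 \<Longrightarrow> n < 0 \<Longrightarrow> x = 0"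
  by (induction rule: homog_le.induct) (auto elim!: monomialsE)

text \<open>The projection \<open>p\<^sub>B\<close> minus the part that passes through the edges in \<open>F\<close>. It is an idempotent
  if \<open>F\<close> consists of edges that start in \<open>B\<close>.\<close>

definition gap :: "'v set \<Rightarrow> 'e set \<Rightarrow> 'a" where
  "gap B F = P B - (\<Sum>e\<in>F. S e * T e)"

text \<open>The idempotents of this form; they include all \<open>P B\<close>.\<close>

definition gap_idem :: "'a \<Rightarrow> bool" where
  "gap_idem q \<longleftrightarrow> (\<exists>B F. B \<in> GV \<and> finite F \<and> F \<subseteq> E \<and> (\<forall>e\<in>F. src G e \<in> B) \<and> q = gap B F)"

lemma ST_homog: "e \<in> E \<Longrightarrow> S e * T e \<in> homog 0"
  by (rule homog_mult[OF S_homog T_homog]) auto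

lemma sum_ST_S:
  assumes "finite F" "F \<subseteq> E" "f \<in> E"
  shows "(\<Sum>e\<in>F. S e * T e) * S f = (if f \<in> F then S f else 0)"
proof -
  have "(\<Sum>e\<in>F. S e * T e) * S f = (\<Sum>e\<in>F. if e = f then S f else 0)"
    unfolding sum_distrib_right using assms by (intro sum.cong) (auto simp: mult.assoc T_S S_P_rge)
  then show ?thesis using assms by simp
qed

lemma T_sum_ST:
  assumes "finite F" "F \<subseteq> E" "f \<in> E"
  shows "T f * (\<Sum>e\<in>F. S e * T e) = (if f \<in> F then T f else 0)"
proof -
  have "T f * (\<Sum>e\<in>F. S e * T e) = (\<Sum>e\<in>F. if e = f then T f else 0)"
    unfolding sum_distrib_left using assms
    by (intro sum.cong) (auto simp: mult.assoc[symmetric] T_S P_rge_T)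
  then show ?thesis using assms by simp
qed

lemma gap_facts:
  assumes "B \<in> GV" "finite F" "F \<subseteq> E" "\<forall>e\<in>F. src G e \<in> B"
  shows "gap B F \<in> homog 0"
    and "\<And>f. f \<in> E \<Longrightarrow> gap B F * S f = (if src G f \<in> B \<and> f \<notin> F then S f else 0)"
    and "\<And>f. f \<in> E \<Longrightarrow> T f * gap B F = (if src G f \<in> B \<and> f \<notin> F then T f else 0)"
    and "gap B F * gap B F = gap B F"
proof -
  show "gap B F \<in> homog 0" unfolding gap_def using assms
    by (intro homog_diff homog_sum P_homog ST_homog) auto
  show gS: "gap B F * S f = (if src G f \<in> B \<and> f \<notin> F then S f else 0)" if "f \<in> E" for f
    using assms that by (auto simp: gap_def left_diff_distrib sum_ST_S P_S)
  show "T f * gap B F = (if src G f \<in> B \<and> f \<notin> F then T f else 0)" if "f \<in> E" for f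
    using assms that by (auto simp: gap_def right_diff_distrib T_sum_ST T_P)
  have "(\<Sum>e\<in>F. S e * T e) * P B = (\<Sum>e\<in>F. S e * T e)"
    unfolding sum_distrib_right using assms by (intro sum.cong) (auto simp: mult.assoc T_P)
  then have "gap B F * P B = gap B F" using assms by (simp add: gap_def left_diff_distrib P_mult)
  moreover have "gap B F * (\<Sum>e\<in>F. S e * T e) = 0"
    unfolding sum_distrib_left using assms gS
    by (intro sum.neutral) (auto simp: mult.assoc[symmetric])
  ultimately have "gap B F * (P B - (\<Sum>e\<in>F. S e * T e)) = gap B F" by (simp add: right_diff_distrib)
  then show "gap B F * gap B F = gap B F" by (simp add: gap_def[symmetric])
qed

lemma gap_idem_facts:
  assumes "gap_idem q"
  shows "q \<in> homog 0" "q * q = q" "\<And>f. f \<in> E \<Longrightarrow> (q * S f = S f \<and> T f * q = T f) \<or> (q * S f = 0 \<and> T f * q = 0)"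
proof -
  obtain B F where "B \<in> GV" "finite F" "F \<subseteq> E" "\<forall>e\<in>F. src G e \<in> B" "q = gap B F"
    using assms unfolding gap_idem_def by blast
  note g = gap_facts[OF this(1-4)] this(5)
  show "q \<in> homog 0" "q * q = q" using g by auto
  show "(q * S f = S f \<and> T f * q = T f) \<or> (q * S f = 0 \<and> T f * q = 0)" if "f \<in> E" for f
    using g(2,3)[OF that] g(5) by (auto split: if_splits)
qed

lemma gap_idem_P: "A \<in> GV \<Longrightarrow> gap_idem (P A)"
  unfolding gap_idem_def by (intro exI[of _ A] exI[of _ "{}"]) (simp add: gap_def)

lemma gap_idem_P_mult:
  assumes "B \<in> GV" "finite F" "F \<subseteq> E"
  shows "gap_idem (P B * (1 - (\<Sum>e\<in>F. S e * T e)))"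
proof -
  have "P B * (\<Sum>e\<in>F. S e * T e) = (\<Sum>e\<in>F. if src G e \<in> B then S e * T e else 0)"
    unfolding sum_distrib_left using assms
    by (intro sum.cong) (auto simp: mult.assoc[symmetric] P_S)
  also have "\<dots> = (\<Sum>e\<in>{e\<in>F. src G e \<in> B}. S e * T e)"
    using assms by (simp add: sum.inter_filter)
  finally show ?thesis unfolding gap_idem_def
    using assms by (intro exI[of _ B] exI[of _ "{e\<in>F. src G e \<in> B}"]) (auto simp: gap_def right_diff_distrib)
qed

text \<open>A ghost-free element of degree zero acts as a scalar on some \<open>P B\<close>, and \<open>B\<close> can be chosen so that
  \<open>P B\<close> does not kill a given \<open>z\<close>: for each summand \<open>P A\<close>, cut the current set by \<open>A\<close> or by its complement.\<close>

lemma vertex_atom: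
  assumes "y \<in> homog_le 0 0" "U \<in> GV" "P U * z \<noteq> 0"
  shows "\<exists>B c. B \<in> GV \<and> P B * y = kap c * P B \<and> P B * z \<noteq> 0 \<and> B \<subseteq> U"
  using assms
proof (induction arbitrary: U rule: homog_le.induct)
  case homog_le_zero
  then show ?case by (intro exI[of _ U] exI[of _ 0]) (simp add: kap_zero)
next
  case (homog_le_step x y)
  obtain d A where x: "x = kap d * P A" "A \<in> GV"
    using homog_le_step(1) by (auto elim!: monomialsE)
  have gv: "U \<inter> A \<in> GV" "U - A \<in> GV" using homog_le_step x by (auto intro: gv_Int gv_Diff)
  have PBx: "P B * x = kap d * P (B \<inter> A)" if "B \<in> GV" for B
    using that x by (simp add: mult.assoc[symmetric] kap_P) (simp add: mult.assoc P_mult)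
  have "P U * z = P (U \<inter> A) * z + P (U - A) * z"
    using P_split[of U A] homog_le_step x by (simp add: distrib_right)
  then consider "P (U \<inter> A) * z \<noteq> 0" | "P (U - A) * z \<noteq> 0" using homog_le_step by force
  then show ?case
  proof cases
    case 1
    then obtain B c where B: "B \<in> GV" "P B * y = kap c * P B" "P B * z \<noteq> 0" "B \<subseteq> U \<inter> A"
      using homog_le_step.IH[OF gv(1)] by blast
    moreover have "B \<inter> A = B" using B by auto
    ultimately show ?thesis
      by (intro exI[of _ B] exI[of _ "d + c"]) (auto simp: distrib_left distrib_right kap_add PBx)
  next
    case 2
    then obtain B c where B: "B \<in> GV" "P B * y = kap c * P B" "P B * z \<noteq> 0" "B \<subseteq> U - A"
      using homog_le_step.IH[OF gv(2)] by blast
    moreover have "B \<inter> A = {}" using B by auto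
    ultimately show ?thesis
      by (intro exI[of _ B] exI[of _ "c"]) (auto simp: distrib_left distrib_right kap_add PBx P_empty)
  qed
qed

text \<open>Strip off the paths of \<open>y\<close> edge by edge from the left, keeping the product with \<open>1 - \<Sum> S e T e\<close>
  nonzero; in degree zero, cut down to a set on which \<open>y\<close> is a nonzero scalar.\<close>

lemma reduce_ghost_free:
  assumes "y \<in> homog_le (int N) 0" "finite F" "F \<subseteq> E" "y * (1 - (\<Sum>e\<in>F. S e * T e)) \<noteq> 0"
  shows "\<exists>a q. a \<in> homog (- int N) \<and> gap_idem q \<and> q \<noteq> 0 \<and> a * (y * (1 - (\<Sum>e\<in>F. S e * T e))) = q"
  using assms(1,4)
proof (induction N arbitrary: y)
  let ?z = "1 - (\<Sum>e\<in>F. S e * T e)"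
  case 0
  then have y: "y \<in> homog_le 0 0" by simp
  obtain U where U: "U \<in> GV" "P U * y = y" using local_unit_left[OF y] by blast
  have "P U * (y * ?z) \<noteq> 0" using U 0 by (simp add: mult.assoc[symmetric])
  then obtain B c where B: "B \<in> GV" "P B * y = kap c * P B" "P B * (y * ?z) \<noteq> 0"
    using vertex_atom[OF y U(1)] by blast
  have eq: "P B * (y * ?z) = kap c * (P B * ?z)"
    using B(2) by (simp add: mult.assoc[symmetric])
  then have c: "c \<noteq> 0" using B kap_zero by auto
  have "kap (inverse c) * P B * (y * ?z) = (kap (inverse c) * kap c) * (P B * ?z)"
    using eq by (simp add: mult.assoc)
  then have "kap (inverse c) * P B * (y * ?z) = P B * ?z" by (simp add: kap_inv[OF c])
  moreover have "P B * ?z \<noteq> 0" using eq B(3) by auto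
  ultimately show ?case using B
    by (intro exI[of _ "kap (inverse c) * P B"] exI[of _ "P B * ?z"])
      (use gap_idem_P_mult[OF B(1) assms(2,3)] in \<open>auto intro: homog_kap P_homog\<close>)
next
  let ?z = "1 - (\<Sum>e\<in>F. S e * T e)"
  case (Suc N)
  have "y \<in> homog (int (Suc N))" using Suc by (auto simp: homog_def)
  then obtain K where K: "finite K" "K \<subseteq> E" "y = (\<Sum>e\<in>K. S e * (T e * y))"
    using first_edges[of y "int (Suc N)"] by auto
  have "\<exists>e\<in>K. T e * y * ?z \<noteq> 0"
  proof (rule ccontr)
    assume "\<not> ?thesis"
    then have "(\<Sum>e\<in>K. S e * (T e * y * ?z)) = 0" by (intro sum.neutral) auto
    moreover have "(\<Sum>e\<in>K. S e * (T e * y * ?z)) = (\<Sum>e\<in>K. S e * (T e * y)) * ?z"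
      unfolding sum_distrib_right by (simp add: mult.assoc)
    ultimately show False using K(3) Suc by simp
  qed
  then obtain e where e: "e \<in> K" "T e * y * ?z \<noteq> 0" by blast
  have "T e * y \<in> homog_le (int N) 0" using homog_le_T_left[OF Suc.prems(1), of e] e K by auto
  from Suc.IH[OF this e(2)] obtain a q where a: "a \<in> homog (- int N)" "gap_idem q" "q \<noteq> 0"
    "a * (T e * y * ?z) = q" by blast
  show ?case
  proof (rule exI[of _ "a * T e"], rule exI[of _ q], intro conjI)
    show "a * T e \<in> homog (- int (Suc N))" using a e K by (intro homog_T_right) auto
    show "a * T e * (y * ?z) = q" using a(4) by (simp add: mult.assoc)
  qed (use a in auto)
qed

text \<open>Induction on the ghost length. If \<open>x S e \<noteq> 0\<close> for an edge \<open>e\<close> that occurs in the last place of a ghost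
  part, multiply by it. Otherwise the equations \<open>x S e = 0\<close> determine the ghost part of \<open>x\<close> from its
  ghost-free part \<open>y\<close>, and \<open>x = y (1 - \<Sum> S e T e)\<close>.\<close>

lemma reduction_aux:
  assumes "x \<in> homog_le n m" "x \<noteq> 0"
  shows "\<exists>a b q k l. a \<in> homog k \<and> b \<in> homog l \<and> k + n + l = 0 \<and> gap_idem q \<and> q \<noteq> 0 \<and> a * x * b = q"
  using assms
proof (induction m arbitrary: x n)
  case 0
  then have "\<not> n < 0" using ghost_free_neg by blast
  then have "x \<in> homog_le (int (nat n)) 0" using 0 by simp
  from reduce_ghost_free[OF this, of "{}"] 0 obtain a q where "a \<in> homog (- int (nat n))" "gap_idem q" "q \<noteq> 0"
    "a * x = q" by auto
  then show ?case using \<open>\<not> n < 0\<close> gap_idem_facts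
    by (intro exI[of _ a] exI[of _ q] exI[of _ "- n"] exI[of _ 0]) auto
next
  case (Suc m)
  obtain y F z where x: "finite F" "F \<subseteq> E" "y \<in> homog_le n 0" "\<And>e. e \<notin> F \<Longrightarrow> z e = 0"
    "\<And>e. e\<in>F \<Longrightarrow> z e \<in> homog_le (n + 1) m" "\<And>e. e\<in>F \<Longrightarrow> z e * P (rge G e) = z e"
    "x = y + (\<Sum>e\<in>F. z e * T e)"
    using last_ghosts[OF Suc.prems(1)] by blast
  have xS: "x * S e = y * S e + z e" if "e \<in> F" for e
  proof -
    have "(\<Sum>f\<in>F. z f * T f * S e) = (\<Sum>f\<in>F. if f = e then z e else 0)"
      using x(2,6) that by (intro sum.cong) (auto simp: mult.assoc T_S subsetD)
    then have "(\<Sum>f\<in>F. z f * T f) * S e = z e" unfolding sum_distrib_right using x(1) that by simp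
    then show ?thesis unfolding x(7) by (simp add: distrib_right)
  qed
  show ?case
  proof (cases "\<exists>e\<in>F. x * S e \<noteq> 0")
    case True
    then obtain e where e: "e \<in> F" "x * S e \<noteq> 0" by blast
    have "x * S e \<in> homog_le (n + 1) m" using homog_le_S_right[OF Suc.prems(1)] e x by auto
    from Suc.IH[OF this e(2)] obtain a b q k l where
      "a \<in> homog k" "b \<in> homog l" "k + (n + 1) + l = 0" "gap_idem q" "q \<noteq> 0" "a * (x * S e) * b = q" by blast
    then show ?thesis using e x
      by (intro exI[of _ a] exI[of _ "S e * b"] exI[of _ q] exI[of _ k] exI[of _ "l + 1"])
        (auto intro: homog_S_left simp: mult.assoc)
  next
    case False
    then have "z e = - (y * S e)" if "e \<in> F" for e
      using xS[OF that] that by (simp add: eq_neg_iff_add_eq_0 add.commute)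
    then have "(\<Sum>e\<in>F. z e * T e) = - (\<Sum>e\<in>F. y * (S e * T e))"
      unfolding sum_negf[symmetric] by (intro sum.cong) (auto simp: mult.assoc)
    then have xy: "x = y * (1 - (\<Sum>e\<in>F. S e * T e))"
      using x(7) by (simp add: right_diff_distrib sum_distrib_left)
    have n: "\<not> n < 0" using ghost_free_neg[OF x(3)] xy Suc by auto
    then have "y \<in> homog_le (int (nat n)) 0" using x by simp
    from reduce_ghost_free[OF this x(1,2)] xy Suc obtain a q where "a \<in> homog (- int (nat n))" "gap_idem q" "q \<noteq> 0"
      "a * x = q" by auto
    then show ?thesis using n gap_idem_facts
      by (intro exI[of _ a] exI[of _ q] exI[of _ "- n"] exI[of _ 0]) auto
  qed
qed

text \<open>Every nonzero homogeneous element can be multiplied by homogeneous elements on both sides so as to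
  become a nonzero idempotent of the form \<open>gap B F\<close>.\<close>

lemma reduction:
  assumes "x \<in> homog n" "x \<noteq> 0"
  obtains a b q k l where "a \<in> homog k" "b \<in> homog l" "k + n + l = 0" "gap_idem q" "q \<noteq> 0" "a * x * b = q"
    "q * a = a" "b * q = b"
proof -
  obtain m where "x \<in> homog_le n m" using assms by (auto simp: homog_def)
  from reduction_aux[OF this assms(2)] obtain a b q k l where
    *: "a \<in> homog k" "b \<in> homog l" "k + n + l = 0" "gap_idem q" "q \<noteq> 0" "a * x * b = q" by blast
  note q = gap_idem_facts[OF *(4)]
  show thesis
  proof (rule that[of "q * a" k "b * q" l q])
    show "q * a \<in> homog k" "b * q \<in> homog l" using * q by (auto intro: homog_mult)
    have "(q * a) * x * (b * q) = q * (a * x * b) * q" by (simp add: mult.assoc)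
    then show "(q * a) * x * (b * q) = q" using * q by simp
    show "q * (q * a) = q * a" using q by (simp add: mult.assoc[symmetric])
    show "b * q * q = b * q" using q by (simp add: mult.assoc)
  qed (use * in auto)
qed

end

section \<open>Corners, dependencies between degrees, and closed paths\<close>

context leavitt_family begin

text \<open>The elements of degree \<open>n\<close> of the corner at \<open>p\<close>. For \<open>p = 1\<close> this is \<open>homog n\<close>, although \<open>1\<close> itself need
  not be homogeneous.\<close>

definition chomog :: "'a \<Rightarrow> int \<Rightarrow> 'a set" where "chomog p n = {x \<in> homog n. p * x = x \<and> x * p = x}"

text \<open>The elements of the corner at \<open>p\<close> that are sums of terms of degrees between \<open>a\<close> and \<open>b\<close>; such a
  presentation need not be unique.\<close>

definition window :: "'a \<Rightarrow> int \<Rightarrow> int \<Rightarrow> 'a set" where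
  "window p a b = {(\<Sum>j\<in>{a..b}. h j) | h. \<forall>j. h j \<in> chomog p j}"

lemma chomogI: "\<lbrakk>x \<in> homog n; p * x = x; x * p = x\<rbrakk> \<Longrightarrow> x \<in> chomog p n" by (simp add: chomog_def)
lemma chomogD: "x \<in> chomog p n \<Longrightarrow> x \<in> homog n" "x \<in> chomog p n \<Longrightarrow> p * x = x" "x \<in> chomog p n \<Longrightarrow> x * p = x"
  by (simp_all add: chomog_def)

lemma chomog_one: "chomog 1 n = homog n" by (auto simp: chomog_def)

lemma chomog_zero: "0 \<in> chomog p n" by (simp add: chomog_def homog_zero)
lemma chomog_add: "\<lbrakk>x \<in> chomog p n; y \<in> chomog p n\<rbrakk> \<Longrightarrow> x + y \<in> chomog p n"
  by (simp add: chomog_def homog_add distrib_left distrib_right)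
lemma chomog_uminus: "x \<in> chomog p n \<Longrightarrow> - x \<in> chomog p n"
  by (simp add: chomog_def homog_uminus)
lemma chomog_mult: "\<lbrakk>x \<in> chomog p n; y \<in> chomog p n'; N = n + n'\<rbrakk> \<Longrightarrow> x * y \<in> chomog p N"
  unfolding chomog_def by (auto intro: homog_mult simp: mult.assoc) (simp add: mult.assoc[symmetric])

lemma windowI: "\<forall>j. h j \<in> chomog p j \<Longrightarrow> (\<Sum>j\<in>{a..b}. h j) \<in> window p a b"
  unfolding window_def by blast

lemma windowE:
  assumes "x \<in> window p a b"
  obtains h where "\<And>j. h j \<in> chomog p j" "x = (\<Sum>j\<in>{a..b}. h j)"
  using assms unfolding window_def by blast

lemma window_sub: "window p a b \<subseteq> window 1 a b"
  unfolding window_def chomog_one by (auto simp: chomog_def)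

lemma window_empty: "b < a \<Longrightarrow> window p a b \<subseteq> {0}"
  by (auto simp: window_def)

lemma window_zero: "0 \<in> window p a b"
  using windowI[of "\<lambda>_. 0" p a b] chomog_zero by simp

lemma window_add: "\<lbrakk>x \<in> window p a b; y \<in> window p a b\<rbrakk> \<Longrightarrow> x + y \<in> window p a b"
  by (elim windowE) (auto simp: sum.distrib[symmetric] intro!: windowI chomog_add)

lemma window_uminus: "x \<in> window p a b \<Longrightarrow> - x \<in> window p a b"
  by (elim windowE) (auto simp: sum_negf[symmetric] intro!: windowI chomog_uminus)

lemma window_diff: "\<lbrakk>x \<in> window p a b; y \<in> window p a b\<rbrakk> \<Longrightarrow> x - y \<in> window p a b"
  using window_add[of x p a b "- y"] window_uminus[of y] by simp

lemma window_mono: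
  assumes "x \<in> window p a b" "a' \<le> a" "b \<le> b'" shows "x \<in> window p a' b'"
proof -
  obtain h where h: "\<And>j. h j \<in> chomog p j" "x = (\<Sum>j\<in>{a..b}. h j)" using assms(1) by (rule windowE) (rule that)
  have "(\<Sum>j\<in>{a'..b'}. if j \<in> {a..b} then h j else 0) = (\<Sum>j\<in>{a'..b'} \<inter> {a..b}. h j)"
    by (rule sum.inter_restrict[symmetric]) simp
  also have "{a'..b'} \<inter> {a..b} = {a..b}" using assms by auto
  finally show ?thesis using windowI[of "\<lambda>j. if j \<in> {a..b} then h j else 0" p a' b'] h chomog_zero by simp
qed

lemma chomog_window: assumes "x \<in> chomog p n" "a \<le> n" "n \<le> b" shows "x \<in> window p a b"
proof -
  have "(\<Sum>j\<in>{n..n}. if j = n then x else 0) \<in> window p n n"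
    by (rule windowI) (use assms chomog_zero in auto)
  then show ?thesis using window_mono[of x p n n a b] assms by simp
qed

lemma window_top:
  assumes "x \<in> window p a b" "a \<le> b"
  obtains y z where "y \<in> window p a (b - 1)" "z \<in> chomog p b" "x = y + z"
proof -
  obtain h where h: "\<And>j. h j \<in> chomog p j" "x = (\<Sum>j\<in>{a..b}. h j)" using assms(1) by (rule windowE) (rule that)
  have "{a..b} = insert b {a..b - 1}" using assms(2) by auto
  then have "x = (\<Sum>j\<in>{a..b - 1}. h j) + h b" using h(2) by simp
  then show thesis using that windowI[of h p a "b - 1"] h(1) by blast
qed

lemma window_map:
  assumes x: "x \<in> window p a b" and f: "\<And>j y. y \<in> chomog p j \<Longrightarrow> f y \<in> chomog p' (j + k)"
    and "f 0 = 0" "\<And>y z. f (y + z) = f y + f z"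
  shows "f x \<in> window p' (a + k) (b + k)"
proof -
  obtain h where h: "\<And>j. h j \<in> chomog p j" "x = (\<Sum>j\<in>{a..b}. h j)" using x by (rule windowE) (rule that)
  have "f x = (\<Sum>j\<in>{a..b}. f (h j))"
    using sum_comp_morphism[of f h "{a..b}"] assms(3,4) h(2) by (simp add: o_def)
  also have "\<dots> = (\<Sum>j\<in>{a+k..b+k}. f (h (j - k)))"
    by (rule sum.reindex_bij_witness[of _ "\<lambda>j. j - k" "\<lambda>j. j + k"]) auto
  finally show ?thesis using windowI[of "\<lambda>j. f (h (j - k))" p' "a + k" "b + k"] f[OF h(1)]
    by (metis diff_add_cancel)
qed

text \<open>The corner at \<open>p\<close> of the algebra generated by the family. In particular, \<open>corner 1\<close> is the whole algebra,
  in general without the unit of the ring.\<close>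

definition corner :: "'a \<Rightarrow> 'a set" where "corner p = {x. \<exists>a b. x \<in> window p a b}"

lemma cornerI: "x \<in> window p a b \<Longrightarrow> x \<in> corner p" by (auto simp: corner_def)

lemma window_sum: "(\<And>k. k \<in> K \<Longrightarrow> f k \<in> window p a b) \<Longrightarrow> sum f K \<in> window p a b"
  by (induction K rule: infinite_finite_induct) (auto intro: window_add window_zero)

lemma chomog_mult_window:
  assumes "z \<in> chomog p n" "x \<in> window p a b"
  shows "z * x \<in> window p (a + n) (b + n)"
  by (rule window_map[OF assms(2), of "\<lambda>x. z * x"]) (auto intro: chomog_mult[OF assms(1)] simp: distrib_left)

lemma corner_add: assumes "x \<in> corner p" "y \<in> corner p" shows "x + y \<in> corner p"
proof -
  obtain a b c d where "x \<in> window p a b" "y \<in> window p c d" using assms by (auto simp: corner_def)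
  then have "x \<in> window p (min a c) (max b d)" "y \<in> window p (min a c) (max b d)" by (auto intro: window_mono)
  then show ?thesis by (intro cornerI window_add)
qed

lemma corner_mult: assumes "x \<in> corner p" "y \<in> corner p" shows "x * y \<in> corner p"
proof -
  obtain a b c d where x: "x \<in> window p a b" and y: "y \<in> window p c d" using assms by (auto simp: corner_def)
  obtain h where h: "\<And>j. h j \<in> chomog p j" "x = (\<Sum>j\<in>{a..b}. h j)" using x by (rule windowE) (rule that)
  have "(\<Sum>j\<in>{a..b}. h j * y) \<in> window p (a + c) (b + d)"
  proof (rule window_sum)
    fix j assume "j \<in> {a..b}"
    then show "h j * y \<in> window p (a + c) (b + d)" using chomog_mult_window[OF h(1) y, of j] by (auto intro: window_mono)
  qed
  then show ?thesis using h(2) by (auto simp: sum_distrib_right intro: cornerI)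
qed

lemma corner_absorb: "x \<in> corner p \<Longrightarrow> p * x = x" "x \<in> corner p \<Longrightarrow> x * p = x"
proof -
  assume "x \<in> corner p"
  then obtain a b where "x \<in> window p a b" by (auto simp: corner_def)
  then obtain h where h: "\<And>j. h j \<in> chomog p j" "x = (\<Sum>j\<in>{a..b}. h j)" by (rule windowE) (rule that)
  show "p * x = x" "x * p = x"
    using chomogD(2,3)[OF h(1)] by (simp_all add: h(2) sum_distrib_left sum_distrib_right)
qed

lemma compress_in_corner:
  assumes "p \<in> homog 0" "p * p = p" "x \<in> corner 1"
  shows "p * x * p \<in> corner p"
proof -
  obtain a b where "x \<in> window 1 a b" using assms by (auto simp: corner_def)
  then have "p * x * p \<in> window p (a + 0) (b + 0)"
  proof (rule window_map)
    fix j y assume "y \<in> chomog 1 j"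
    then have "p * y * p \<in> homog (j + 0)" using assms(1)
      by (intro homog_mult[of "p * y" j p 0] homog_mult[of p 0 y j]) (auto simp: chomog_one)
    then show "p * y * p \<in> chomog p (j + 0)"
      using assms(2) by (intro chomogI) (simp_all add: mult.assoc[symmetric], simp add: mult.assoc)
  qed (simp_all add: algebra_simps)
  then show ?thesis by (rule cornerI)
qed

lemma corner_sub: "corner p \<subseteq> corner 1"
  using window_sub by (fastforce simp: corner_def)

lemma chomog_corner: "x \<in> chomog p n \<Longrightarrow> x \<in> corner p"
  by (rule cornerI[OF chomog_window[of x p n n n]]) auto

lemma commute_corner:
  assumes "x \<in> corner p" "\<And>n y. y \<in> chomog p n \<Longrightarrow> z * y = y * z"
  shows "z * x = x * z"
proof -
  obtain a b where "x \<in> window p a b" using assms(1) by (auto simp: corner_def)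
  then obtain h where h: "\<And>j. h j \<in> chomog p j" "x = (\<Sum>j\<in>{a..b}. h j)" by (rule windowE) (rule that)
  show ?thesis
    using assms(2)[OF h(1)] by (simp add: h(2) sum_distrib_left sum_distrib_right)
qed

lemma local_units:
  assumes "x \<in> corner 1" shows "\<exists>U\<in>GV. P U * x = x" "\<exists>U\<in>GV. x * P U = x"
proof -
  obtain a b where "x \<in> window 1 a b" using assms by (auto simp: corner_def)
  then obtain h where h: "\<And>j. h j \<in> homog j" "x = (\<Sum>j\<in>{a..b}. h j)" unfolding window_def chomog_one by blast
  have h': "\<exists>U\<in>GV. P U * h j = h j" "\<exists>U\<in>GV. h j * P U = h j" for j
    using h(1)[of j] local_unit_left local_unit_right unfolding homog_def by blast+
  have "(\<exists>U\<in>GV. P U * (\<Sum>j\<in>N. h j) = (\<Sum>j\<in>N. h j)) \<and> (\<exists>U\<in>GV. (\<Sum>j\<in>N. h j) * P U = (\<Sum>j\<in>N. h j))"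
    if "finite N" for N
    using that
  proof (induction N rule: finite_induct)
    case (insert i N)
    then show ?case using h'[of i] local_unit_left_add local_unit_right_add by simp
  qed (auto intro: gv_empty)
  from this[of "{a..b}"] show "\<exists>U\<in>GV. P U * x = x" "\<exists>U\<in>GV. x * P U = x" using h(2) by auto
qed

text \<open>A linear dependency between homogeneous elements that spreads over \<open>v + 1\<close> consecutive degrees and
  has a nonzero term in the highest of them.\<close>

definition dependent :: "nat \<Rightarrow> bool" where
  "dependent v \<longleftrightarrow> (\<exists>b. \<exists>d\<in>homog b. d \<noteq> 0 \<and> d \<in> window 1 (b - int v) (b - 1))"

lemma not_dependent_0: "\<not> dependent 0"
  using window_empty[of "b - 1" b 1 for b] by (auto simp: dependent_def)

text \<open>A nontrivial relation between homogeneous elements can be solved for its top term.\<close>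

lemma dependent_exists:
  assumes "finite N" "\<And>n. n \<in> N \<Longrightarrow> y n \<in> homog n" "(\<Sum>n\<in>N. y n) = 0" "m \<in> N" "y m \<noteq> 0"
  shows "\<exists>v. dependent v"
proof -
  define M where "M = {n \<in> N. y n \<noteq> 0}"
  have M: "finite M" "m \<in> M" using assms by (auto simp: M_def)
  have sM: "(\<Sum>n\<in>M. y n) = 0"
    using assms(3) unfolding M_def
    by (subst sum.mono_neutral_left[of N "{n \<in> N. y n \<noteq> 0}"]) (use assms(1) in auto)
  define b where "b = Max M"
  define a where "a = Min M"
  have b: "b \<in> M" using M unfolding b_def by (intro Max_in) auto
  have ab: "a \<le> n \<and> n \<le> b" if "n \<in> M" for n using M that by (auto simp: a_def b_def)
  have "y b = - (\<Sum>n\<in>M - {b}. y n)"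
    using sM sum.remove[OF M(1) b, of y] by (simp add: eq_neg_iff_add_eq_0)
  also have "\<dots> \<in> window 1 a (b - 1)"
  proof (intro window_uminus window_sum)
    fix i assume i: "i \<in> M - {b}"
    then show "y i \<in> window 1 a (b - 1)" using assms(2) ab[of i] ab[OF b]
      by (intro chomog_window[of _ _ i]) (auto simp: chomog_one M_def)
  qed
  finally have "y b \<in> window 1 (b - int (nat (b - a))) (b - 1)" using ab[OF b] by simp
  moreover have "y b \<in> homog b" "y b \<noteq> 0" using b assms(2) by (auto simp: M_def)
  ultimately have "dependent (nat (b - a))" unfolding dependent_def by blast
  then show ?thesis by blast
qed

end

text \<open>The number \<open>w\<close> is the least width of a dependency between homogeneous elements.\<close>

locale leavitt_dependent = leavitt_family G kap P S T
  for G :: "('v, 'e) ugraph" and kap :: "'k::field \<Rightarrow> 'a::ring_1" and P S T +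
  fixes w :: nat
  assumes dependent_w: "dependent w" and w_minimal: "v < w \<Longrightarrow> \<not> dependent v"
begin

lemma w_pos: "1 \<le> w"
  using dependent_w not_dependent_0 by (cases w) auto

lemma min_zero:
  assumes "d \<in> homog b" "d \<in> window p (b - int v) (b - 1)" "v < w"
  shows "d = 0"
proof (rule ccontr)
  assume "d \<noteq> 0"
  moreover have "d \<in> window 1 (b - int v) (b - 1)" using assms(2) window_sub by blast
  ultimately have "dependent v" unfolding dependent_def using assms(1) by blast
  then show False using w_minimal assms(3) by blast
qed

text \<open>Homogeneous elements in at most \<open>w\<close> consecutive degrees are independent.\<close>

lemma window_indep:
  assumes "\<And>j. h j \<in> homog j" "(\<Sum>j\<in>{b - int v..b}. h j) = 0" "v < w" "j \<in> {b - int v..b}"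
  shows "h j = 0"
  using assms
proof (induction v arbitrary: b)
  case 0
  then show ?case by simp
next
  case (Suc v)
  have "{b - int (Suc v)..b} = insert b {b - 1 - int v..b - 1}" by auto
  then have s: "h b + (\<Sum>j\<in>{b - 1 - int v..b - 1}. h j) = 0" using Suc.prems(2) by simp
  then have "h b = - (\<Sum>j\<in>{b - int (Suc v)..b - 1}. h j)"
    by (simp add: eq_neg_iff_add_eq_0 algebra_simps)
  also have "\<dots> \<in> window 1 (b - int (Suc v)) (b - 1)"
    using Suc.prems(1) by (intro window_uminus windowI) (simp add: chomog_one)
  finally have "h b = 0" using min_zero[OF Suc.prems(1), of b 1 "Suc v"] Suc.prems(3) by blast
  then show ?case using Suc.IH[of "b - 1"] Suc.prems s
    by (cases "j = b") auto
qed

text \<open>A nonzero homogeneous idempotent \<open>p\<close> of degree zero whose corner has a central unit \<open>v\<close> of degree \<open>w\<close>, and in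
  whose corner \<open>p\<close> is a sum of terms of the degrees \<open>-w, \<dots>, -1\<close>.\<close>

definition good :: "'a \<Rightarrow> 'a \<Rightarrow> bool" where
  "good p v \<longleftrightarrow> p \<in> homog 0 \<and> p \<noteq> 0 \<and> p * p = p \<and> p \<in> window p (- int w) (- 1) \<and> v \<in> chomog p (int w) \<and>
     (\<forall>n. \<forall>y\<in>chomog p n. v * y = y * v) \<and> (\<exists>u\<in>chomog p (- int w). u * v = p \<and> v * u = p)"

lemma goodD:
  assumes "good p v"
  shows "p \<in> homog 0" "p \<noteq> 0" "p * p = p" "p \<in> window p (- int w) (- 1)" "v \<in> chomog p (int w)"
    "\<And>n y. y \<in> chomog p n \<Longrightarrow> v * y = y * v" "\<exists>u\<in>chomog p (- int w). u * v = p \<and> v * u = p"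
    "v \<noteq> 0"
  using assms unfolding good_def by auto

text \<open>Reduce the top term of a shortest dependency to an idempotent \<open>q\<close>. The commutator of the resulting
  equation with a homogeneous element of the corner at \<open>q\<close> is a shorter dependency, so all terms are
  central. The bottom term \<open>u\<close> is nonzero, again by minimality. If \<open>A u B = q'\<close> is a reduction of
  \<open>u\<close>, then \<open>A B\<close> is a central unit of the corner at \<open>q'\<close>, with inverse \<open>A u u B\<close>.\<close>

lemma good_exists:
  shows "\<exists>p v. gap_idem p \<and> good p v"
proof -
  obtain b d where d: "d \<in> homog b" "d \<noteq> 0" "d \<in> window 1 (b - int w) (b - 1)"
    using dependent_w unfolding dependent_def by blast
  obtain a c q k l where ac: "a \<in> homog k" "c \<in> homog l" "k + b + l = 0" "gap_idem q" "q \<noteq> 0" "a * d * c = q"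
    "q * a = a" "c * q = c" using reduction[OF d(1,2)] .
  note q = gap_idem_facts[OF ac(4)]
  have "(\<lambda>y. a * y * c) d \<in> window q (b - int w + (k + l)) (b - 1 + (k + l))"
  proof (rule window_map[OF d(3)])
    fix j y assume "y \<in> chomog 1 j"
    then have "a * y * c \<in> homog (j + (k + l))"
      using ac by (intro homog_mult[of "a * y" "k + j"] homog_mult[of a k]) (auto simp: chomog_one)
    then show "a * y * c \<in> chomog q (j + (k + l))"
      using ac by (intro chomogI) (simp_all add: mult.assoc[symmetric], simp add: mult.assoc)
  qed (simp_all add: algebra_simps)
  moreover have "b - int w + (k + l) = - int w" "b - 1 + (k + l) = - 1" using ac(3) by auto
  ultimately have qW: "q \<in> window q (- int w) (- 1)" using ac(6) by simp
  then obtain h where h: "\<And>j. h j \<in> chomog q j" "q = (\<Sum>j\<in>{- int w..- 1}. h j)" by (rule windowE) (rule that)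
  have comm: "z * h j = h j * z" if z: "z \<in> chomog q n" and j: "j \<in> {- int w..- 1}" for z n j
  proof -
    \<comment> \<open>the commutator with \<open>q\<close>, sorted by degrees\<close>
    define g where "g i = z * h (i - n) - h (i - n) * z" for i
    have g: "g i \<in> homog i" for i unfolding g_def
      using chomogD(1)[OF z] chomogD(1)[OF h(1)] by (intro homog_diff homog_mult[of z n] homog_mult[of "h (i - n)" "i - n"]) auto
    have "(\<Sum>i\<in>{n - 1 - int (w - 1)..n - 1}. g i) = (\<Sum>j\<in>{- int w..- 1}. z * h j - h j * z)"
      by (rule sum.reindex_bij_witness[of _ "\<lambda>i. i + n" "\<lambda>i. i - n"]) (use w_pos in \<open>auto simp: g_def\<close>)
    also have "\<dots> = z * q - q * z"
      unfolding sum_subtractf sum_distrib_left[symmetric] sum_distrib_right[symmetric] h(2)[symmetric] ..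
    also have "\<dots> = 0" using chomogD[OF z] by simp
    finally have "g (j + n) = 0"
      by (rule window_indep[OF g]) (use w_pos j in auto)
    then show ?thesis by (simp add: g_def)
  qed
  define u where "u = h (- int w)"
  have u_chomog: "u \<in> chomog q (- int w)" using h(1) by (simp add: u_def)
  have ucomm: "z * u = u * z" if "z \<in> chomog q n" for z n
    unfolding u_def using comm[OF that, of "- int w"] w_pos by auto
  \<comment> \<open>otherwise \<open>q\<close> would lie in a window that is too short\<close>
  have u0: "u \<noteq> 0"
  proof
    assume "u = 0"
    moreover have "{- int w..- 1} = insert (- int w) {0 - int (w - 1)..0 - 1}" using w_pos by auto
    ultimately have "q = (\<Sum>j\<in>{0 - int (w - 1)..0 - 1}. h j)"
      using h(2) w_pos by (simp add: u_def)
    then have "q \<in> window q (0 - int (w - 1)) (0 - 1)" using windowI[of h q] h(1) by metis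
    then have "q = 0" by (rule min_zero[OF q(1)]) (use w_pos in auto)
    then show False using ac by simp
  qed
  obtain a' c' q' k' l' where ac': "a' \<in> homog k'" "c' \<in> homog l'" "k' + - int w + l' = 0" "gap_idem q'" "q' \<noteq> 0"
    "a' * u * c' = q'" "q' * a' = a'" "c' * q' = c'" using reduction[OF chomogD(1)[OF u_chomog] u0] .
  note q' = gap_idem_facts[OF ac'(4)]
  \<comment> \<open>replace both factors by their products with \<open>q\<close>; as \<open>u = q u q\<close>, the value stays the same\<close>
  define A where "A = a' * q"
  define B where "B = q * c'"
  have A: "A \<in> homog k'" "q' * A = A" "A * q = A"
    using ac' q(1,2) by (auto simp: A_def mult.assoc intro: homog_mult) (simp add: mult.assoc[symmetric])
  have B: "B \<in> homog l'" "B * q' = B" "q * B = B"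
    using ac' q(1,2) by (auto simp: B_def mult.assoc intro: homog_mult) (simp add: mult.assoc[symmetric])
  have uq: "q * u = u" "u * q = u" using chomogD[OF u_chomog] by auto
  have "A * u * B = a' * (q * u * q) * c'" by (simp add: A_def B_def mult.assoc)
  then have AuB: "A * u * B = q'" using uq ac'(6) by simp
  have AB: "A * B \<in> chomog q' (int w)"
    using A B ac'(3) by (intro chomogI homog_mult[of A k' B l']) (simp_all add: mult.assoc[symmetric], simp add: mult.assoc)
  have Auu: "A * u * u * B \<in> chomog q' (- int w)"
  proof (rule chomogI)
    show "A * u * u * B \<in> homog (- int w)"
      using A B ac'(3) chomogD(1)[OF u_chomog] by (intro homog_mult[of "A * u * u" "k' - int w - int w" B l']
        homog_mult[of "A * u" "k' - int w" u "- int w"] homog_mult[of A k' u "- int w"]) auto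
  qed (use A B in \<open>simp_all add: mult.assoc[symmetric]\<close>, simp add: B mult.assoc)
  have BAC: "B * (y * A) \<in> chomog q (n + int w)" if "y \<in> chomog q' n" for y n
    using A B ac'(3) chomogD[OF that]
    by (intro chomogI homog_mult[of B l' "y * A" "n + k'"] homog_mult[of y n A k']) (simp_all add: mult.assoc[symmetric], simp add: mult.assoc)
  have BA: "B * A \<in> chomog q (int w)"
    using A B ac'(3)
    by (intro chomogI homog_mult[of B l' A k']) (simp_all add: mult.assoc[symmetric], simp add: mult.assoc)
  have ucomm': "u * (z * x) = z * (u * x)" if "z \<in> chomog q n" for z n x
    using ucomm[OF that] by (simp add: mult.assoc[symmetric])
  have uBA: "u * (B * (A * x)) = B * (A * (u * x))" for x using ucomm'[OF BA] by (simp add: mult.assoc)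
  have AuB': "A * (u * (B * x)) = q' * x" for x using AuB by (simp add: mult.assoc[symmetric])
  have q'B: "x * A * (u * B) = x * q'" for x using AuB by (simp add: mult.assoc)
  have inv1: "(A * u * u * B) * (A * B) = q'"
  proof -
    have "(A * u * u * B) * (A * B) = A * (u * (u * ((B * A) * B)))" by (simp add: mult.assoc)
    also have "\<dots> = A * (u * (B * (A * (u * B))))" by (simp only: uBA[of B] mult.assoc)
    also have "\<dots> = q'" using AuB q'(2) by (simp add: AuB') (simp add: mult.assoc)
    finally show ?thesis .
  qed
  have inv2: "(A * B) * (A * u * u * B) = q'"
  proof -
    have "(A * B) * (A * u * u * B) = A * ((B * A) * (u * (u * B)))" by (simp add: mult.assoc)
    also have "\<dots> = A * (u * (B * (A * (u * B))))"
      by (simp only: uBA[of "u * B"] mult.assoc)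
    also have "\<dots> = q'" using AuB q'(2) by (simp add: AuB') (simp add: mult.assoc)
    finally show ?thesis .
  qed
  have u'comm: "(A * u * u * B) * y = y * (A * u * u * B)" if y: "y \<in> chomog q' n" for y n
  proof -
    have "(A * u * u * B) * y = A * u * (u * B * (y * q'))" using chomogD[OF y] by (simp add: mult.assoc)
    also have "\<dots> = A * (u * (u * ((B * (y * A)) * (u * B))))" by (simp add: AuB[symmetric] mult.assoc)
    also have "\<dots> = A * (u * (B * (y * A) * (u * (u * B))))" by (simp add: ucomm'[OF BAC[OF y]])
    also have "\<dots> = (q' * y) * (A * (u * (u * B)))" by (simp add: AuB' mult.assoc)
    also have "\<dots> = y * (A * u * u * B)" using chomogD[OF y] by (simp add: mult.assoc)
    finally show ?thesis .
  qed
  have v'comm: "(A * B) * y = y * (A * B)" if y: "y \<in> chomog q' n" for y n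
  proof -
    have "(A * B) * y = (A * B) * (y * q')" using chomogD[OF y] by simp
    also have "\<dots> = (A * B) * (y * (A * u * u * B)) * (A * B)" by (simp only: inv1[symmetric] mult.assoc)
    also have "\<dots> = (A * B) * ((A * u * u * B) * y) * (A * B)" by (simp only: u'comm[OF y])
    also have "\<dots> = ((A * B) * (A * u * u * B)) * y * (A * B)" by (simp only: mult.assoc)
    also have "\<dots> = y * (A * B)" unfolding inv2 using chomogD[OF y] by simp
    finally show ?thesis .
  qed
  have "(\<lambda>y. A * y * (u * B)) q \<in> window q' (- int w + 0) (- 1 + 0)"
  proof (rule window_map[OF qW])
    fix j y assume y: "y \<in> chomog q j"
    show "A * y * (u * B) \<in> chomog q' (j + 0)"
    proof (rule chomogI)
      show "A * y * (u * B) \<in> homog (j + 0)"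
        using A B ac'(3) chomogD(1)[OF u_chomog] chomogD(1)[OF y] by (intro homog_mult[of "A * y" "k' + j" "u * B" "l' - int w"]
          homog_mult[of A k' y j] homog_mult[of u "- int w" B l']) auto
    qed (use A B in \<open>simp_all add: mult.assoc[symmetric]\<close>, simp add: B mult.assoc)
  qed (simp_all add: algebra_simps)
  moreover have "A * q * (u * B) = q'" using AuB A by (simp add: mult.assoc)
  ultimately have "q' \<in> window q' (- int w) (- 1)" by simp
  then have "good q' (A * B)"
    unfolding good_def using q'(1,2) ac'(5) AB Auu inv1 inv2 v'comm by blast
  then show ?thesis using ac'(4) by blast
qed

text \<open>If \<open>p' = a b\<close> with \<open>a = p' a p\<close> and \<open>b = p b p'\<close>, then \<open>b a\<close> lies in the corner at \<open>p\<close>, hence commutes with \<open>v\<close>.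
  This makes \<open>y \<mapsto> a y b\<close> carry the required data from the corner at \<open>p\<close> to the corner at \<open>p'\<close>.\<close>

lemma good_transfer:
  assumes "good p v" and a: "a \<in> homog k" "a * p = a" "p' * a = a"
    and b: "b \<in> homog (- k)" "p * b = b" "b * p' = b" and ab: "a * b = p'" "p' \<noteq> 0"
  shows "good p' (a * v * b)"
proof -
  note g = goodD[OF assms(1)]
  obtain u where u: "u \<in> chomog p (- int w)" "u * v = p" "v * u = p" using g(7) by blast
  have CC: "a * y * b \<in> chomog p' n" if "y \<in> chomog p n" for y n
  proof (rule chomogI)
    show "a * y * b \<in> homog n"
      using a b chomogD(1)[OF that] by (intro homog_mult[of "a * y" "k + n" b "- k"] homog_mult[of a k y n]) auto
  qed (use a b in \<open>simp_all add: mult.assoc[symmetric]\<close>, simp add: b mult.assoc)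
  have BAC: "b * y * a \<in> chomog p n" if "y \<in> chomog p' n" for y n
  proof (rule chomogI)
    show "b * y * a \<in> homog n"
      using a b chomogD(1)[OF that] by (intro homog_mult[of "b * y" "n - k" a k] homog_mult[of b "- k" y n]) auto
  qed (use a b in \<open>simp_all add: mult.assoc[symmetric]\<close>, simp add: a mult.assoc)
  have p': "p' \<in> homog 0" using homog_mult[OF a(1) b(1), of 0] ab by simp
  have pp': "p' * p' = p'" using a b ab by (metis mult.assoc)
  have ba: "b * a \<in> chomog p 0" using BAC[of p' 0] p' pp' a b by (simp add: chomogI)
  have "(\<lambda>y. a * y * b) p \<in> window p' (- int w + 0) (- 1 + 0)"
    by (rule window_map[OF g(4)]) (use CC in \<open>simp_all add: algebra_simps\<close>)
  then have window: "p' \<in> window p' (- int w) (- 1)" using a ab by simp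
  have vba: "v * (b * (a * x)) = b * (a * (v * x))" for x
    using g(6)[OF ba] by (metis mult.assoc)
  have 1: "(a * v * b) * (a * u * b) = p'"
  proof -
    have "(a * v * b) * (a * u * b) = a * (v * (b * (a * (u * b))))" by (simp add: mult.assoc)
    also have "\<dots> = a * (b * (a * ((v * u) * b)))" unfolding vba by (simp add: mult.assoc)
    also have "\<dots> = (a * b) * (a * b)" using u b by (simp add: mult.assoc)
    finally show ?thesis using ab pp' by simp
  qed
  have 2: "(a * u * b) * (a * v * b) = p'"
  proof -
    have "(a * u * b) * (a * v * b) = a * (u * (b * (a * (v * b))))" by (simp add: mult.assoc)
    also have "\<dots> = a * ((u * v) * (b * (a * b)))" unfolding vba[symmetric] by (simp add: mult.assoc)
    also have "\<dots> = ((a * p) * b) * (a * b)" using u by (simp add: mult.assoc)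
    finally show ?thesis using ab a pp' by simp
  qed
  have 3: "(a * v * b) * y = y * (a * v * b)" if y: "y \<in> chomog p' n" for y n
  proof -
    have "(a * v * b) * y = a * v * b * (y * (a * b))" using chomogD[OF y] ab by simp
    also have "\<dots> = a * (v * (b * y * a)) * b" by (simp add: mult.assoc)
    also have "\<dots> = (a * b) * y * a * v * b" unfolding g(6)[OF BAC[OF y]] by (simp add: mult.assoc)
    also have "\<dots> = y * (a * v * b)" using chomogD[OF y] ab by (simp add: mult.assoc)
    finally show ?thesis .
  qed
  show ?thesis unfolding good_def
    using p' ab(2) pp' window CC[OF g(5)] 1 2 3 CC[OF u(1)] by blast
qed

text \<open>Since \<open>v\<close> is a unit of positive degree, some edge \<open>e\<close> satisfies \<open>p S e \<noteq> 0\<close>; for a gap idempotent this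
  means \<open>p S e = S e\<close>, and the data move to the projection of the range of \<open>e\<close>.\<close>

lemma good_edge:
  assumes "good p v" "gap_idem p"
  obtains e where "e \<in> E" "good (P (rge G e)) (T e * v * S e)"
proof -
  note g = goodD[OF assms(1)]
  obtain F where F: "finite F" "F \<subseteq> E" "v = (\<Sum>e\<in>F. S e * (T e * v))"
    using first_edges[OF chomogD(1)[OF g(5)]] w_pos by auto
  have "\<exists>e\<in>F. p * S e \<noteq> 0"
  proof (rule ccontr)
    assume "\<not> ?thesis"
    then have "(\<Sum>e\<in>F. p * (S e * (T e * v))) = 0" by (intro sum.neutral) (auto simp: mult.assoc[symmetric])
    then have "p * v = 0" using F(3) by (simp add: sum_distrib_left[symmetric])
    then show False using chomogD[OF g(5)] g(8) by simp
  qed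
  then obtain e where e: "e \<in> E" "p * S e \<noteq> 0" using F by blast
  have pe: "p * S e = S e" "T e * p = T e" using gap_idem_facts(3)[OF assms(2) e(1)] e(2) by auto
  have "P (rge G e) \<noteq> 0" using e S_P_rge[OF e(1)] by auto
  then have "good (P (rge G e)) (T e * v * S e)"
    using e pe by (intro good_transfer[OF assms(1), of _ "- 1"])
      (auto simp: T_homog S_homog P_rge_T S_P_rge T_S)
  then show thesis using that e by blast
qed

text \<open>Each step along an edge shortens the ghost part of the central unit, unless it is empty.\<close>

lemma good_ghost_free:
  assumes "good p v" "gap_idem p" "v \<in> homog_le (int w) m"
  shows "\<exists>A v. A \<in> GV \<and> good (P A) v \<and> v \<in> homog_le (int w) 0"
  using assms
proof (induction m arbitrary: p v)
  case 0
  obtain e where e: "e \<in> E" "good (P (rge G e)) (T e * v * S e)" using good_edge[OF 0(1,2)] .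
  have "T e * v \<in> homog_le (int w - 1) 0" using homog_le_T_left[OF 0(3) e(1)] w_pos by simp
  then have "T e * v * S e \<in> homog_le (int w) 0" using homog_le_S_right[OF _ e(1)] by fastforce
  then show ?case using e gv_range[OF e(1)] by blast
next
  case (Suc m)
  obtain e where e: "e \<in> E" "good (P (rge G e)) (T e * v * S e)" using good_edge[OF Suc.prems(1,2)] .
  have "T e * v \<in> homog_le (int w - 1) (Suc m)" using homog_le_T_left[OF Suc.prems(3) e(1)] w_pos by simp
  then have "T e * v * S e \<in> homog_le (int w) m" using homog_le_S_right[OF _ e(1)] by fastforce
  then show ?case using Suc.IH[OF e(2) gap_idem_P[OF gv_range[OF e(1)]]] by blast
qed

lemma good_scale:
  assumes "good p v" "c \<noteq> 0"
  shows "good p (kap c * v)"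
proof -
  note g = goodD[OF assms(1)]
  have K: "kap d * y \<in> chomog p n" if "y \<in> chomog p n" for d y n
  proof -
    have "p * (kap d * y) = (p * kap d) * y" by (simp add: mult.assoc)
    then have "p * (kap d * y) = kap d * y" using chomogD[OF that] homog_kap_right[OF g(1)] by (simp add: mult.assoc)
    then show ?thesis using chomogD[OF that] by (intro chomogI) (auto intro: homog_kap simp: mult.assoc)
  qed
  obtain u where u: "u \<in> chomog p (- int w)" "u * v = p" "v * u = p" using g(7) by blast
  let ?u = "kap (inverse c) * u"
  have "?u * (kap c * v) = kap (inverse c) * (u * kap c) * v" by (simp add: mult.assoc)
  also have "\<dots> = kap (inverse c) * kap c * (u * v)"
    by (simp add: homog_kap_right[OF chomogD(1)[OF u(1)]] mult.assoc)
  also have "\<dots> = p" using u assms by (simp add: kap_inv)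
  finally have 1: "?u * (kap c * v) = p" .
  have "kap c * v * ?u = kap c * (v * kap (inverse c)) * u" by (simp add: mult.assoc)
  also have "\<dots> = kap (inverse c) * kap c * (v * u)"
    by (simp add: homog_kap_right[OF chomogD(1)[OF g(5)]] mult.assoc) (simp add: mult.assoc[symmetric] kap_comm)
  also have "\<dots> = p" using u assms by (simp add: kap_inv)
  finally have 2: "kap c * v * ?u = p" .
  have 3: "kap c * v * y = y * (kap c * v)" if y: "y \<in> chomog p n" for y n
  proof -
    have "y * (kap c * v) = (y * kap c) * v" by (simp add: mult.assoc)
    also have "\<dots> = kap c * v * y" using homog_kap_right[OF chomogD(1)[OF y]] g(6)[OF y] by (simp add: mult.assoc)
    finally show ?thesis by simp
  qed
  show ?thesis unfolding good_def using g(1-4) K[OF g(5)] K[OF u(1)] 1 2 3 by blast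
qed

text \<open>Take a path \<open>\<alpha>\<close> of length \<open>w\<close> leaving \<open>A\<close>. As \<open>v\<close> is ghost-free of degree \<open>w\<close>, the product of \<open>v\<close> with
  the ghost of \<open>\<alpha>\<close> has degree zero and acts on the path \<open>\<alpha>\<close> as a scalar \<open>c\<close>. So the central unit transported
  along \<open>\<alpha>\<close> is \<open>c\<close> times the path \<open>\<alpha>\<close> itself, which is therefore closed.\<close>

lemma good_cycle:
  obtains \<alpha> where "set \<alpha> \<subseteq> E" "length \<alpha> = w" "good (P (rge G (last \<alpha>))) (spath \<alpha>)"
    "spath \<alpha> * gpath \<alpha> = P (rge G (last \<alpha>))"
proof -
  obtain p v where "gap_idem p" "good p v" using good_exists by blast
  moreover obtain m where "v \<in> homog_le (int w) m" using chomogD(1)[OF goodD(5)[OF \<open>good p v\<close>]] by (auto simp: homog_def)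
  ultimately obtain A v where A: "A \<in> GV" "good (P A) v" "v \<in> homog_le (int w) 0"
    using good_ghost_free by blast
  note g = goodD[OF A(2)]
  have "\<exists>\<alpha>. set \<alpha> \<subseteq> E \<and> length \<alpha> = w \<and> P A * spath \<alpha> \<noteq> 0"
  proof (rule ccontr)
    assume no: "\<not> ?thesis"
    have "P A * y = 0" if "y \<in> homog_le (int w) 0" for y
      using that
    proof (induction rule: homog_le.induct)
      case (homog_le_step x y)
      obtain d \<alpha> B \<beta> where x: "x = kap d * spath \<alpha> * P B * gpath \<beta>" "set \<alpha> \<subseteq> E"
        "int (length \<alpha>) - int (length \<beta>) = int w" "length \<beta> \<le> 0" using homog_le_step(1) by (rule monomialsE)
      have "P A * x = (P A * kap d) * spath \<alpha> * P B * gpath \<beta>" using x by (simp add: mult.assoc)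
      also have "\<dots> = kap d * (P A * spath \<alpha>) * P B * gpath \<beta>" using A by (simp add: kap_P mult.assoc)
      also have "P A * spath \<alpha> = 0" using no x by auto
      finally show ?case using homog_le_step by (simp add: distrib_left)
    qed simp
    then show False using A chomogD(2)[OF g(5)] g(8) by force
  qed
  then obtain \<alpha> where \<alpha>: "set \<alpha> \<subseteq> E" "length \<alpha> = w" "P A * spath \<alpha> \<noteq> 0" by blast
  have ne: "\<alpha> \<noteq> []" using \<alpha> w_pos by auto
  have PA: "P A * spath \<alpha> = spath \<alpha>" "gpath \<alpha> * P A = gpath \<alpha>" using P_spath_gpath[OF A(1) \<alpha>(1) ne] \<alpha>(3) by auto
  have s0: "spath \<alpha> \<noteq> 0" using \<alpha>(3) by auto
  let ?R = "rge G (last \<alpha>)"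
  note s = gpath_spath[OF \<alpha>(1) ne s0] and l = spath_last[OF \<alpha>(1) ne] and spH = spath_gpath_homog[OF \<alpha>(1) ne]
  have R: "?R \<in> GV" using \<alpha>(1) ne by (intro gv_range) auto
  have R0: "P ?R \<noteq> 0" using l s0 by auto
  have gR: "good (P ?R) (gpath \<alpha> * v * spath \<alpha>)"
    using l PA s spH R0 by (intro good_transfer[OF A(2), of _ "- int w"]) (auto simp: \<alpha>(2))
  have "gpath \<alpha> * v \<in> homog_le (int w - int (length \<alpha>)) 0"
    using \<alpha> by (intro homog_le_gpath_left[OF A(3)]) auto
  then have "gpath \<alpha> * v \<in> homog_le 0 0" using \<alpha>(2) by simp
  from vertex_mult_spath[OF this \<alpha>(1) ne] obtain c where c: "gpath \<alpha> * v * spath \<alpha> = kap c * spath \<alpha>" by blast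
  have c0: "c \<noteq> 0" using goodD(8)[OF gR] c kap_zero by auto
  have "spath \<alpha> = kap (inverse c) * (gpath \<alpha> * v * spath \<alpha>)"
    using c kap_inv[OF c0] by (simp add: mult.assoc[symmetric])
  then have gs: "good (P ?R) (spath \<alpha>)" using good_scale[OF gR, of "inverse c"] c0 by simp
  note g' = goodD[OF gs]
  obtain u where u: "u \<in> chomog (P ?R) (- int w)" "spath \<alpha> * u = P ?R" using g'(7) by blast
  have "gpath \<alpha> * P ?R = gpath \<alpha>"
    using P_spath_gpath[OF R \<alpha>(1) ne] chomogD(2)[OF g'(5)] s0 by auto
  then have "u = gpath \<alpha>" using u(2) s chomogD(2)[OF u(1)] by (metis mult.assoc)
  then show thesis using that \<alpha> gs u by blast
qed

end

section \<open>The corner at the closed path is a field\<close>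

context leavitt_dependent begin

text \<open>The closed path \<open>\<alpha>\<close> and the corner at \<open>p\<close> of its range, as provided by \<open>good_cycle\<close>, with the central unit
  \<open>t\<close> and its inverse \<open>u\<close>.\<close>

context
  fixes \<alpha> p t u
  assumes \<alpha>: "set \<alpha> \<subseteq> E" "length \<alpha> = w" and p_def: "p = P (rge G (last \<alpha>))"
    and t_def: "t = spath \<alpha>" and u_def: "u = gpath \<alpha>"
    and good: "good p t" and tu: "t * u = p"
begin

lemma alpha_ne: "\<alpha> \<noteq> []" using \<alpha> w_pos by auto

lemmas good_facts = goodD[OF good]

lemma p_idem: "p * p = p" by (rule good_facts)

lemma ut: "u * t = p"
  using gpath_spath[OF \<alpha>(1) alpha_ne] good_facts(8) by (simp add: u_def t_def p_def)

lemma pt: "p * t = t" "t * p = t" using chomogD[OF good_facts(5)] by auto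

lemma pu: "p * u = u" "u * p = u"
  using spath_last(2)[OF \<alpha>(1) alpha_ne] ut tu pt by (auto simp: p_def u_def) (metis mult.assoc)

lemma u_chomog: "u \<in> chomog p (- int w)"
  using pu spath_gpath_homog(2)[OF \<alpha>(1) alpha_ne] \<alpha>(2) by (intro chomogI) (auto simp: u_def)

lemma pow_inv': "1 \<le> k \<Longrightarrow> t ^ k * u ^ k = p \<and> u ^ k * t ^ k = p"
proof (induction k)
  case (Suc k)
  show ?case
  proof (cases "k = 0")
    case False
    have "t ^ Suc k * u ^ Suc k = t * (t ^ k * u ^ k) * u" "u ^ Suc k * t ^ Suc k = u * (u ^ k * t ^ k) * t"
      by (simp_all add: mult.assoc power_commutes)
    then show ?thesis using Suc False pt pu tu ut by simp
  qed (simp add: tu ut)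
qed simp

lemmas pow_inv = conjunct1[OF pow_inv'] conjunct2[OF pow_inv']

lemma pow_chomog: "1 \<le> k \<Longrightarrow> t ^ k \<in> chomog p (int (k * w))"
proof (induction k)
  case (Suc k)
  then show ?case using good_facts(5)
    by (cases "k = 0") (auto intro!: chomog_mult[OF good_facts(5) Suc.IH] simp: algebra_simps)
qed simp

lemma t_comm: "y \<in> chomog p n \<Longrightarrow> t ^ k * y = y * t ^ k"
  using good_facts(6)[of y n] by (simp add: power_commuting_commutes)

text \<open>The initial segment of length \<open>N\<close> of the infinite word \<open>\<alpha>\<alpha>\<alpha>\<dots>\<close>.\<close>

definition cyc_word :: "nat \<Rightarrow> 'e list" where
  "cyc_word N = take N (concat (replicate N \<alpha>))"

lemma set_rep: "set (concat (replicate N \<alpha>)) \<subseteq> E"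
  using \<alpha>(1) by auto

lemma length_rep: "length (concat (replicate N \<alpha>)) = N * w"
  by (induction N) (auto simp: \<alpha>(2))

lemma rep_pow: "spath (concat (replicate N \<alpha>)) = t ^ N" "gpath (concat (replicate N \<alpha>)) = u ^ N"
  by (induction N) (auto simp: t_def u_def power_commutes)

lemma set_cyc_word: "set (cyc_word N) \<subseteq> E"
  using set_rep[of N] set_take_subset unfolding cyc_word_def by fast

lemma length_cyc_word: "length (cyc_word N) = N"
  using w_pos by (simp add: cyc_word_def length_rep)

text \<open>Since \<open>p = t\<^sup>N u\<^sup>N\<close>, a path that is not killed by \<open>p\<close> must follow \<open>\<alpha>\<alpha>\<alpha>\<dots>\<close>.\<close>

lemma corner_word:
  assumes "set \<gamma> \<subseteq> E" "\<gamma> \<noteq> []" "p * spath \<gamma> \<noteq> 0"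
  shows "\<gamma> = cyc_word (length \<gamma>)"
proof -
  let ?N = "length \<gamma>"
  have N: "1 \<le> ?N" using assms(2) by (cases \<gamma>) auto
  have "p * spath \<gamma> = t ^ ?N * (u ^ ?N * spath \<gamma>)" by (simp only: pow_inv(1)[OF N] mult.assoc[symmetric])
  then have "gpath (concat (replicate ?N \<alpha>)) * spath \<gamma> \<noteq> 0" using assms(3) rep_pow by auto
  moreover have "?N \<le> ?N * w" using w_pos by simp
  ultimately show ?thesis
    using gpath_spath_prefix[OF set_rep assms(1), of ?N] by (simp add: cyc_word_def length_rep)
qed

lemma P_p: "B \<in> GV \<Longrightarrow> P B * p = p \<or> P B * p = 0"
  using P_spath_gpath[OF _ \<alpha>(1) alpha_ne, of B] tu by (auto simp: t_def mult.assoc[symmetric] simp flip: tu)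

lemma p_kap: "p * kap c = kap c * p"
  by (rule homog_kap_right[OF good_facts(1)])

text \<open>The path of length \<open>N\<close> along \<open>\<alpha>\<alpha>\<alpha>\<dots>\<close>, cut down to the corner at \<open>p\<close>. It is zero unless that path can be
  continued by \<open>\<alpha>\<close>.\<close>

definition cyc :: "nat \<Rightarrow> 'a" where "cyc N = p * spath (cyc_word N) * p"

lemma ghost_free_corner:
  assumes "y \<in> homog_le (int N) 0" "1 \<le> N"
  shows "\<exists>c. p * y * p = kap c * cyc N"
  using assms(1)
proof (induction rule: homog_le.induct)
  case homog_le_zero
  then show ?case by (intro exI[of _ 0]) (simp add: kap_zero)
next
  case (homog_le_step x y)
  obtain d \<gamma> B \<beta> where x: "x = kap d * spath \<gamma> * P B * gpath \<beta>" "set \<gamma> \<subseteq> E" "B \<in> GV"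
    "int (length \<gamma>) - int (length \<beta>) = int N" "length \<beta> \<le> 0" using homog_le_step(1) by (rule monomialsE)
  then have "p * x * p = (p * kap d) * spath \<gamma> * (P B * p)" by (simp add: mult.assoc)
  then have px: "p * x * p = kap d * (p * spath \<gamma>) * (P B * p)" by (simp add: p_kap mult.assoc)
  have "\<exists>c. p * x * p = kap c * cyc N"
  proof (cases "P B * p = 0 \<or> p * spath \<gamma> = 0")
    case True
    then show ?thesis using px by (intro exI[of _ 0]) (auto simp: kap_zero)
  next
    case False
    have "\<gamma> \<noteq> []" using x assms(2) by auto
    then have "\<gamma> = cyc_word N" using corner_word[OF x(2)] False x by auto
    moreover have "P B * p = p" using P_p[OF x(3)] False by auto
    ultimately show ?thesis using px by (intro exI[of _ d]) (simp add: cyc_def mult.assoc)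
  qed
  moreover obtain c where "p * y * p = kap c * cyc N" using homog_le_step by blast
  ultimately obtain c' where "p * x * p = kap c' * cyc N" "p * y * p = kap c * cyc N" by blast
  then show ?case by (intro exI[of _ "c' + c"]) (simp add: distrib_left distrib_right kap_add)
qed

text \<open>Multiplication by a high power of the central unit removes all ghost edges, and a ghost-free element
  of the corner is a scalar multiple of some \<open>cyc N\<close>.\<close>

lemma chomog_elem:
  assumes "x \<in> chomog p j"
  obtains k N c where "1 \<le> k" "1 \<le> N" "int N = j + int (k * w)" "x * t ^ k = kap c * cyc N"
proof -
  note x = chomogD[OF assms]
  obtain m where m: "x \<in> homog_le j m" using x by (auto simp: homog_def)
  \<comment> \<open>large enough to cancel all ghost edges and to make the degree positive\<close>
  define k where "k = m + nat \<bar>j\<bar> + 1"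
  have kw: "k \<le> k * w" using w_pos by simp
  have k: "m \<le> k" "1 \<le> j + int k" "1 \<le> k" by (auto simp: k_def)
  have "x * spath (concat (replicate k \<alpha>)) \<in> homog_le (j + int (k * w)) (m - k * w)"
    using homog_le_spath_right[OF m set_rep, of k] by (simp add: length_rep)
  moreover have "m - k * w = 0" using le_trans[OF k(1) kw] by simp
  ultimately have xt: "x * t ^ k \<in> homog_le (j + int (k * w)) 0" by (simp add: rep_pow)
  have "1 \<le> j + int (k * w)" using k kw by linarith
  then obtain N where N: "int N = j + int (k * w)" "1 \<le> N"
    by (metis nonneg_int_cases of_nat_le_iff of_nat_1 order.trans zero_le_one)
  obtain c where c: "p * (x * t ^ k) * p = kap c * cyc N"
    using ghost_free_corner[of "x * t ^ k" N] xt N by auto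
  have "p * (x * t ^ k) * p = x * t ^ k"
    using x chomogD[OF pow_chomog[OF k(3)]] by (simp add: mult.assoc[symmetric]) (simp add: mult.assoc)
  then show thesis using that[of k N c] k N c by simp
qed

lemma cyc_nonzero:
  assumes "1 \<le> N" "cyc N \<noteq> 0"
  shows "cyc N = spath (cyc_word N) * p" "P (rge G (last (cyc_word N))) * p = p" "gpath (cyc_word N) * cyc N = p"
    "p * spath (cyc_word N) = spath (cyc_word N)"
proof -
  let ?R = "rge G (last (cyc_word N))"
  have ned: "cyc_word N \<noteq> []" using length_cyc_word[of N] assms(1) by auto
  have R: "?R \<in> GV" using set_cyc_word[of N] ned by (intro gv_range) (meson last_in_set subsetD)
  have pG: "rge G (last \<alpha>) \<in> GV" using \<alpha>(1) alpha_ne by (intro gv_range) (meson last_in_set subsetD)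
  have "p * spath (cyc_word N) \<noteq> 0" using assms(2) by (auto simp: cyc_def)
  then show ps: "p * spath (cyc_word N) = spath (cyc_word N)"
    using P_spath_gpath[OF pG set_cyc_word[of N] ned] by (auto simp: p_def)
  then show cyc: "cyc N = spath (cyc_word N) * p" by (simp add: cyc_def)
  have "spath (cyc_word N) \<noteq> 0" using cyc assms(2) by auto
  note s = spath_last[OF set_cyc_word[of N] ned] gpath_spath[OF set_cyc_word[of N] ned this]
  have "spath (cyc_word N) * (P ?R * p) \<noteq> 0" using assms(2) cyc s(1) by (simp add: mult.assoc[symmetric])
  then show Rp: "P ?R * p = p" using P_p[OF R] by auto
  show "gpath (cyc_word N) * cyc N = p" using cyc s(3) Rp by (simp add: mult.assoc[symmetric])
qed

lemma cyc_mult: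
  assumes "1 \<le> N" "1 \<le> M" "cyc N \<noteq> 0" "cyc M \<noteq> 0"
  shows "cyc N * cyc M = cyc (N + M)"
proof -
  note n = cyc_nonzero[OF assms(1,3)] and m = cyc_nonzero[OF assms(2,4)]
  have pd: "p * cyc M = cyc M" by (simp add: cyc_def mult.assoc[symmetric] p_idem)
  have eq: "cyc N * cyc M = spath (cyc_word N) * (p * cyc M)" by (simp only: n(1) mult.assoc)
  have "gpath (cyc_word N) * (cyc N * cyc M) = cyc M"
    using n(3) pd by (simp add: mult.assoc[symmetric])
  then have nz: "cyc N * cyc M \<noteq> 0" using assms(4) by auto
  have eq2: "cyc N * cyc M = p * spath (cyc_word N @ cyc_word M) * p"
  proof -
    have "cyc N * cyc M = (p * spath (cyc_word N)) * (spath (cyc_word M) * p)" using eq pd m(1) n(4) by simp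
    then show ?thesis by (simp add: mult.assoc)
  qed
  then have "p * spath (cyc_word N @ cyc_word M) \<noteq> 0" using nz by auto
  moreover have "cyc_word N @ cyc_word M \<noteq> []" using length_cyc_word[of N] assms(1) by auto
  ultimately have "cyc_word N @ cyc_word M = cyc_word (N + M)"
    using corner_word[of "cyc_word N @ cyc_word M"] set_cyc_word[of N] set_cyc_word[of M] by (simp add: length_cyc_word)
  then show ?thesis using eq2 by (simp add: cyc_def)
qed

lemma cyc_comm:
  assumes "1 \<le> N" "1 \<le> M"
  shows "cyc N * cyc M = cyc M * cyc N"
  using cyc_mult[OF assms] cyc_mult[OF assms(2,1)]
  by (cases "cyc N = 0 \<or> cyc M = 0") (auto simp: add.commute)

lemma cyc_homog: assumes "1 \<le> N" shows "cyc N \<in> homog (int N)"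
proof -
  have "cyc_word N \<noteq> []" using length_cyc_word[of N] assms(1) by auto
  then have "spath (cyc_word N) \<in> homog (int N)" using spath_gpath_homog(1)[OF set_cyc_word[of N]] by (simp add: length_cyc_word)
  then show ?thesis unfolding cyc_def
    using good_facts(1) by (intro homog_mult[of "p * spath (cyc_word N)" "int N" p 0] homog_mult[of p 0 "spath (cyc_word N)" "int N"]) auto
qed

lemma chomog_comm:
  assumes x: "x \<in> chomog p n" and y: "y \<in> chomog p m"
  shows "x * y = y * x"
proof -
  obtain k N c where k: "1 \<le> k" "1 \<le> N" "x * t ^ k = kap c * cyc N" using chomog_elem[OF x] by metis
  obtain l M d where l: "1 \<le> l" "1 \<le> M" "y * t ^ l = kap d * cyc M" using chomog_elem[OF y] by metis
  have kd: "cyc N * kap d = kap d * cyc N" if "1 \<le> N" for N d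
    by (rule homog_kap_right[OF cyc_homog[OF that]])
  have "(kap c * cyc N) * (kap d * cyc M) = kap c * (cyc N * kap d) * cyc M" by (simp add: mult.assoc)
  also have "\<dots> = kap d * kap c * (cyc M * cyc N)"
    using kd[OF k(2)] cyc_comm[OF k(2) l(2)] kap_comm[of c d] by (simp add: mult.assoc[symmetric]) (simp add: mult.assoc)
  also have "\<dots> = kap d * (cyc M * kap c) * cyc N" using kd[OF l(2)] by (simp add: mult.assoc)
  finally have e: "(x * t ^ k) * (y * t ^ l) = (y * t ^ l) * (x * t ^ k)"
    using k l by (simp add: mult.assoc)
  have "(x * t ^ k) * (y * t ^ l) = x * (t ^ k * y) * t ^ l" by (simp add: mult.assoc)
  also have "\<dots> = (x * y) * t ^ (k + l)" by (simp add: t_comm[OF y] power_add mult.assoc)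
  finally have 1: "(x * t ^ k) * (y * t ^ l) = (x * y) * t ^ (k + l)" .
  have "(y * t ^ l) * (x * t ^ k) = y * (t ^ l * x) * t ^ k" by (simp add: mult.assoc)
  also have "\<dots> = (y * x) * (t ^ l * t ^ k)" by (simp add: t_comm[OF x] mult.assoc)
  also have "t ^ l * t ^ k = t ^ (k + l)" by (simp add: power_add[symmetric] add.commute)
  finally have "(x * y) * t ^ (k + l) * u ^ (k + l) = (y * x) * t ^ (k + l) * u ^ (k + l)"
    using 1 e by simp
  moreover have "t ^ (k + l) * u ^ (k + l) = p" using pow_inv(1)[of "k + l"] k by simp
  ultimately have "(x * y) * p = (y * x) * p" by (simp add: mult.assoc)
  then show ?thesis using chomogD[OF x] chomogD[OF y] by (simp add: mult.assoc)
qed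

lemma corner_comm: "\<lbrakk>x \<in> corner p; y \<in> corner p\<rbrakk> \<Longrightarrow> x * y = y * x"
proof -
  assume x: "x \<in> corner p" and y: "y \<in> corner p"
  have "z * x = x * z" if "z \<in> chomog p n" for z n
    by (rule commute_corner[OF x]) (rule chomog_comm[OF that])
  then show ?thesis by (intro commute_corner[OF y]) simp
qed

text \<open>By \<open>chomog_elem\<close>, a nonzero homogeneous element is \<open>cyc N\<close> up to a scalar and a power of the central unit,
  and the ghost of the path is a left inverse of \<open>cyc N\<close>.\<close>

lemma chomog_unit:
  assumes x: "x \<in> chomog p n" "x \<noteq> 0"
  obtains z where "z \<in> chomog p (- n)" "z * x = p"
proof -
  obtain k N c where k: "1 \<le> k" "1 \<le> N" "int N = n + int (k * w)" "x * t ^ k = kap c * cyc N"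
    using chomog_elem[OF x(1)] by metis
  have "x * t ^ k \<noteq> 0"
  proof
    assume "x * t ^ k = 0"
    then have "x * (t ^ k * u ^ k) = 0" by (simp add: mult.assoc[symmetric])
    then show False using pow_inv(1)[OF k(1)] chomogD[OF x(1)] x(2) by simp
  qed
  then have c: "c \<noteq> 0" and d: "cyc N \<noteq> 0" using k kap_zero by auto
  note n = cyc_nonzero[OF k(2) d]
  have ned: "cyc_word N \<noteq> []" using length_cyc_word[of N] k(2) by auto
  define z' where "z' = kap (inverse c) * (p * gpath (cyc_word N) * p)"
  have z'C: "z' \<in> chomog p (- int N)"
  proof (rule chomogI)
    have "gpath (cyc_word N) \<in> homog (- int N)" using spath_gpath_homog(2)[OF set_cyc_word[of N] ned] by (simp add: length_cyc_word)
    then show "z' \<in> homog (- int N)" unfolding z'_def using good_facts(1)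
      by (intro homog_kap homog_mult[of "p * gpath (cyc_word N)" "- int N" p 0] homog_mult[of p 0 _ "- int N"]) auto
    have "p * z' = (p * kap (inverse c)) * (p * gpath (cyc_word N) * p)" by (simp add: z'_def mult.assoc)
    then show "p * z' = z'" by (simp add: p_kap z'_def mult.assoc) (simp add: mult.assoc[symmetric] p_idem)
    show "z' * p = z'" by (simp add: z'_def mult.assoc p_idem)
  qed
  have pd: "p * cyc N = cyc N" by (simp add: cyc_def mult.assoc[symmetric] p_idem)
  have "z' * (kap c * cyc N) = (z' * kap c) * cyc N" by (simp add: mult.assoc)
  also have "\<dots> = kap c * z' * cyc N" using homog_kap_right[OF chomogD(1)[OF z'C]] by simp
  also have "\<dots> = (kap c * kap (inverse c)) * (p * (gpath (cyc_word N) * (p * cyc N)))"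
    by (simp add: z'_def mult.assoc)
  also have "\<dots> = p" using kap_inv[OF c] n(3) by (simp add: pd p_idem kap_comm[of c])
  finally have z': "z' * (x * t ^ k) = p" using k(4) by simp
  have "z' * x \<in> chomog p (n - int N)" by (rule chomog_mult[OF z'C x(1)]) simp
  then have "t ^ k * z' * x = p" using t_comm[of "z' * x" "n - int N" k] z' by (simp add: mult.assoc)
  moreover have "t ^ k * z' \<in> chomog p (- n)" by (rule chomog_mult[OF pow_chomog[OF k(1)] z'C]) (use k in simp)
  ultimately show thesis using that by blast
qed

text \<open>Since \<open>p\<close> is a sum of terms of the degrees \<open>-w, \<dots>, -1\<close>, multiplying by \<open>p\<close> moves a top term to lower
  degrees. So every element of the corner fits into \<open>w\<close> consecutive degrees.\<close>

lemma window_reduce: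
  assumes "y \<in> window p a (a + int m)"
  shows "y \<in> window p a (a + int (w - 1))"
  using assms
proof (induction m)
  case 0
  then show ?case by (auto intro: window_mono)
next
  case (Suc m)
  show ?case
  proof (cases "Suc m < w")
    case True
    then show ?thesis using Suc by (auto intro: window_mono)
  next
    case False
    obtain y1 c where y: "y1 \<in> window p a (a + int m)" "c \<in> chomog p (a + int (Suc m))" "y = y1 + c"
      using window_top[OF Suc.prems] by auto
    have "c * p \<in> window p (- int w + (a + int (Suc m))) (- 1 + (a + int (Suc m)))"
      by (rule chomog_mult_window[OF y(2) good_facts(4)])
    then have "c \<in> window p a (a + int m)" using chomogD[OF y(2)] False by (auto intro: window_mono)
    then show ?thesis using y Suc.IH window_add by blast
  qed
qed

text \<open>Division with remainder by \<open>p + y''\<close>, whose top term is \<open>p\<close>, of degree zero.\<close>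

lemma division:
  assumes y'': "y'' \<in> window p (- int l) (- 1)" and l: "l < w"
    and i: "1 \<le> i" "i + k = w - l + 1" and s: "s \<in> window p (- int w) (- int i)"
  shows "\<exists>g\<in>window p (- int (w - l)) (- int i). s - g * (p + y'') \<in> window p (- int w) (- int (w - l) - 1)"
  using i s
proof (induction k arbitrary: i s)
  case 0
  then have "- int i = - int (w - l) - 1" by simp
  then have "s \<in> window p (- int w) (- int (w - l) - 1)" using 0(3) by (simp only:)
  then show ?case by (intro bexI[of _ 0] window_zero) simp
next
  case (Suc k)
  obtain s1 e where s: "s1 \<in> window p (- int w) (- int i - 1)" "e \<in> chomog p (- int i)" "s = s1 + e"
  proof -
    have "- int w \<le> - int i" using Suc.prems(2) l by simp
    from window_top[OF Suc.prems(3) this] that show thesis by blast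
  qed
  have "e * y'' \<in> window p (- int l + - int i) (- 1 + - int i)" by (rule chomog_mult_window[OF s(2) y''])
  then have "e * y'' \<in> window p (- int w) (- int i - 1)" using Suc.prems l by (auto intro: window_mono)
  then have "s1 - e * y'' \<in> window p (- int w) (- int (Suc i))" by (intro window_mono[OF window_diff[OF s(1)]]) auto
  moreover have "s1 - e * y'' = s - e * (p + y'')"
    using s chomogD[OF s(2)] by (simp add: distrib_left)
  ultimately obtain g where g: "g \<in> window p (- int (w - l)) (- int (Suc i))"
    "s - e * (p + y'') - g * (p + y'') \<in> window p (- int w) (- int (w - l) - 1)"
    using Suc.IH[of "Suc i" "s1 - e * y''"] Suc.prems by auto
  have "e \<in> window p (- int (w - l)) (- int i)" using s(2) Suc.prems by (intro chomog_window) auto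
  then have "e + g \<in> window p (- int (w - l)) (- int i)" by (rule window_add[OF _ window_mono[OF g(1)]]) auto
  then show ?case using g(2) by (intro bexI[of _ "e + g"]) (simp_all add: algebra_simps)
qed

context
  assumes prime: "\<And>x y. \<lbrakk>x \<in> corner 1; y \<in> corner 1; \<And>r. r \<in> corner 1 \<Longrightarrow> x * r * y = 0\<rbrakk> \<Longrightarrow> x = 0 \<or> y = 0"
begin

lemma corner_domain:
  assumes "x \<in> corner p" "y \<in> corner p" "x * y = 0"
  shows "x = 0 \<or> y = 0"
proof (rule prime)
  show "x \<in> corner 1" "y \<in> corner 1" using assms corner_sub by blast+
  fix r assume "r \<in> corner 1"
  then have r: "p * r * p \<in> corner p" using compress_in_corner good_facts(1,3) by blast
  have "x * r * y = x * (p * r * p) * y"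
    using corner_absorb[OF assms(1)] corner_absorb[OF assms(2)] by (simp add: mult.assoc) (simp add: mult.assoc[symmetric])
  also have "\<dots> = (p * r * p) * (x * y)" using corner_comm[OF assms(1) r] by (simp add: mult.assoc)
  finally show "x * r * y = 0" using assms(3) by simp
qed

text \<open>Induction on the spread \<open>l\<close> of \<open>y\<close>. Normalise \<open>y\<close> to \<open>p + y''\<close> with \<open>y''\<close> in negative degrees and divide zero,
  presented as \<open>p - p\<close> where the second \<open>p\<close> is rewritten in the degrees \<open>-w, \<dots>, -1\<close>, by it. The quotient
  \<open>p + q\<close> is nonzero since it spreads over at most \<open>w\<close> consecutive degrees. So the product
  \<open>(p + q) (p + y'')\<close> is nonzero in the domain, and up to sign it is the remainder, of spread
  less than \<open>l\<close>.\<close>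

lemma corner_field_window:
  assumes "l < w" "y \<in> window p a (a + int l)" "y \<noteq> 0"
  shows "\<exists>z\<in>corner p. z * y = p"
  using assms
proof (induction l arbitrary: y a)
  case 0
  obtain y1 c where "y1 \<in> window p a (a - 1)" "c \<in> chomog p a" "y = y1 + c" using window_top[OF 0(2)] by auto
  then have "y \<in> chomog p a" using window_empty[of "a - 1" a p] by auto
  then show ?case using chomog_unit[OF _ 0(3)] chomog_corner by metis
next
  case (Suc l)
  let ?l = "Suc l"
  let ?b = "a + int ?l"
  obtain y1 c where y: "y1 \<in> window p a (?b - 1)" "c \<in> chomog p ?b" "y = y1 + c"
    using window_top[OF Suc.prems(2)] by auto
  show ?case
  proof (cases "c = 0")
    case True
    then show ?thesis using Suc.IH[of y a] Suc.prems y by simp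
  next
    case False
    obtain c' where c': "c' \<in> chomog p (- ?b)" "c' * c = p" using chomog_unit[OF y(2) False] .
    define y'' where "y'' = c' * y1"
    have "y'' \<in> window p (a + - ?b) (?b - 1 + - ?b)" unfolding y''_def by (rule chomog_mult_window[OF c'(1) y(1)])
    then have y'': "y'' \<in> window p (- int ?l) (- 1)" by simp
    have y': "c' * y = p + y''" using y c' by (simp add: distrib_left y''_def)
    have yD: "y \<in> corner p" using Suc.prems by (blast intro: cornerI)
    have y'0: "p + y'' \<noteq> 0"
    proof
      assume "p + y'' = 0"
      then have "c * c' * y = 0" using y' by (simp add: mult.assoc)
      moreover have "c * c' = p" using chomog_comm[OF y(2) c'(1)] c' by simp
      ultimately show False using corner_absorb[OF yD] Suc.prems by simp
    qed
    have "- (p + y'') \<in> window p (- int w) (- int 1)"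
      using window_add[OF good_facts(4) window_mono[OF y'']] Suc.prems by (intro window_uminus) auto
    then obtain q where q: "q \<in> window p (- int (w - ?l)) (- int 1)"
      "- (p + y'') - q * (p + y'') \<in> window p (- int w) (- int (w - ?l) - 1)"
      using division[OF y'' Suc.prems(1), of 1 "w - ?l"] by auto
    define r where "r = (p + q) * (p + y'')"
    have py: "p * (p + y'') = p + y''"
      using corner_absorb(1)[OF cornerI[OF y'']] p_idem by (simp add: distrib_left)
    have "- r = - (p + y'') - q * (p + y'')" using py by (simp add: r_def distrib_right)
    then have "- r \<in> window p (- int w) (- int (w - ?l) - 1)" using q(2) by simp
    then have "r \<in> window p (- int w) (- int (w - ?l) - 1)" using window_uminus by fastforce
    moreover have "- int (w - ?l) - 1 = - int w + int l" using Suc.prems by auto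
    ultimately have r: "r \<in> window p (- int w) (- int w + int l)" by simp
    have "p + q \<noteq> 0"
    proof
      assume "p + q = 0"
      then have "p = - q" by (simp add: eq_neg_iff_add_eq_0)
      then have "p \<in> window p (0 - int (w - ?l)) (0 - 1)" using window_uminus[OF q(1)] by simp
      then have "p = 0" by (rule min_zero[OF good_facts(1)]) (use Suc.prems in auto)
      then show False using good_facts(2) by simp
    qed
    moreover have pD: "p \<in> corner p" using good_facts(4) by (rule cornerI)
    have pqD: "p + q \<in> corner p" using corner_add[OF pD cornerI[OF q(1)]] .
    moreover have "p + y'' \<in> corner p" using corner_add[OF pD cornerI[OF y'']] .
    ultimately have "r \<noteq> 0" unfolding r_def using corner_domain y'0 by blast
    then obtain z where z: "z \<in> corner p" "z * r = p" using Suc.IH[OF _ r] Suc.prems by auto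
    have "z * (p + q) * c' * y = p" using z(2) y' by (simp add: r_def mult.assoc)
    moreover have "z * (p + q) * c' \<in> corner p" using z(1) pqD chomog_corner[OF c'(1)] by (intro corner_mult)
    ultimately show ?thesis by blast
  qed
qed

lemma corner_field:
  assumes "y \<in> corner p" "y \<noteq> 0"
  shows "\<exists>z\<in>corner p. z * y = p"
proof -
  obtain a b where "y \<in> window p a b" using assms by (auto simp: corner_def)
  then have "y \<in> window p a (a + int (nat (b - a)))" by (auto intro: window_mono)
  then have "y \<in> window p a (a + int (w - 1))" by (rule window_reduce)
  then show ?thesis using corner_field_window[of "w - 1" y a] assms w_pos by auto
qed

end
end

theorem prime_dependent_has_field_corner:
  assumes prime: "\<And>x y. \<lbrakk>x \<in> corner 1; y \<in> corner 1; \<And>r. r \<in> corner 1 \<Longrightarrow> x * r * y = 0\<rbrakk> \<Longrightarrow> x = 0 \<or> y = 0"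
  shows "\<exists>p\<in>corner 1. p \<noteq> 0 \<and> p * p = p \<and> (\<forall>x\<in>corner 1. p * x * p \<noteq> 0 \<longrightarrow> (\<exists>z\<in>corner 1. z * (p * x * p) = p))"
proof -
  obtain \<alpha> where \<alpha>: "set \<alpha> \<subseteq> E" "length \<alpha> = w" "good (P (rge G (last \<alpha>))) (spath \<alpha>)"
    "spath \<alpha> * gpath \<alpha> = P (rge G (last \<alpha>))" using good_cycle .
  define p where "p = P (rge G (last \<alpha>))"
  note g = goodD[OF \<alpha>(3)[folded p_def]]
  have field: "\<exists>z\<in>corner p. z * y = p" if "y \<in> corner p" "y \<noteq> 0" for y
    using corner_field[OF \<alpha>(1,2) p_def refl refl \<alpha>(3,4)[folded p_def]] prime that by blast
  show ?thesis
  proof (rule bexI[of _ p], intro conjI ballI impI)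
    fix x assume "x \<in> corner 1" "p * x * p \<noteq> 0"
    then show "\<exists>z\<in>corner 1. z * (p * x * p) = p"
      using field[OF compress_in_corner[OF g(1,3)]] corner_sub by blast
  qed (use g corner_sub[of p] cornerI[OF g(4)] in auto)
qed

end

section \<open>Realising an algebra by endomorphisms\<close>

text \<open>The additive endomorphisms of a ring. They serve as a unital ring type that contains the quotient algebras
  in question; these depend on a graph and an ideal and so are not types themselves.\<close>

typedef (overloaded) 'a endo = "{f :: 'a::ring_1 \<Rightarrow> 'a. \<forall>x y. f (x + y) = f x + f y}"
  morphisms app_endo Abs_endo
  by (intro exI[of _ "\<lambda>x. x"]) simp

setup_lifting type_definition_endo

instantiation endo :: (ring_1) ring_1
begin

lift_definition zero_endo :: "'a endo" is "\<lambda>x. 0" by simp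
lift_definition one_endo :: "'a endo" is "\<lambda>x. x" by simp
lift_definition plus_endo :: "'a endo \<Rightarrow> 'a endo \<Rightarrow> 'a endo" is "\<lambda>f g x. f x + g x"
  by (simp add: algebra_simps)
lift_definition uminus_endo :: "'a endo \<Rightarrow> 'a endo" is "\<lambda>f x. - f x"
  by simp
lift_definition minus_endo :: "'a endo \<Rightarrow> 'a endo \<Rightarrow> 'a endo" is "\<lambda>f g x. f x - g x"
  by (simp add: algebra_simps)
lift_definition times_endo :: "'a endo \<Rightarrow> 'a endo \<Rightarrow> 'a endo" is "\<lambda>f g x. f (g x)"
  by simp

instance
proof
  show "(0 :: 'a endo) \<noteq> 1"
  proof
    assume "(0 :: 'a endo) = 1"
    then have "(0 :: 'a) = 1" by transfer meson
    then show False by simp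
  qed
qed (transfer, force simp: algebra_simps)+

end

text \<open>A linear map with kernel \<open>J\<close> that is the identity modulo \<open>J\<close>: send a basis of \<open>J\<close> to zero
  and fix the vectors that extend it to a basis of the whole space.\<close>

lemma (in vector_space) projection_along_subspace:
  assumes J: "subspace J"
  shows "\<exists>\<pi>. Vector_Spaces.linear scale scale \<pi> \<and> (\<forall>x. \<pi> x = 0 \<longleftrightarrow> x \<in> J) \<and> (\<forall>x. x - \<pi> x \<in> J)"
proof -
  interpret vector_space_pair scale scale ..
  obtain B where B: "B \<subseteq> J" "independent B" "J \<subseteq> span B"
    using maximal_independent_subset[of J] by auto
  let ?B = "extend_basis B"
  have B': "independent ?B" "span ?B = UNIV"
    using independent_extend_basis[OF B(2)] span_extend_basis[OF B(2)] by auto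
  obtain \<pi> where \<pi>: "Vector_Spaces.linear scale scale \<pi>" "\<And>x. x \<in> ?B \<Longrightarrow> \<pi> x = (if x \<in> B then 0 else x)"
    using linear_independent_extend[OF B'(1), of "\<lambda>x. if x \<in> B then 0 else x"] by blast
  interpret \<pi>: Vector_Spaces.linear scale scale \<pi> by (rule \<pi>)
  have BJ: "span B = J" using B J by (metis span_minimal subset_antisym)
  have zero: "\<pi> x = 0" if "x \<in> J" for x
  proof -
    have "\<pi> b = 0" if "b \<in> B" for b using \<pi>(2)[of b] that extend_basis_superset[OF B(2)] by auto
    then show ?thesis using linear_eq_0_on_span[OF \<pi>(1), of B x] that BJ by blast
  qed
  have diff: "x - \<pi> x \<in> J" for x
  proof -
    have "subspace {x. x - \<pi> x \<in> J}"
    proof (rule subspaceI)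
      fix x y assume "x \<in> {x. x - \<pi> x \<in> J}" "y \<in> {x. x - \<pi> x \<in> J}"
      then have "(x - \<pi> x) + (y - \<pi> y) \<in> J" using subspace_add[OF J] by blast
      then show "x + y \<in> {x. x - \<pi> x \<in> J}" by (simp add: \<pi>.add algebra_simps)
    next
      fix c x assume "x \<in> {x. x - \<pi> x \<in> J}"
      then have "scale c (x - \<pi> x) \<in> J" using subspace_scale[OF J] by blast
      then show "scale c x \<in> {x. x - \<pi> x \<in> J}" by (simp add: \<pi>.scale scale_right_diff_distrib)
    qed (use subspace_0[OF J] \<pi>.zero in simp)
    moreover have "?B \<subseteq> {x. x - \<pi> x \<in> J}"
      using \<pi>(2) B(1) subspace_0[OF J] by auto
    ultimately have "span ?B \<subseteq> {x. x - \<pi> x \<in> J}" by (rule span_minimal[rotated])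
    then show ?thesis using B'(2) by auto
  qed
  have "x \<in> J" if "\<pi> x = 0" for x using diff[of x] that by simp
  then show ?thesis using \<pi>(1) zero diff by blast
qed

text \<open>The quotient of \<open>'b\<close> by an ideal \<open>J\<close> is realised inside the endomorphisms of \<open>'b\<close>: with a projection \<open>\<pi>\<close>
  along \<open>J\<close> as above, map \<open>f\<close> to \<open>v \<mapsto> \<pi> (f v)\<close>. This is multiplicative because \<open>\<pi> (f (\<pi> x)) = \<pi> (f x)\<close>,
  but it does not preserve the unit. Scalars act by multiplication.\<close>

lemma ring_with_prescribed_kernel:
  fixes \<kappa> :: "'k::field \<Rightarrow> 'b::ring_1" and J :: "'b set"
  assumes \<kappa>: "\<kappa> 1 = 1" "\<And>c d. \<kappa> (c + d) = \<kappa> c + \<kappa> d" "\<And>c d. \<kappa> (c * d) = \<kappa> c * \<kappa> d"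
      "\<And>c x. \<kappa> c * x = x * \<kappa> c"
    and J: "0 \<in> J" "\<And>x y. \<lbrakk>x \<in> J; y \<in> J\<rbrakk> \<Longrightarrow> x + y \<in> J" "\<And>x r. x \<in> J \<Longrightarrow> r * x \<in> J" "\<And>x r. x \<in> J \<Longrightarrow> x * r \<in> J"
  shows "\<exists>(\<rho> :: 'b \<Rightarrow> 'b endo) (kap :: 'k \<Rightarrow> 'b endo).
    (\<forall>f g. \<rho> (f + g) = \<rho> f + \<rho> g) \<and> (\<forall>f g. \<rho> (f * g) = \<rho> f * \<rho> g) \<and> (\<forall>f. \<rho> f = 0 \<longleftrightarrow> f \<in> J) \<and>
    kap 1 = 1 \<and> (\<forall>c d. kap (c + d) = kap c + kap d) \<and> (\<forall>c d. kap (c * d) = kap c * kap d) \<and>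
    (\<forall>c f. kap c * \<rho> f = \<rho> f * kap c) \<and> (\<forall>c f. \<rho> (\<kappa> c * f) = kap c * \<rho> f)"
proof -
  interpret vector_space "\<lambda>c f. \<kappa> c * f"
    by unfold_locales (simp_all add: \<kappa>(1-3) distrib_left distrib_right mult.assoc)
  have "subspace J" by (rule subspaceI) (use J in auto)
  then obtain \<pi> where \<pi>: "Vector_Spaces.linear (\<lambda>c f. \<kappa> c * f) (\<lambda>c f. \<kappa> c * f) \<pi>"
    "\<And>x. \<pi> x = 0 \<longleftrightarrow> x \<in> J" "\<And>x. x - \<pi> x \<in> J"
    using projection_along_subspace by blast
  interpret \<pi>: Vector_Spaces.linear "\<lambda>c f. \<kappa> c * f" "\<lambda>c f. \<kappa> c * f" \<pi> by (rule \<pi>)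
  define \<rho> where "\<rho> f = Abs_endo (\<lambda>v. \<pi> (f * v))" for f
  define kap where "kap c = Abs_endo (\<lambda>v. \<kappa> c * v)" for c
  have app: "app_endo (\<rho> f) v = \<pi> (f * v)" "app_endo (kap c) v = \<kappa> c * v" for f c v
    unfolding \<rho>_def kap_def by (subst Abs_endo_inverse; simp add: distrib_left \<pi>.add)+
  have eqI: "x = y" if "\<And>v. app_endo x v = app_endo y v" for x y :: "'b endo"
    using that by (metis app_endo_inject ext)
  note sim = plus_endo.rep_eq times_endo.rep_eq zero_endo.rep_eq one_endo.rep_eq app
  have key: "\<pi> (f * \<pi> x) = \<pi> (f * x)" for f x
  proof -
    have "\<pi> (f * (x - \<pi> x)) = 0" using \<pi>(2,3) J(3) by blast
    then show ?thesis by (simp add: right_diff_distrib \<pi>.diff)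
  qed
  have "\<rho> f = 0 \<longleftrightarrow> f \<in> J" for f
  proof
    assume "\<rho> f = 0"
    then have "app_endo (\<rho> f) 1 = 0" by (simp add: sim)
    then show "f \<in> J" using \<pi>(2) by (simp add: app)
  next
    assume "f \<in> J"
    then show "\<rho> f = 0" by (intro eqI) (simp add: sim \<pi>(2) J(4))
  qed
  moreover have "\<rho> (f + g) = \<rho> f + \<rho> g" for f g
    by (rule eqI) (simp add: sim distrib_right \<pi>.add)
  moreover have "\<rho> (f * g) = \<rho> f * \<rho> g" for f g
    by (rule eqI) (simp add: sim key mult.assoc)
  moreover have "kap 1 = 1" by (rule eqI) (simp add: sim \<kappa>)
  moreover have "kap (c + d) = kap c + kap d" for c d by (rule eqI) (simp add: sim \<kappa>(2) distrib_right)
  moreover have "kap (c * d) = kap c * kap d" for c d by (rule eqI) (simp add: sim)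
  moreover have "\<rho> (\<kappa> c * f) = kap c * \<rho> f" for c f
    by (rule eqI) (simp add: sim mult.assoc \<pi>.scale)
  moreover have "kap c * \<rho> f = \<rho> f * kap c" for c f
  proof (rule eqI)
    fix v
    have "f * (\<kappa> c * v) = \<kappa> c * (f * v)" by (metis \<kappa>(4) mult.assoc)
    then show "app_endo (kap c * \<rho> f) v = app_endo (\<rho> f * kap c) v" by (simp add: sim \<pi>.scale)
  qed
  ultimately show ?thesis by blast
qed

lemma poly_mapping_induct_keys [consumes 1, case_names zero add]:
  fixes f :: "'w \<Rightarrow>\<^sub>0 'c::comm_monoid_add"
  assumes "Poly_Mapping.keys f \<subseteq> A" and "Q 0"
    and "\<And>w c g. \<lbrakk>w \<in> A; Poly_Mapping.keys g \<subseteq> A; Q g\<rbrakk> \<Longrightarrow> Q (Poly_Mapping.single w c + g)"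
  shows "Q f"
  using assms(1)
proof (induction f rule: Poly_Mapping.update_induct)
  case (update f a b)
  have eq: "Poly_Mapping.update a b f = Poly_Mapping.single a b + f"
    using update(1) by (intro poly_mapping_eqI)
      (auto simp: lookup_update lookup_add lookup_single in_keys_iff when_def)
  have "a \<in> A" "Poly_Mapping.keys f \<subseteq> A" using update by (auto simp: keys_update)
  then show ?case unfolding eq using assms(3) update.IH by blast
qed (rule assms(2))

section \<open>Quotients of the free algebra\<close>

abbreviation scal :: "'k::field \<Rightarrow> ('v, 'e, 'k) free_elem" where
  "scal c \<equiv> Poly_Mapping.single 0 c"

lemma scal_comm: "scal c * f = f * (scal c :: ('v, 'e, 'k::field) free_elem)"
proof -
  have "Poly_Mapping.keys f \<subseteq> UNIV" by simp
  then show ?thesis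
    by (induction f rule: poly_mapping_induct_keys) (simp_all add: algebra_simps mult_single)
qed

lemma scal_closed: "f \<in> carrier (free_alg G) \<Longrightarrow> scal c * f \<in> carrier (free_alg G)"
  using keys_mult[of "scal c" f] by (auto simp: free_alg_simps split: if_splits)

lemma generators_closed:
  "A \<in> gen_verts G \<Longrightarrow> pp A \<in> carrier (free_alg G)"
  "e \<in> edges G \<Longrightarrow> ss e \<in> carrier (free_alg G)"
  "e \<in> edges G \<Longrightarrow> gg e \<in> carrier (free_alg G)"
  by (auto intro!: gen_elem_closed simp: generators_def)

text \<open>A map \<open>\<rho>\<close> from the free algebra to a unital ring with kernel \<open>J\<close>, where \<open>J\<close> contains the defining
  relations of the Leavitt path algebra. Only the values of \<open>\<rho>\<close> on combinations of nonempty words in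
  the generators of \<open>G\<close> matter; the other words and the unit are in its domain for convenience.\<close>

locale leavitt_quotient =
  fixes G :: "('v, 'e) ugraph" and J :: "('v, 'e, 'k::field) free_elem set"
    and \<rho> :: "('v, 'e, 'k) free_elem \<Rightarrow> 'a::ring_1" and kap :: "'k \<Rightarrow> 'a"
  assumes G: "ultragraph G"
    and rho_add: "\<rho> (f + g) = \<rho> f + \<rho> g"
    and rho_mult: "\<rho> (f * g) = \<rho> f * \<rho> g"
    and rho_zero_iff: "f \<in> carrier (free_alg G) \<Longrightarrow> \<rho> f = 0 \<longleftrightarrow> f \<in> J"
    and kap: "kap 1 = 1" "kap (c + d) = kap c + kap d" "kap (c * d) = kap c * kap d" "kap c * \<rho> f = \<rho> f * kap c"
    and rho_scal: "\<rho> (scal c * f) = kap c * \<rho> f"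
    and J: "J \<subseteq> carrier (free_alg G)" "lpa_relations G \<subseteq> J"
begin

lemma rho_zero: "\<rho> 0 = 0" using rho_add[of 0 0] by simp
lemma rho_uminus: "\<rho> (- f) = - \<rho> f"
  using rho_add[of f "- f"] by (simp add: rho_zero minus_unique)
lemma rho_diff: "\<rho> (f - g) = \<rho> f - \<rho> g"
  using rho_add[of f "- g"] by (simp add: rho_uminus)
lemma rho_sum: "\<rho> (sum f N) = (\<Sum>n\<in>N. \<rho> (f n))"
  by (induction N rule: infinite_finite_induct) (simp_all add: rho_zero rho_add)

lemma rho_rel: "x \<in> lpa_relations G \<Longrightarrow> \<rho> x = 0"
  using J rho_zero_iff by blast

sublocale leavitt_family G kap "\<lambda>A. \<rho> (pp A)" "\<lambda>e. \<rho> (ss e)" "\<lambda>e. \<rho> (gg e)"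
proof
  fix A B assume A: "A \<in> gen_verts G" "B \<in> gen_verts G"
  show "\<rho> (pp A) * \<rho> (pp B) = \<rho> (pp (A \<inter> B))"
    using rho_rel[OF rel_p_mult[OF A]] by (simp add: rho_diff rho_mult)
  show "\<rho> (pp (A \<union> B)) = \<rho> (pp A) + \<rho> (pp B) - \<rho> (pp (A \<inter> B))"
    using rho_rel[OF rel_p_Un[OF A]] by (simp add: rho_diff rho_add)
next
  fix e assume e: "e \<in> edges G"
  show "\<rho> (pp {src G e}) * \<rho> (ss e) = \<rho> (ss e)" using rho_rel[OF rel_src_edge[OF e]] by (simp add: rho_diff rho_mult)
  show "\<rho> (ss e) * \<rho> (pp (rge G e)) = \<rho> (ss e)" using rho_rel[OF rel_edge_rge[OF e]] by (simp add: rho_diff rho_mult)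
  show "\<rho> (pp (rge G e)) * \<rho> (gg e) = \<rho> (gg e)" using rho_rel[OF rel_rge_ghost[OF e]] by (simp add: rho_diff rho_mult)
  show "\<rho> (gg e) * \<rho> (pp {src G e}) = \<rho> (gg e)" using rho_rel[OF rel_ghost_src[OF e]] by (simp add: rho_diff rho_mult)
  show "src G e \<in> verts G" using G e by (auto simp: ultragraph_def)
next
  fix e f assume e: "e \<in> edges G" "f \<in> edges G"
  show "\<rho> (gg e) * \<rho> (ss f) = (if e = f then \<rho> (pp (rge G e)) else 0)"
    using rho_rel[OF rel_ghost_edge[OF e]] by (auto simp: rho_diff rho_mult rho_zero)
qed (simp_all add: kap rho_rel[OF rel_p_empty])

lemma rho_word_homog:
  assumes "set l \<subseteq> generators G" "l \<noteq> []"
  shows "\<rho> (Poly_Mapping.single (Word l) 1) \<in> homog (sum_list (map generator_degree l))"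
  using assms
proof (induction l)
  case (Cons x l)
  have x: "\<rho> (gen_elem x) \<in> homog (generator_degree x)"
    using Cons.prems by (auto simp: generators_def intro: P_homog S_homog T_homog)
  show ?case
  proof (cases "l = []")
    case True
    then show ?thesis using x by (simp add: gen_elem_def)
  next
    case False
    have "Word (x # l) = Word [x] + Word l" by (simp add: plus_word_def)
    then have "\<rho> (Poly_Mapping.single (Word (x # l)) 1) = \<rho> (gen_elem x) * \<rho> (Poly_Mapping.single (Word l) 1)"
      by (simp add: gen_elem_def rho_mult[symmetric] mult_single)
    then show ?thesis using homog_mult[OF x Cons.IH] Cons.prems False by simp
  qed
qed simp

lemma rho_single_homog:
  assumes "w \<in> gen_words G"
  shows "\<rho> (Poly_Mapping.single w c) \<in> homog (word_degree w)"
proof -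
  have "\<rho> (Poly_Mapping.single w c) = kap c * \<rho> (Poly_Mapping.single w 1)"
    by (simp add: rho_scal[symmetric] mult_single)
  moreover have "\<rho> (Poly_Mapping.single w 1) \<in> homog (word_degree w)"
    using assms rho_word_homog[of "letters w"]
    by (cases w) (auto simp: gen_words_def word_degree_def zero_word_def)
  ultimately show ?thesis using homog_kap by simp
qed

lemma rho_homog:
  assumes "f \<in> carrier (free_alg G)" "\<And>w. w \<in> Poly_Mapping.keys f \<Longrightarrow> word_degree w = n"
  shows "\<rho> f \<in> homog n"
proof -
  have "Poly_Mapping.keys f \<subseteq> {w \<in> gen_words G. word_degree w = n}"
    using assms by (auto simp: free_alg_simps)
  then show ?thesis
    by (induction f rule: poly_mapping_induct_keys)
      (auto simp: rho_zero rho_add homog_zero intro!: homog_add rho_single_homog)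
qed

lemma rho_corner:
  assumes "f \<in> carrier (free_alg G)"
  shows "\<rho> f \<in> corner 1"
proof -
  have "Poly_Mapping.keys f \<subseteq> gen_words G" using assms by (simp add: free_alg_simps)
  then show ?thesis
  proof (induction f rule: poly_mapping_induct_keys)
    case zero
    show ?case by (rule cornerI[of _ 1 0 0]) (simp add: rho_zero window_zero)
  next
    case (add w c g)
    have "\<rho> (Poly_Mapping.single w c) \<in> corner 1" using rho_single_homog[OF add(1)] by (intro chomog_corner) (auto simp: chomog_one)
    then show ?case using add corner_add by (simp add: rho_add)
  qed
qed

lemma corner_rho:
  assumes "x \<in> corner 1"
  shows "\<exists>f\<in>carrier (free_alg G). x = \<rho> f"
proof -
  let ?R = "\<rho> ` carrier (free_alg G)"
  have R: "0 \<in> ?R" "x \<in> ?R \<Longrightarrow> y \<in> ?R \<Longrightarrow> x + y \<in> ?R" "x \<in> ?R \<Longrightarrow> y \<in> ?R \<Longrightarrow> x * y \<in> ?R"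
    "x \<in> ?R \<Longrightarrow> kap c * x \<in> ?R" for x y c
  proof -
    show "0 \<in> ?R" by (rule image_eqI[of _ _ 0]) (auto simp: rho_zero free_alg_simps)
    show "x + y \<in> ?R" if "x \<in> ?R" "y \<in> ?R" using that by (auto simp: rho_add[symmetric] intro!: imageI free_alg_closed)
    show "x * y \<in> ?R" if "x \<in> ?R" "y \<in> ?R" using that by (auto simp: rho_mult[symmetric] intro!: imageI free_alg_closed)
    show "kap c * x \<in> ?R" if "x \<in> ?R" using that by (auto simp: rho_scal[symmetric] intro!: imageI scal_closed)
  qed
  have gens: "A \<in> GV \<Longrightarrow> \<rho> (pp A) \<in> ?R" "e \<in> E \<Longrightarrow> \<rho> (ss e) \<in> ?R" "e \<in> E \<Longrightarrow> \<rho> (gg e) \<in> ?R" for A e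
    by (auto intro: imageI generators_closed)
  have spath: "spath \<alpha> * x \<in> ?R" if "set \<alpha> \<subseteq> E" "x \<in> ?R" for \<alpha> x
    using that
  proof (induction \<alpha>)
    case (Cons e \<alpha>)
    then have "\<rho> (ss e) * (spath \<alpha> * x) \<in> ?R" by (intro R(3)[OF gens(2)]) auto
    then show ?case by (simp add: mult.assoc)
  qed simp
  have gpath: "x * gpath \<beta> \<in> ?R" if "set \<beta> \<subseteq> E" "x \<in> ?R" for \<beta> x
    using that
  proof (induction \<beta>)
    case (Cons e \<beta>)
    then have "(x * gpath \<beta>) * \<rho> (gg e) \<in> ?R" by (intro R(3)[OF _ gens(3)]) auto
    then show ?case by (simp add: mult.assoc)
  qed simp
  have homog_le: "x \<in> ?R" if "x \<in> homog_le n m" for x n m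
    using that
  proof (induction rule: homog_le.induct)
    case (homog_le_step x y)
    obtain d \<alpha> A \<beta> where x: "x = kap d * spath \<alpha> * \<rho> (pp A) * gpath \<beta>" "set \<alpha> \<subseteq> E" "set \<beta> \<subseteq> E" "A \<in> GV"
      using homog_le_step(1) by (auto elim!: monomialsE)
    have "x = kap d * (spath \<alpha> * \<rho> (pp A) * gpath \<beta>)" using x by (simp add: mult.assoc)
    also have "\<dots> \<in> ?R" using x by (intro R(4) gpath spath gens)
    finally show ?case using R(2) homog_le_step by blast
  qed (rule R(1))
  obtain a b where "x \<in> window 1 a b" using assms by (auto simp: corner_def)
  then obtain h where h: "\<And>j. h j \<in> homog j" "x = (\<Sum>j\<in>{a..b}. h j)" unfolding window_def chomog_one by blast
  have "(\<Sum>j\<in>N. h j) \<in> ?R" if "finite N" for N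
    using that
  proof (induction N rule: finite_induct)
    case (insert i N)
    have "h i \<in> ?R" using h(1)[of i] homog_le by (auto simp: homog_def)
    then show ?case using insert R(2) by simp
  qed (use R(1) in simp)
  then show ?thesis using h(2) by auto
qed

end

text \<open>The ideal \<open>J\<close> of the algebra without unit is enlarged to the ideal \<open>K\<close> of all finitely supported
  functions on words by adding the combinations \<open>Z\<close> of words with a letter that is not a generator
  of \<open>G\<close>. This does not change the kernel on the free algebra of \<open>G\<close>.\<close>

lemma leavitt_quotient_exists:
  fixes G :: "('v, 'e) ugraph" and J :: "('v, 'e, 'k::field) free_elem set"
  assumes G: "ultragraph G" and J: "two_sided_ideal J (free_alg G)"
    and scal: "\<And>c f. f \<in> J \<Longrightarrow> scal c * f \<in> J" and rel: "lpa_relations G \<subseteq> J"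
  shows "\<exists>(\<rho> :: ('v, 'e, 'k) free_elem \<Rightarrow> ('v, 'e, 'k) free_elem endo) kap. leavitt_quotient G J \<rho> kap"
proof -
  interpret F: nonunital_ring "free_alg G :: ('v, 'e, 'k) free_elem ring" by (rule nonunital_ring_free_alg)
  note Jf = F.two_sided_ideal_facts[OF J, unfolded free_alg_simps(2-4)]
  note Jm = two_sided_idealD(2,3)[OF J, unfolded free_alg_simps(2-4)]
  define B where "B = {w :: ('v, 'e) generator word. \<not> set (letters w) \<subseteq> generators G}"
  define Z :: "('v, 'e, 'k) free_elem set" where "Z = {z. Poly_Mapping.keys z \<subseteq> B}"
  have Z_add: "x + y \<in> Z" if "x \<in> Z" "y \<in> Z" for x y
    using that Poly_Mapping.keys_add[of x y] by (auto simp: Z_def)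
  have B: "u \<in> B \<or> v \<in> B \<Longrightarrow> u + v \<in> B" for u v
    by (cases u; cases v) (auto simp: B_def plus_word_def)
  have Z_mult: "x * z \<in> Z" "z * x \<in> Z" if "z \<in> Z" for x z
  proof -
    have "k \<in> B" if k: "k \<in> Poly_Mapping.keys (x * z)" for k
    proof -
      obtain a b where "b \<in> Poly_Mapping.keys z" "k = a + b" using keys_mult[of x z] k by blast
      then show ?thesis using B \<open>z \<in> Z\<close> by (auto simp: Z_def)
    qed
    then show "x * z \<in> Z" by (auto simp: Z_def)
    have "k \<in> B" if k: "k \<in> Poly_Mapping.keys (z * x)" for k
    proof -
      obtain a b where "a \<in> Poly_Mapping.keys z" "k = a + b" using keys_mult[of z x] k by blast
      then show ?thesis using B \<open>z \<in> Z\<close> by (auto simp: Z_def)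
    qed
    then show "z * x \<in> Z" by (auto simp: Z_def)
  qed
  have Z_zero: "0 \<in> Z" by (simp add: Z_def)
  have split: "\<exists>c f z. f \<in> carrier (free_alg G) \<and> z \<in> Z \<and> x = scal c + f + z" for x :: "('v, 'e, 'k) free_elem"
  proof -
    have "Poly_Mapping.keys x \<subseteq> UNIV" by simp
    then show ?thesis
    proof (induction x rule: poly_mapping_induct_keys)
      case zero
      show ?case by (intro exI[of _ 0]) (simp add: Z_zero free_alg_simps)
    next
      case (add w d g)
      then obtain c f z where g: "f \<in> carrier (free_alg G)" "z \<in> Z" "g = scal c + f + z" by blast
      consider "w = 0" | "w \<in> gen_words G" | "w \<in> B" by (auto simp: gen_words_def B_def)
      then show ?case
      proof cases
        case 1
        then show ?thesis
          by - (rule exI[of _ "d + c"], rule exI[of _ f], rule exI[of _ z], use g in \<open>simp add: single_add add_ac\<close>)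
      next
        case 2
        then have "Poly_Mapping.single w d \<in> carrier (free_alg G)" by (simp add: free_alg_simps)
        then show ?thesis
          by - (rule exI[of _ c], rule exI[of _ "Poly_Mapping.single w d + f"], rule exI[of _ z],
            use g free_alg_closed(1) in \<open>simp add: add_ac\<close>)
      next
        case 3
        then have "Poly_Mapping.single w d \<in> Z" by (simp add: Z_def)
        then show ?thesis
          by - (rule exI[of _ c], rule exI[of _ f], rule exI[of _ "Poly_Mapping.single w d + z"],
            use g Z_add in \<open>simp add: add_ac\<close>)
      qed
    qed
  qed
  define K where "K = {i + z | i z. i \<in> J \<and> z \<in> Z}"
  have K0: "0 \<in> K" unfolding K_def using Jf(2) Z_zero by (auto intro!: exI[of _ 0])
  have K_add: "x + y \<in> K" if xy: "x \<in> K" "y \<in> K" for x y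
  proof -
    obtain i z j z' where "i \<in> J" "z \<in> Z" "j \<in> J" "z' \<in> Z" "x = i + z" "y = j + z'" using xy unfolding K_def by blast
    then have "i + j \<in> J" "z + z' \<in> Z" "x + y = (i + j) + (z + z')" using Jf(3) Z_add by (auto simp: add_ac)
    then show ?thesis unfolding K_def by blast
  qed
  have K_left: "r * x \<in> K" if xK: "x \<in> K" for x r
  proof -
    obtain i z where x: "i \<in> J" "z \<in> Z" "x = i + z" using xK unfolding K_def by blast
    obtain c f z' where r: "f \<in> carrier (free_alg G)" "z' \<in> Z" "r = scal c + f + z'" using split by blast
    have "r * x = (scal c * i + f * i) + (z' * i + r * z)" using x r by (simp add: algebra_simps)
    moreover have "scal c * i + f * i \<in> J" using x r by (intro Jf(3) scal Jm(1))
    moreover have "z' * i + r * z \<in> Z" using x r Z_mult Z_add by blast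
    ultimately show ?thesis unfolding K_def by blast
  qed
  have K_right: "x * r \<in> K" if xK: "x \<in> K" for x r
  proof -
    obtain i z where x: "i \<in> J" "z \<in> Z" "x = i + z" using xK unfolding K_def by blast
    obtain c f z' where r: "f \<in> carrier (free_alg G)" "z' \<in> Z" "r = scal c + f + z'" using split by blast
    have "x * r = (scal c * i + i * f) + (i * z' + z * r)" using x r scal_comm[of c i] by (simp add: algebra_simps)
    moreover have "scal c * i + i * f \<in> J" using x r by (intro Jf(3) scal Jm(2))
    moreover have "i * z' + z * r \<in> Z" using x r Z_mult Z_add by blast
    ultimately show ?thesis unfolding K_def by blast
  qed
  have KJ: "f \<in> K \<longleftrightarrow> f \<in> J" if f: "f \<in> carrier (free_alg G)" for f
  proof
    assume "f \<in> J"
    then have "f + 0 \<in> K" unfolding K_def using Z_zero by blast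
    then show "f \<in> K" by simp
  next
    assume "f \<in> K"
    then obtain i z where x: "i \<in> J" "z \<in> Z" "f = i + z" by (auto simp: K_def)
    then have "z = f - i" by simp
    then have "z \<in> carrier (free_alg G)" using f x Jf(1) free_alg_closed(2)[of f G i] by auto
    then have "Poly_Mapping.keys z \<subseteq> gen_words G \<inter> B" using x by (simp add: Z_def free_alg_simps)
    moreover have "gen_words G \<inter> B = {}" by (auto simp: gen_words_def B_def)
    ultimately have "Poly_Mapping.keys z = {}" by blast
    then have "z = 0" by simp
    then show "f \<in> J" using x by simp
  qed
  have "\<exists>(\<rho> :: ('v, 'e, 'k) free_elem \<Rightarrow> ('v, 'e, 'k) free_elem endo) (kap :: 'k \<Rightarrow> ('v, 'e, 'k) free_elem endo).
    (\<forall>f g. \<rho> (f + g) = \<rho> f + \<rho> g) \<and> (\<forall>f g. \<rho> (f * g) = \<rho> f * \<rho> g) \<and> (\<forall>f. \<rho> f = 0 \<longleftrightarrow> f \<in> K) \<and>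
    kap 1 = 1 \<and> (\<forall>c d. kap (c + d) = kap c + kap d) \<and> (\<forall>c d. kap (c * d) = kap c * kap d) \<and>
    (\<forall>c f. kap c * \<rho> f = \<rho> f * kap c) \<and> (\<forall>c f. \<rho> (scal c * f) = kap c * \<rho> f)"
    by (rule ring_with_prescribed_kernel) (use K0 K_add K_left K_right scal_comm in \<open>auto simp: single_add mult_single\<close>)
  then obtain \<rho> :: "('v, 'e, 'k) free_elem \<Rightarrow> ('v, 'e, 'k) free_elem endo"
    and kap :: "'k \<Rightarrow> ('v, 'e, 'k) free_elem endo" where
    \<rho>: "\<forall>f g. \<rho> (f + g) = \<rho> f + \<rho> g" "\<forall>f g. \<rho> (f * g) = \<rho> f * \<rho> g" "\<forall>f. \<rho> f = 0 \<longleftrightarrow> f \<in> K"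
    "kap 1 = 1" "\<forall>c d. kap (c + d) = kap c + kap d" "\<forall>c d. kap (c * d) = kap c * kap d"
    "\<forall>c f. kap c * \<rho> f = \<rho> f * kap c" "\<forall>c f. \<rho> (scal c * f) = kap c * \<rho> f"
    by (elim exE conjE) (rule that)
  have "leavitt_quotient G J \<rho> kap"
    by (rule leavitt_quotient.intro) (use \<rho> G KJ Jf(1) rel in simp_all)
  then show ?thesis by blast
qed

section \<open>Prime non-graded ideals are primitive\<close>

lemma free_alg_degree_decomp:
  fixes f :: "('v, 'e, 'k::field) free_elem"
  assumes "f \<in> carrier (free_alg G)"
  shows "\<exists>N y. finite N \<and> f = (\<Sum>n\<in>N. y n) \<and>
    (\<forall>n. y n \<in> carrier (free_alg G) \<and> (\<forall>w\<in>Poly_Mapping.keys (y n). word_degree w = n))"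
proof -
  have "Poly_Mapping.keys f \<subseteq> gen_words G" using assms by (simp add: free_alg_simps)
  then have "\<exists>N y. finite N \<and> f = (\<Sum>n\<in>N. y n) \<and> (\<forall>n. n \<notin> N \<longrightarrow> y n = 0) \<and>
    (\<forall>n. y n \<in> carrier (free_alg G) \<and> (\<forall>w\<in>Poly_Mapping.keys (y n). word_degree w = n))"
  proof (induction f rule: poly_mapping_induct_keys)
    case zero
    show ?case by (intro exI[of _ "{}"] exI[of _ "\<lambda>_. 0"]) (simp add: free_alg_simps)
  next
    case (add w c g)
    then obtain N y where y: "finite N" "g = (\<Sum>n\<in>N. y n)" "\<And>n. n \<notin> N \<Longrightarrow> y n = 0"
      "\<And>n. y n \<in> carrier (free_alg G)" "\<And>n w. w \<in> Poly_Mapping.keys (y n) \<Longrightarrow> word_degree w = n" by blast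
    let ?d = "word_degree w" and ?s = "Poly_Mapping.single w c"
    let ?y = "y(?d := ?s + y ?d)"
    have sc: "?s \<in> carrier (free_alg G)" using add(1) by (simp add: free_alg_simps)
    have "(\<Sum>n\<in>insert ?d N. ?y n) = (\<Sum>n\<in>insert ?d N. (if n = ?d then ?s else 0) + y n)"
      by (intro sum.cong) auto
    also have "\<dots> = ?s + (\<Sum>n\<in>insert ?d N. y n)" using y(1) by (simp add: sum.distrib)
    also have "(\<Sum>n\<in>insert ?d N. y n) = (\<Sum>n\<in>N. y n)"
      using y(1,3) by (cases "?d \<in> N") (simp_all add: insert_absorb)
    finally have "?s + g = (\<Sum>n\<in>insert ?d N. ?y n)" using y(2) by simp
    moreover have "word_degree v = n" if "v \<in> Poly_Mapping.keys (?y n)" for v n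
      using that y(5) Poly_Mapping.keys_add[of ?s "y ?d"] by (auto split: if_splits)
    moreover have "?y n \<in> carrier (free_alg G)" for n
      using y(4) sc free_alg_closed(1) by auto
    moreover have "finite (insert ?d N)" "\<forall>n. n \<notin> insert ?d N \<longrightarrow> ?y n = 0" using y(1,3) by auto
    ultimately show ?case
      by - (rule exI[of _ "insert ?d N"], rule exI[of _ ?y], blast)
  qed
  then show ?thesis by blast
qed

context
  fixes G :: "('v, 'e) ugraph" and I :: "('v, 'e, 'k::field) free_elem set set"
  assumes G: "ultragraph G" and I: "two_sided_ideal I (lpa G)"
begin

abbreviation F :: "('v, 'e, 'k) free_elem ring" where "F \<equiv> free_alg G"
abbreviation L :: "('v, 'e, 'k) free_elem set" where "L \<equiv> lpa_ideal G"

text \<open>The class of an element of the free algebra in the Leavitt path algebra.\<close>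

definition cls :: "('v, 'e, 'k) free_elem \<Rightarrow> ('v, 'e, 'k) free_elem set" where
  "cls f = L +>\<^bsub>F\<^esub> f"

lemma F_ring: "nonunital_ring F" by (rule nonunital_ring_free_alg)
lemma L_ring: "nonunital_ring (lpa G :: ('v, 'e, 'k) free_elem set ring)" by (rule nonunital_ring_lpa[OF G])
lemma L_ideal: "two_sided_ideal L F" by (rule two_sided_ideal_lpa_ideal[OF G])

lemma cls_facts:
  "carrier (lpa G) = cls ` carrier F" "\<zero>\<^bsub>lpa G\<^esub> = cls 0"
  "\<And>f g. \<lbrakk>f \<in> carrier F; g \<in> carrier F\<rbrakk> \<Longrightarrow> cls f \<otimes>\<^bsub>lpa G\<^esub> cls g = cls (f * g)"
  "\<And>f g. \<lbrakk>f \<in> carrier F; g \<in> carrier F\<rbrakk> \<Longrightarrow> cls f \<oplus>\<^bsub>lpa G\<^esub> cls g = cls (f + g)"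
  "\<And>f. f \<in> carrier F \<Longrightarrow> cls f = cls 0 \<longleftrightarrow> f \<in> L"
proof -
  note q = nonunital_ring.Quot_facts[OF F_ring L_ideal, folded lpa_def cls_def, unfolded free_alg_simps(2-4)]
  have z: "(0 :: ('v, 'e, 'k) free_elem) \<in> carrier F" "(0 :: ('v, 'e, 'k) free_elem) \<in> L"
    using nonunital_ring.two_sided_ideal_facts(2)[OF F_ring L_ideal] by (simp_all add: free_alg_simps)
  have cl0: "cls 0 = L" using q(5) z by blast
  show "carrier (lpa G) = cls ` carrier F" using q(1) by auto
  show "\<zero>\<^bsub>lpa G\<^esub> = cls 0" using q(2) cl0 by simp
  show "\<And>f g. \<lbrakk>f \<in> carrier F; g \<in> carrier F\<rbrakk> \<Longrightarrow> cls f \<otimes>\<^bsub>lpa G\<^esub> cls g = cls (f * g)"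
    "\<And>f g. \<lbrakk>f \<in> carrier F; g \<in> carrier F\<rbrakk> \<Longrightarrow> cls f \<oplus>\<^bsub>lpa G\<^esub> cls g = cls (f + g)"
    "\<And>f. f \<in> carrier F \<Longrightarrow> cls f = cls 0 \<longleftrightarrow> f \<in> L" using q(3-5) cl0 by auto
qed

lemma cls_eqI:
  assumes "f \<in> carrier F" "g \<in> carrier F" "f - g \<in> L" shows "cls f = cls g"
proof -
  interpret R: nonunital_ring "lpa G :: ('v, 'e, 'k) free_elem set ring" by (rule L_ring)
  have fg: "f - g \<in> carrier F" using assms by (intro free_alg_closed)
  have "cls f = cls ((f - g) + g)" by simp
  also have "\<dots> = cls 0 \<oplus>\<^bsub>lpa G\<^esub> cls g" using cls_facts(4)[OF fg assms(2)] cls_facts(5)[OF fg] assms by simp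
  also have "\<dots> = cls g" using R.l_zero[of "cls g"] cls_facts(1,2) assms by auto
  finally show ?thesis .
qed

lemma lpa_local_units:
  assumes f: "f \<in> carrier F"
  shows "\<exists>e\<in>carrier F. e * f - f \<in> L" "\<exists>e\<in>carrier F. f * e - f \<in> L"
proof -
  interpret FF: nonunital_ring F by (rule F_ring)
  have "lpa_relations G \<subseteq> L" "\<And>c f. f \<in> L \<Longrightarrow> scal c * f \<in> L" unfolding lpa_ideal_def by blast+
  then obtain \<rho> :: "('v, 'e, 'k) free_elem \<Rightarrow> ('v, 'e, 'k) free_elem endo" and kap where
    "leavitt_quotient G L \<rho> kap" using leavitt_quotient_exists[OF G L_ideal] by blast
  then interpret leavitt_quotient G L \<rho> kap .
  note u = local_units[OF rho_corner[OF f]]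
  obtain A where A: "A \<in> gen_verts G" "\<rho> (pp A) * \<rho> f = \<rho> f" using u(1) by blast
  have "\<rho> (pp A * f - f) = 0" using A by (simp add: rho_diff rho_mult)
  then have "pp A * f - f \<in> L"
    using rho_zero_iff by (simp add: free_alg_closed generators_closed A(1) f)
  then show "\<exists>e\<in>carrier F. e * f - f \<in> L" by (rule bexI) (rule generators_closed(1)[OF A(1)])
  obtain A where A: "A \<in> gen_verts G" "\<rho> f * \<rho> (pp A) = \<rho> f" using u(2) by blast
  have "\<rho> (f * pp A - f) = 0" using A by (simp add: rho_diff rho_mult)
  then have "f * pp A - f \<in> L"
    using rho_zero_iff by (simp add: free_alg_closed generators_closed A(1) f)
  then show "\<exists>e\<in>carrier F. f * e - f \<in> L" by (rule bexI) (rule generators_closed(1)[OF A(1)])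
qed

text \<open>The preimage of \<open>I\<close> in the free algebra.\<close>

definition preim :: "('v, 'e, 'k) free_elem set" where "preim = {f \<in> carrier F. cls f \<in> I}"

lemma preim_ideal: "two_sided_ideal preim F"
proof -
  interpret R: nonunital_ring "lpa G :: ('v, 'e, 'k) free_elem set ring" by (rule L_ring)
  interpret FF: nonunital_ring F by (rule F_ring)
  note If = R.two_sided_ideal_facts[OF I] and Im = two_sided_idealD(2,3)[OF I]
  show ?thesis
  proof (rule FF.two_sided_idealI)
    show "\<zero>\<^bsub>F\<^esub> \<in> preim" using If(2) cls_facts(2) by (simp add: preim_def free_alg_simps)
  next
    fix f g assume f: "f \<in> preim" "g \<in> preim"
    then show "f \<oplus>\<^bsub>F\<^esub> g \<in> preim" using If(3)[of "cls f" "cls g"] cls_facts(4)[of f g]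
      by (simp add: preim_def free_alg_simps(2-4) free_alg_closed)
  next
    fix f assume f: "f \<in> preim"
    then have fc: "f \<in> carrier F" "- f \<in> carrier F" by (auto simp: preim_def free_alg_closed)
    have "cls (- f) \<oplus>\<^bsub>lpa G\<^esub> cls f = \<zero>\<^bsub>lpa G\<^esub>" using cls_facts(2,4) fc by simp
    then have "cls (- f) = \<ominus>\<^bsub>lpa G\<^esub> (cls f)" using R.minus_equality[of "cls (- f)" "cls f"] fc cls_facts(1) by auto
    then have "- f \<in> preim" using If(4)[of "cls f"] f fc by (simp add: preim_def)
    moreover have "\<ominus>\<^bsub>F\<^esub> f = - f" using FF.minus_equality[of "- f" f] fc by (simp add: free_alg_simps(2-4))
    ultimately show "\<ominus>\<^bsub>F\<^esub> f \<in> preim" by simp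
  next
    fix f r assume f: "f \<in> preim" "r \<in> carrier F"
    then have "cls r \<in> carrier (lpa G)" using cls_facts(1) by blast
    then show "r \<otimes>\<^bsub>F\<^esub> f \<in> preim" "f \<otimes>\<^bsub>F\<^esub> r \<in> preim"
      using f Im[of "cls f" "cls r"] cls_facts(3)[of f r] cls_facts(3)[of r f]
      by (simp_all add: preim_def free_alg_simps(2-4) free_alg_closed)
  qed (auto simp: preim_def)
qed

lemma lpa_ideal_subset_preim: "f \<in> L \<Longrightarrow> f \<in> preim"
proof -
  interpret R: nonunital_ring "lpa G :: ('v, 'e, 'k) free_elem set ring" by (rule L_ring)
  interpret FF: nonunital_ring F by (rule F_ring)
  assume f: "f \<in> L"
  then have fc: "f \<in> carrier F" using FF.two_sided_ideal_facts(1)[OF L_ideal] by blast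
  then have "cls f = cls 0" using cls_facts(5) f by blast
  then show ?thesis using fc R.two_sided_ideal_facts(2)[OF I] cls_facts(2) by (simp add: preim_def)
qed

text \<open>Ring ideals of an algebra without unit need not be closed under scalars; here they are, as there are
  local units \<open>e\<close>, and \<open>c f = (c e) f\<close>.\<close>

lemma preim_scal:
  assumes f: "f \<in> preim" shows "scal c * f \<in> preim"
proof -
  interpret FF: nonunital_ring F by (rule F_ring)
  note Jf = FF.two_sided_ideal_facts[OF preim_ideal, unfolded free_alg_simps(2-4)]
  note Jm = two_sided_idealD(2,3)[OF preim_ideal, unfolded free_alg_simps(2-4)]
  have fc: "f \<in> carrier F" using f by (simp add: preim_def)
  obtain e where e: "e \<in> carrier F" "e * f - f \<in> L" using lpa_local_units(1)[OF fc] by blast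
  have "scal c * (e * f - f) \<in> L" using e unfolding lpa_ideal_def by blast
  then have 1: "scal c * (e * f - f) \<in> preim" by (rule lpa_ideal_subset_preim)
  have 2: "(scal c * e) * f \<in> preim" using e f by (intro Jm(1) scal_closed)
  have m1: "- (scal c * (e * f - f)) \<in> preim"
  proof -
    have c: "scal c * (e * f - f) \<in> carrier F" using 1 Jf(1) by blast
    have "\<ominus>\<^bsub>F\<^esub> (scal c * (e * f - f)) = - (scal c * (e * f - f))"
      using FF.minus_equality[of "- (scal c * (e * f - f))" "scal c * (e * f - f)"] c free_alg_closed(4)[OF c c]
      by (simp add: free_alg_simps(2-4))
    then show ?thesis using Jf(4)[OF 1] by simp
  qed
  have "scal c * f = (scal c * e) * f + - (scal c * (e * f - f))" by (simp add: algebra_simps)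
  then show ?thesis using Jf(3)[OF 2 m1] by simp
qed

text \<open>The quotient of the free algebra by the preimage of \<open>I\<close> is a prime algebra generated by a family as
  above, and its homogeneous elements are dependent. So it has a corner that is a field, and the same
  holds for the isomorphic quotient by \<open>I\<close>.\<close>

lemma primitive_if_prime:
  assumes ng: "\<not> graded_ideal (lpa_component G) I (lpa G)"
    and prime: "prime_two_sided_ideal I (lpa G)"
  shows "left_primitive_ideal I (lpa G)"
proof -
  interpret R: nonunital_ring "lpa G :: ('v, 'e, 'k) free_elem set ring" by (rule L_ring)
  interpret FF: nonunital_ring F by (rule F_ring)
  have rel: "lpa_relations G \<subseteq> preim"
  proof
    fix x :: "('v, 'e, 'k) free_elem" assume "x \<in> lpa_relations G"
    then have "x \<in> L" unfolding lpa_ideal_def by blast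
    then show "x \<in> preim" by (rule lpa_ideal_subset_preim)
  qed
  obtain \<rho> :: "('v, 'e, 'k) free_elem \<Rightarrow> ('v, 'e, 'k) free_elem endo" and kap where
    "leavitt_quotient G preim \<rho> kap" using leavitt_quotient_exists[OF G preim_ideal preim_scal rel] by blast
  then interpret leavitt_quotient G preim \<rho> kap .
  \<comment> \<open>an element of \<open>I\<close> not all of whose components lie in \<open>I\<close> yields a relation between homogeneous elements\<close>
  have dep_ex: "\<exists>v. dependent v"
  proof -
    obtain x where x: "x \<in> I" "\<And>N y. \<lbrakk>finite N; \<And>n. n \<in> N \<Longrightarrow> y n \<in> I \<inter> lpa_component G n\<rbrakk>
      \<Longrightarrow> x \<noteq> (\<Oplus>\<^bsub>lpa G\<^esub>n\<in>N. y n)"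
      using ng I unfolding graded_ideal_def by blast
    obtain f where f: "f \<in> carrier F" "x = cls f" using x(1) R.two_sided_ideal_facts(1)[OF I] cls_facts(1) by auto
    obtain N y where y: "finite N" "f = (\<Sum>n\<in>N. y n)" "\<And>n. y n \<in> carrier F"
      "\<And>n w. w \<in> Poly_Mapping.keys (y n) \<Longrightarrow> word_degree w = n" using free_alg_degree_decomp[OF f(1)] by blast
    have clsc: "cls (y n) \<in> carrier (lpa G)" for n using y(3) cls_facts(1) by blast
    have "cls (\<Sum>n\<in>N. y n) = (\<Oplus>\<^bsub>lpa G\<^esub>n\<in>N. cls (y n))"
      using y(1)
    proof (induction N rule: finite_induct)
      case empty
      then show ?case using cls_facts(2) by simp
    next
      case (insert n N)
      then have "(\<Oplus>\<^bsub>lpa G\<^esub>n\<in>insert n N. cls (y n)) = cls (y n) \<oplus>\<^bsub>lpa G\<^esub> cls (\<Sum>n\<in>N. y n)"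
        using clsc by simp
      also have "\<dots> = cls (y n + (\<Sum>n\<in>N. y n))" using y(3) by (intro cls_facts(4) free_alg_sum_closed)
      finally show ?case using insert by simp
    qed
    then have xs: "x = (\<Oplus>\<^bsub>lpa G\<^esub>n\<in>N. cls (y n))" using f y by simp
    have "cls (y n) \<in> lpa_component G n" for n
      unfolding lpa_component_def cls_def using y(3,4) by blast
    then obtain m where m: "m \<in> N" "cls (y m) \<notin> I" using x(2)[OF y(1), of "\<lambda>n. cls (y n)"] xs by blast
    have "\<rho> (y m) \<noteq> 0" using rho_zero_iff[OF y(3)] m by (simp add: preim_def)
    moreover have "(\<Sum>n\<in>N. \<rho> (y n)) = 0"
      using rho_zero_iff[OF f(1)] f x(1) y(2) by (simp add: rho_sum[symmetric] preim_def)
    ultimately show ?thesis using dependent_exists[OF y(1), of "\<lambda>n. \<rho> (y n)" m] m rho_homog[OF y(3,4)] by blast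
  qed
  define w where "w = (LEAST v. dependent v)"
  interpret leavitt_dependent G kap "\<lambda>A. \<rho> (pp A)" "\<lambda>e. \<rho> (ss e)" "\<lambda>e. \<rho> (gg e)" w
    using LeastI_ex[OF dep_ex] not_less_Least by unfold_locales (auto simp: w_def)
  have units: "\<exists>e\<in>carrier (lpa G). x \<otimes>\<^bsub>lpa G\<^esub> e = x" if "x \<in> carrier (lpa G)" for x :: "('v, 'e, 'k) free_elem set"
  proof -
    obtain f where f: "f \<in> carrier F" "x = cls f" using \<open>x \<in> carrier (lpa G)\<close> cls_facts(1) by auto
    obtain e where e: "e \<in> carrier F" "f * e - f \<in> L" using lpa_local_units(2)[OF f(1)] by blast
    have "cls (f * e) = cls f" using f e by (intro cls_eqI free_alg_closed)
    then show ?thesis using f e cls_facts(1,3) by force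
  qed
  have primeF: "f \<in> preim \<or> g \<in> preim"
    if f: "f \<in> carrier F" "g \<in> carrier F" and fg: "\<And>h. h \<in> carrier F \<Longrightarrow> f * h * g \<in> preim" for f g
  proof -
    have "cls f \<in> I \<or> cls g \<in> I"
    proof (rule R.prime_elementwise[OF prime units])
      show "cls f \<in> carrier (lpa G)" "cls g \<in> carrier (lpa G)" using f cls_facts(1) by auto
      fix r :: "('v, 'e, 'k) free_elem set" assume "r \<in> carrier (lpa G)"
      then obtain h where h: "h \<in> carrier F" "r = cls h" using cls_facts(1) by auto
      have "cls f \<otimes>\<^bsub>lpa G\<^esub> r \<otimes>\<^bsub>lpa G\<^esub> cls g = cls (f * h * g)"
        using f h by (simp add: cls_facts(3) free_alg_closed)
      then show "cls f \<otimes>\<^bsub>lpa G\<^esub> r \<otimes>\<^bsub>lpa G\<^esub> cls g \<in> I" using fg[OF h(1)] by (simp add: preim_def)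
    qed
    then show ?thesis using f by (simp add: preim_def)
  qed
  have primeD: "x = 0 \<or> y = 0" if xy: "x \<in> corner 1" "y \<in> corner 1" "\<And>r. r \<in> corner 1 \<Longrightarrow> x * r * y = 0" for x y
  proof -
    obtain f g where f: "f \<in> carrier F" "x = \<rho> f" "g \<in> carrier F" "y = \<rho> g" using corner_rho xy(1,2) by blast
    have "f * h * g \<in> preim" if "h \<in> carrier F" for h
    proof -
      have "\<rho> (f * h * g) = 0" using xy(3)[OF rho_corner[OF that]] f by (simp add: rho_mult)
      then show ?thesis using rho_zero_iff f that by (simp add: free_alg_closed)
    qed
    then have "f \<in> preim \<or> g \<in> preim" using primeF f by blast
    then show ?thesis using f rho_zero_iff by auto
  qed
  obtain p where p: "p \<in> corner 1" "p \<noteq> 0" "p * p = p"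
    "\<And>x. \<lbrakk>x \<in> corner 1; p * x * p \<noteq> 0\<rbrakk> \<Longrightarrow> \<exists>z\<in>corner 1. z * (p * x * p) = p"
    using prime_dependent_has_field_corner[OF primeD] by blast
  obtain p' where p': "p' \<in> carrier F" "p = \<rho> p'" using corner_rho[OF p(1)] by blast
  \<comment> \<open>the quotient by \<open>I\<close> is the image of \<open>\<rho>\<close>; transfer the idempotent \<open>p\<close> back to it\<close>
  let ?Q = "lpa G Quot I"
  interpret Q: nonunital_ring ?Q by (rule R.nonunital_ring_Quot[OF I])
  define \<phi> where "\<phi> f = I +>\<^bsub>lpa G\<^esub> cls f" for f
  note q = R.Quot_facts[OF I]
  have \<phi>: "carrier ?Q = \<phi> ` carrier F" using q(1) cls_facts(1) by (auto simp: \<phi>_def)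
  have \<phi>_mult: "\<phi> f \<otimes>\<^bsub>?Q\<^esub> \<phi> g = \<phi> (f * g)" "\<phi> f \<oplus>\<^bsub>?Q\<^esub> \<phi> g = \<phi> (f + g)"
    if "f \<in> carrier F" "g \<in> carrier F" for f g
    using q(3,4)[of "cls f" "cls g"] that cls_facts(1,3,4) by (auto simp: \<phi>_def)
  have \<phi>_zero: "\<phi> f = \<zero>\<^bsub>?Q\<^esub> \<longleftrightarrow> \<rho> f = 0" if "f \<in> carrier F" for f
    using q(2) q(5)[of "cls f"] that cls_facts(1) rho_zero_iff[OF that] by (auto simp: \<phi>_def preim_def)
  have \<phi>_eq: "\<phi> f = \<phi> g" if fg: "f \<in> carrier F" "g \<in> carrier F" "\<rho> f = \<rho> g" for f g
  proof -
    have c: "f - g \<in> carrier F" using fg by (intro free_alg_closed)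
    have "\<phi> f = \<phi> ((f - g) + g)" by simp
    also have "\<dots> = \<phi> (f - g) \<oplus>\<^bsub>?Q\<^esub> \<phi> g" using \<phi>_mult(2)[OF c fg(2)] by simp
    also have "\<phi> (f - g) = \<zero>\<^bsub>?Q\<^esub>" using \<phi>_zero[OF c] fg(3) by (simp add: rho_diff)
    finally show ?thesis using Q.l_zero[of "\<phi> g"] fg(2) \<phi> by auto
  qed
  have "left_primitive_ring ?Q"
  proof (rule Q.left_primitive_if_field_corner[of "\<phi> p'"])
    fix x y assume x: "x \<in> carrier ?Q" "y \<in> carrier ?Q"
      and xy: "\<And>r. r \<in> carrier ?Q \<Longrightarrow> x \<otimes>\<^bsub>?Q\<^esub> r \<otimes>\<^bsub>?Q\<^esub> y = \<zero>\<^bsub>?Q\<^esub>"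
    obtain f g where f: "f \<in> carrier F" "x = \<phi> f" "g \<in> carrier F" "y = \<phi> g" using x \<phi> by auto
    have "f * h * g \<in> preim" if h: "h \<in> carrier F" for h
    proof -
      have "\<phi> h \<in> carrier ?Q" using h \<phi> by blast
      then have "\<phi> (f * h * g) = \<zero>\<^bsub>?Q\<^esub>" using xy[of "\<phi> h"] f h by (simp add: \<phi>_mult free_alg_closed)
      then show ?thesis using \<phi>_zero rho_zero_iff f h by (simp add: free_alg_closed)
    qed
    then have "f \<in> preim \<or> g \<in> preim" using primeF f by blast
    then show "x = \<zero>\<^bsub>?Q\<^esub> \<or> y = \<zero>\<^bsub>?Q\<^esub>" using f \<phi>_zero rho_zero_iff by auto
  next
    show "\<phi> p' \<in> carrier ?Q" using p' \<phi> by blast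
    show "\<phi> p' \<noteq> \<zero>\<^bsub>?Q\<^esub>" using p' p(2) \<phi>_zero by auto
    show "\<phi> p' \<otimes>\<^bsub>?Q\<^esub> \<phi> p' = \<phi> p'" unfolding \<phi>_mult(1)[OF p'(1) p'(1)]
      by (rule \<phi>_eq) (use p' p(3) in \<open>simp_all add: free_alg_closed rho_mult\<close>)
  next
    fix x assume x: "x \<in> carrier ?Q" "\<phi> p' \<otimes>\<^bsub>?Q\<^esub> x \<otimes>\<^bsub>?Q\<^esub> \<phi> p' \<noteq> \<zero>\<^bsub>?Q\<^esub>"
    obtain f where f: "f \<in> carrier F" "x = \<phi> f" using x \<phi> by auto
    have c: "p' * f * p' \<in> carrier F" using p' f by (intro free_alg_closed)
    have e: "\<phi> p' \<otimes>\<^bsub>?Q\<^esub> x \<otimes>\<^bsub>?Q\<^esub> \<phi> p' = \<phi> (p' * f * p')" using p' f by (simp add: \<phi>_mult free_alg_closed)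
    have "p * \<rho> f * p \<noteq> 0" using x(2) \<phi>_zero[OF c] e p' by (simp add: rho_mult)
    then obtain z where z: "z \<in> corner 1" "z * (p * \<rho> f * p) = p" using p(4)[OF rho_corner[OF f(1)]] by blast
    obtain h where h: "h \<in> carrier F" "z = \<rho> h" using corner_rho[OF z(1)] by blast
    have "\<phi> (h * (p' * f * p')) = \<phi> p'"
      by (rule \<phi>_eq) (use p' z h c in \<open>simp_all add: free_alg_closed rho_mult\<close>)
    then have "\<phi> h \<otimes>\<^bsub>?Q\<^esub> (\<phi> p' \<otimes>\<^bsub>?Q\<^esub> x \<otimes>\<^bsub>?Q\<^esub> \<phi> p') = \<phi> p'" using e \<phi>_mult(1)[OF h(1) c] by simp
    then show "\<exists>z\<in>carrier ?Q. z \<otimes>\<^bsub>?Q\<^esub> (\<phi> p' \<otimes>\<^bsub>?Q\<^esub> x \<otimes>\<^bsub>?Q\<^esub> \<phi> p') = \<phi> p'" using h \<phi> by blast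
  qed
  then show ?thesis using I by (simp add: left_primitive_ideal_def)
qed

end

theorem theorem4p4:
  fixes G :: "('v, 'e) ugraph"
    and I :: "('v, 'e, 'k::field) free_elem set set"
  assumes "ultragraph G"
    and "two_sided_ideal I (lpa G)"
    and "\<not> graded_ideal (lpa_component G) I (lpa G)"
  shows "prime_two_sided_ideal I (lpa G) \<longleftrightarrow> left_primitive_ideal I (lpa G)"
  using primitive_if_prime[OF assms] nonunital_ring.prime_if_left_primitive[OF nonunital_ring_lpa[OF assms(1)]]
  by blast

end
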